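(* Let $\mathbb{K}=\mathbb{C}$ and let $H$ be the free Hopf algebra generated by the coalgebra $(\mathbb{C}^{2\times 2})^\ast$ dual to the algebra of $2\times 2$ complex matrices, with matrix coefficients $a^i_j\in H$ ($i,j\in\{0,1\}$). Let $A:=H$, $\delta:=\Delta: H\to H\otimes H$ (the comultiplication, viewed as an algebra left coaction of $H$ on itself), and let $M:=H\oplus H$ as a left $H$-module. Let $$\theta:M\to\delta^\ast M=(H\otimes H)_\Delta\otimes_H M,$$ $$\theta(k^0,k^1):=\left(a^0_0\otimes k^0+a^0_1\otimes k^1\right)\otimes(1,0)+\left(a^1_0\otimes k^0+a^1_1\otimes k^1\right)\otimes(0,1),$$ and let $\Theta:H\otimes M\to (H\otimes H)_\Delta\otimes_H M$ be the left $(H\otimes H)$-module homomorphism determined by $\Theta(1\otimes m)=\theta(m)$ for all $m\in M$. Then $\Theta$ satisfies the two conditions $$(\mathrm{id}_H\otimes\delta)^\ast\Theta\circ(\eta\otimes\mathrm{id}_{H\otimes A})^\ast\Theta=(\Delta\otimes\mathrm{id}_A)^\ast\Theta,\qquad (\varepsilon\otimes\mathrm{id}_A)^\ast\Theta=\mathrm{id}_M,$$ but $\Theta$ is not an isomorphism.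
   Context: Unadorned tensor products are over the base field; algebras are associative and unital, modules unital. The free Hopf algebra $H$ generated by a coalgebra $C$ is the Hopf algebra equipped with a coalgebra morphism $C\to H$ that is universal among coalgebra morphisms from $C$ into Hopf algebras (every coalgebra morphism from $C$ to a Hopf algebra $K$ factors uniquely through a Hopf algebra morphism $H\to K$). For $C=(\mathbb{C}^{2\times 2})^\ast$, the $a^i_j$ denote the images in $H$ of the matrix coefficients (the basis of $C$ dual to the matrix units), so that $\Delta(a^i_j)=\sum_l a^i_l\otimes a^l_j$ and $\varepsilon(a^i_j)$ is $1$ if $i=j$ and $0$ otherwise. Here $\Delta,\varepsilon,\eta$ are the comultiplication, counit and unit of $H$. For an algebra homomorphism $\varphi:A\to B$ and a left $A$-module $M$, $\varphi^\ast M:=B\otimes_A M$ ($B$ being a right $A$-module via $\varphi$), a left $B$-module, with natural map $M\to\varphi^\ast M$, $m\mapsto 1\otimes m$; for an $A$-module homomorphism $g$, $\varphi^\ast g:=\mathrm{id}_B\otimes_A g$. For $\delta:A\to H\otimes A$, $(H\otimes A)_\delta$ denotes $H\otimes A$ with the right $A$-module structure induced by $\delta$, so $\delta^\ast M=(H\otimes A)_\delta\otimes_A M$, a left $(H\otimes A)$-module. $H\otimes M$ is a left $(H\otimes A)$-module by $(h\otimes a)(h'\otimes m)=hh'\otimes am$ and is identified with $(\eta\otimes\mathrm{id}_A)^\ast M$ (where $\eta\otimes\mathrm{id}_A:A\to H\otimes A$, $a\mapsto 1\otimes a$) via $(h\otimes a)\otimes m=h\otimes am$. Iterated extensions of scalars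 of $M$ along pairs of algebra maps with equal composites are identified via the unique isomorphism compatible with the natural maps from $M$. Explicitly, the two conditions are understood under the identifications $(\eta\otimes\mathrm{id}_{H\otimes A})^\ast\delta^\ast M=(\mathrm{id}_H\otimes\delta)^\ast(\eta\otimes\mathrm{id}_A)^\ast M$, $(\eta\otimes\mathrm{id}_{H\otimes A})^\ast(\eta\otimes\mathrm{id}_A)^\ast M=(\Delta\otimes\mathrm{id}_A)^\ast(\eta\otimes\mathrm{id}_A)^\ast M$, $(\mathrm{id}_H\otimes\delta)^\ast\delta^\ast M=(\Delta\otimes\mathrm{id}_A)^\ast\delta^\ast M$ (for the first condition), and $(\varepsilon\otimes\mathrm{id}_A)^\ast(\eta\otimes\mathrm{id}_A)^\ast M=M$, $(\varepsilon\otimes\mathrm{id}_A)^\ast\delta^\ast M=M$ (for the second). *)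

theory Defs
  imports "HOL-Analysis.Analysis" "HOL-Algebra.Module" "HOL-Algebra.Generated_Groups"
    "HOL-Algebra.Free_Abelian_Groups"
begin

section \<open>Modules over not necessarily commutative rings\<close>

text \<open>
  Left modules are given by the record type of \<^theory>\<open>HOL-Algebra.Module\<close>; when only the module
  structure is meant, the fields \<open>mult\<close> and \<open>one\<close> are irrelevant.
\<close>

definition lmod_hom ::
  "('r, 'x) ring_scheme \<Rightarrow> ('r, 'm, 'y) module_scheme \<Rightarrow> ('r, 'n, 'z) module_scheme \<Rightarrow> ('m \<Rightarrow> 'n) set"
  where "lmod_hom R M N =
    {f \<in> carrier M \<rightarrow> carrier N.
       (\<forall>x\<in>carrier M. \<forall>y\<in>carrier M. f (x \<oplus>\<^bsub>M\<^esub> y) = f x \<oplus>\<^bsub>N\<^esub> f y) \<and>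
       (\<forall>r\<in>carrier R. \<forall>x\<in>carrier M. f (r \<odot>\<^bsub>M\<^esub> x) = r \<odot>\<^bsub>N\<^esub> f x)}"

definition lmod_iso ::
  "('r, 'x) ring_scheme \<Rightarrow> ('r, 'm, 'y) module_scheme \<Rightarrow> ('r, 'n, 'z) module_scheme \<Rightarrow> ('m \<Rightarrow> 'n) set"
  where "lmod_iso R M N = {f \<in> lmod_hom R M N. bij_betw f (carrier M) (carrier N)}"

definition regular_module :: "('r, 'x) ring_scheme \<Rightarrow> ('r, 'r) module"
  where "regular_module R =
    \<lparr>carrier = carrier R, mult = mult R, one = \<one>\<^bsub>R\<^esub>, ring.zero = \<zero>\<^bsub>R\<^esub>, add = add R, smult = mult R\<rparr>"

definition dsum_module ::
  "('r, 'm, 'y) module_scheme \<Rightarrow> ('r, 'n, 'z) module_scheme \<Rightarrow> ('r, 'm \<times> 'n) module"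
  where "dsum_module M N =
    \<lparr>carrier = carrier M \<times> carrier N, mult = undefined, one = undefined,
     ring.zero = (\<zero>\<^bsub>M\<^esub>, \<zero>\<^bsub>N\<^esub>),
     add = (\<lambda>(x, y) (x', y'). (x \<oplus>\<^bsub>M\<^esub> x', y \<oplus>\<^bsub>N\<^esub> y')),
     smult = (\<lambda>r (x, y). (r \<odot>\<^bsub>M\<^esub> x, r \<odot>\<^bsub>N\<^esub> y))\<rparr>"


section \<open>Tensor products over a ring\<close>

text \<open>
  \<open>B \<otimes>\<^sub>R M\<close> for a right \<open>R\<close>-module \<open>B\<close>, with right action \<open>act\<close>, and a left \<open>R\<close>-module \<open>M\<close>:
  the free abelian group on pairs modulo the relations of biadditivity and \<open>R\<close>-balancedness.
\<close>

definition tensor_relators ::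
  "('r, 'x) ring_scheme \<Rightarrow> ('b, 'y) ring_scheme \<Rightarrow> ('b \<Rightarrow> 'r \<Rightarrow> 'b) \<Rightarrow> ('r, 'm, 'z) module_scheme
    \<Rightarrow> ('b \<times> 'm \<Rightarrow>\<^sub>0 int) set"
  where "tensor_relators R B act M =
    {frag_of (b \<oplus>\<^bsub>B\<^esub> b', m) - frag_of (b, m) - frag_of (b', m) | b b' m.
       b \<in> carrier B \<and> b' \<in> carrier B \<and> m \<in> carrier M} \<union>
    {frag_of (b, m \<oplus>\<^bsub>M\<^esub> m') - frag_of (b, m) - frag_of (b, m') | b m m'.
       b \<in> carrier B \<and> m \<in> carrier M \<and> m' \<in> carrier M} \<union>
    {frag_of (act b r, m) - frag_of (b, r \<odot>\<^bsub>M\<^esub> m) | b r m.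
       b \<in> carrier B \<and> r \<in> carrier R \<and> m \<in> carrier M}"

definition tensor_subgroup ::
  "('r, 'x) ring_scheme \<Rightarrow> ('b, 'y) ring_scheme \<Rightarrow> ('b \<Rightarrow> 'r \<Rightarrow> 'b) \<Rightarrow> ('r, 'm, 'z) module_scheme
    \<Rightarrow> ('b \<times> 'm \<Rightarrow>\<^sub>0 int) set"
  where "tensor_subgroup R B act M =
    generate (free_Abelian_group (carrier B \<times> carrier M)) (tensor_relators R B act M)"

definition tensor_group ::
  "('r, 'x) ring_scheme \<Rightarrow> ('b, 'y) ring_scheme \<Rightarrow> ('b \<Rightarrow> 'r \<Rightarrow> 'b) \<Rightarrow> ('r, 'm, 'z) module_scheme
    \<Rightarrow> ('b \<times> 'm \<Rightarrow>\<^sub>0 int) set ring"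
  where "tensor_group R B act M =
    (let Q = free_Abelian_group (carrier B \<times> carrier M) Mod tensor_subgroup R B act M
     in \<lparr>carrier = carrier Q, mult = undefined, one = undefined, ring.zero = \<one>\<^bsub>Q\<^esub>, add = mult Q\<rparr>)"

definition pure_tensor ::
  "('r, 'x) ring_scheme \<Rightarrow> ('b, 'y) ring_scheme \<Rightarrow> ('b \<Rightarrow> 'r \<Rightarrow> 'b) \<Rightarrow> ('r, 'm, 'z) module_scheme
    \<Rightarrow> 'b \<Rightarrow> 'm \<Rightarrow> ('b \<times> 'm \<Rightarrow>\<^sub>0 int) set"
  where "pure_tensor R B act M b m =
    tensor_subgroup R B act M #>\<^bsub>free_Abelian_group (carrier B \<times> carrier M)\<^esub> frag_of (b, m)"

text \<open>
  The additive map \<open>b \<otimes> m \<mapsto> f b m\<close> into \<open>G\<close> induced by a balanced biadditive map \<open>f\<close>. It is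
  evaluated on a representative of the coset \<open>X\<close>, the choice being immaterial for balanced
  biadditive \<open>f\<close>; it is used for such \<open>f\<close> only.
\<close>

definition tensor_lift ::
  "('c, 'x) ring_scheme \<Rightarrow> ('b \<Rightarrow> 'm \<Rightarrow> 'c) \<Rightarrow> ('b \<times> 'm \<Rightarrow>\<^sub>0 int) set \<Rightarrow> 'c"
  where "tensor_lift G f X =
    (let x = (SOME x. x \<in> X)
     in finsum G (\<lambda>p. add_pow G (Poly_Mapping.lookup x p) (f (fst p) (snd p)))
          (Poly_Mapping.keys x))"


section \<open>Complex vector spaces and algebras\<close>

definition complex_alg :: "(complex, complex) module"
  where "complex_alg =
    \<lparr>carrier = UNIV, mult = (*), one = 1, ring.zero = 0, add = (+), smult = (*)\<rparr>"

definition unital_algebra :: "(complex, 'a, 'x) module_scheme \<Rightarrow> bool"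
  where "unital_algebra A \<longleftrightarrow>
    Module.module complex_alg A \<and> ring A \<and>
    (\<forall>c. \<forall>x\<in>carrier A. \<forall>y\<in>carrier A.
       (c \<odot>\<^bsub>A\<^esub> x) \<otimes>\<^bsub>A\<^esub> y = c \<odot>\<^bsub>A\<^esub> (x \<otimes>\<^bsub>A\<^esub> y) \<and>
       x \<otimes>\<^bsub>A\<^esub> (c \<odot>\<^bsub>A\<^esub> y) = c \<odot>\<^bsub>A\<^esub> (x \<otimes>\<^bsub>A\<^esub> y))"

definition ctens ::
  "(complex, 'v, 'x) module_scheme \<Rightarrow> (complex, 'w, 'y) module_scheme
    \<Rightarrow> 'v \<Rightarrow> 'w \<Rightarrow> ('v \<times> 'w \<Rightarrow>\<^sub>0 int) set"
  where "ctens V W = pure_tensor complex_alg V (\<lambda>v c. c \<odot>\<^bsub>V\<^esub> v) W"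

text \<open>
  \<open>V \<otimes> W\<close> over the complex numbers, as a vector space; if \<open>V\<close> and \<open>W\<close> are algebras, it is the
  tensor product algebra.
\<close>

definition ctensor ::
  "(complex, 'v, 'x) module_scheme \<Rightarrow> (complex, 'w, 'y) module_scheme
    \<Rightarrow> (complex, ('v \<times> 'w \<Rightarrow>\<^sub>0 int) set) module"
  where "ctensor V W =
    (let T = tensor_group complex_alg V (\<lambda>v c. c \<odot>\<^bsub>V\<^esub> v) W
     in \<lparr>carrier = carrier T,
         mult = (\<lambda>X Y. tensor_lift T (\<lambda>v w. tensor_lift T
                   (\<lambda>v' w'. ctens V W (v \<otimes>\<^bsub>V\<^esub> v') (w \<otimes>\<^bsub>W\<^esub> w')) Y) X),
         one = ctens V W \<one>\<^bsub>V\<^esub> \<one>\<^bsub>W\<^esub>,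
         ring.zero = \<zero>\<^bsub>T\<^esub>,
         add = add T,
         smult = (\<lambda>c. tensor_lift T (\<lambda>v w. ctens V W (c \<odot>\<^bsub>V\<^esub> v) w))\<rparr>)"

text \<open>The map \<open>f \<otimes> g\<close> into \<open>V' \<otimes> W'\<close>, for linear \<open>f\<close> and \<open>g\<close>.\<close>

definition ctensor_map ::
  "(complex, 'v', 'x) module_scheme \<Rightarrow> (complex, 'w', 'y) module_scheme
    \<Rightarrow> ('v \<Rightarrow> 'v') \<Rightarrow> ('w \<Rightarrow> 'w') \<Rightarrow> ('v \<times> 'w \<Rightarrow>\<^sub>0 int) set \<Rightarrow> ('v' \<times> 'w' \<Rightarrow>\<^sub>0 int) set"
  where "ctensor_map V' W' f g = tensor_lift (ctensor V' W') (\<lambda>v w. ctens V' W' (f v) (g w))"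

text \<open>The associativity isomorphism from \<open>(U \<otimes> V) \<otimes> W\<close> to \<open>U \<otimes> (V \<otimes> W)\<close>.\<close>

definition ctensor_assoc ::
  "(complex, 'u, 'x) module_scheme \<Rightarrow> (complex, 'v, 'y) module_scheme \<Rightarrow> (complex, 'w, 'z) module_scheme
    \<Rightarrow> (('u \<times> 'v \<Rightarrow>\<^sub>0 int) set \<times> 'w \<Rightarrow>\<^sub>0 int) set \<Rightarrow> ('u \<times> ('v \<times> 'w \<Rightarrow>\<^sub>0 int) set \<Rightarrow>\<^sub>0 int) set"
  where "ctensor_assoc U V W =
    (let T = ctensor U (ctensor V W)
     in tensor_lift T (\<lambda>t w. tensor_lift T (\<lambda>u v. ctens U (ctensor V W) u (ctens V W v w)) t))"


section \<open>Coalgebras, bialgebras and Hopf algebras\<close>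

record 'a coalg = "(complex, 'a) module" +
  comult :: "'a \<Rightarrow> ('a \<times> 'a \<Rightarrow>\<^sub>0 int) set"
  counit :: "'a \<Rightarrow> complex"

definition coalgebra :: "('a, 'x) coalg_scheme \<Rightarrow> bool"
  where "coalgebra C \<longleftrightarrow>
    Module.module complex_alg C \<and>
    comult C \<in> lmod_hom complex_alg C (ctensor C C) \<and>
    counit C \<in> lmod_hom complex_alg C complex_alg \<and>
    (\<forall>c\<in>carrier C.
       ctensor_assoc C C C (ctensor_map (ctensor C C) C (comult C) id (comult C c)) =
         ctensor_map C (ctensor C C) id (comult C) (comult C c) \<and>
       tensor_lift C (\<lambda>x y. counit C x \<odot>\<^bsub>C\<^esub> y) (comult C c) = c \<and>
       tensor_lift C (\<lambda>x y. counit C y \<odot>\<^bsub>C\<^esub> x) (comult C c) = c)"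

definition coalgebra_hom :: "('a, 'x) coalg_scheme \<Rightarrow> ('b, 'y) coalg_scheme \<Rightarrow> ('a \<Rightarrow> 'b) set"
  where "coalgebra_hom C D =
    {f \<in> lmod_hom complex_alg C D.
       \<forall>c\<in>carrier C. comult D (f c) = ctensor_map D D f f (comult C c) \<and>
                     counit D (f c) = counit C c}"

definition bialgebra :: "('a, 'x) coalg_scheme \<Rightarrow> bool"
  where "bialgebra H \<longleftrightarrow>
    unital_algebra H \<and> coalgebra H \<and>
    comult H \<in> ring_hom H (ctensor H H) \<and> counit H \<in> ring_hom H complex_alg"

definition is_antipode :: "('a, 'x) coalg_scheme \<Rightarrow> ('a \<Rightarrow> 'a) \<Rightarrow> bool"
  where "is_antipode H S \<longleftrightarrow>
    S \<in> lmod_hom complex_alg H H \<and>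
    (\<forall>h\<in>carrier H.
       tensor_lift H (\<lambda>x y. S x \<otimes>\<^bsub>H\<^esub> y) (comult H h) = counit H h \<odot>\<^bsub>H\<^esub> \<one>\<^bsub>H\<^esub> \<and>
       tensor_lift H (\<lambda>x y. x \<otimes>\<^bsub>H\<^esub> S y) (comult H h) = counit H h \<odot>\<^bsub>H\<^esub> \<one>\<^bsub>H\<^esub>)"

definition hopf_algebra :: "('a, 'x) coalg_scheme \<Rightarrow> bool"
  where "hopf_algebra H \<longleftrightarrow> bialgebra H \<and> (\<exists>S. is_antipode H S)"

text \<open>Antipodes are unique and automatically preserved by bialgebra morphisms.\<close>

definition hopf_hom :: "('a, 'x) coalg_scheme \<Rightarrow> ('b, 'y) coalg_scheme \<Rightarrow> ('a \<Rightarrow> 'b) set"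
  where "hopf_hom H K = ring_hom H K \<inter> coalgebra_hom H K"

text \<open>
  The universal property ranges over all Hopf algebras \<open>K\<close> whose carrier is a subset of the
  type \<open>'h\<close> (the type of \<open>H\<close>), since one cannot quantify over types inside a formula. For the
  countable-dimensional \<open>C\<close> considered below this is equivalent to the property for Hopf algebras
  on arbitrary types: a nonzero complex algebra on \<open>'h\<close> forces \<open>'h\<close> to have at least the
  cardinality of the continuum, so every Hopf algebra generated by images of \<open>C\<close> has an isomorphic
  copy carried by a subset of \<open>'h\<close>. Uniqueness is meant on the carrier, hence \<open>extensional\<close>.
\<close>

definition is_free_hopf_algebra :: "('c, 'x) coalg_scheme \<Rightarrow> 'h coalg \<Rightarrow> ('c \<Rightarrow> 'h) \<Rightarrow> bool"
  where "is_free_hopf_algebra C H \<iota> \<longleftrightarrow>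
    hopf_algebra H \<and> \<iota> \<in> coalgebra_hom C H \<and>
    (\<forall>K :: 'h coalg. \<forall>f. hopf_algebra K \<and> f \<in> coalgebra_hom C K \<longrightarrow>
       (\<exists>!g. g \<in> hopf_hom H K \<inter> extensional (carrier H) \<and> (\<forall>c\<in>carrier C. g (\<iota> c) = f c)))"


section \<open>The coalgebra dual to the algebra of two by two matrices\<close>

definition matrix_dual :: "(complex, complex^2^2 \<Rightarrow> complex) module"
  where "matrix_dual =
    \<lparr>carrier = {f. Vector_Spaces.linear (\<lambda>c (X :: complex^2^2). \<chi> i j. c * X $ i $ j) (*) f},
     mult = undefined, one = undefined,
     ring.zero = (\<lambda>X. 0), add = (\<lambda>f g X. f X + g X), smult = (\<lambda>c f X. c * f X)\<rparr>"

text \<open>The comultiplication is the transpose of matrix multiplication, the counit that of the unit.\<close>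

definition matrix_coalgebra :: "(complex^2^2 \<Rightarrow> complex) coalg"
  where "matrix_coalgebra =
    \<lparr>carrier = carrier matrix_dual, mult = undefined, one = undefined,
     ring.zero = \<zero>\<^bsub>matrix_dual\<^esub>, add = add matrix_dual, smult = smult matrix_dual,
     comult = (\<lambda>f. THE t. t \<in> carrier (ctensor matrix_dual matrix_dual) \<and>
                 (\<forall>X Y. tensor_lift complex_alg (\<lambda>g h. g X * h Y) t = f (X ** Y))),
     counit = (\<lambda>f. f (mat 1))\<rparr>"

text \<open>The basis of the dual space dual to the matrix units.\<close>

definition matrix_coord :: "2 \<Rightarrow> 2 \<Rightarrow> complex^2^2 \<Rightarrow> complex"
  where "matrix_coord i j = (\<lambda>X. X $ i $ j)"


section \<open>Extension of scalars\<close>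

text \<open>The left \<open>B\<close>-module \<open>\<phi>\<^sup>*M = B \<otimes>\<^sub>A M\<close> for \<open>\<phi> : A \<rightarrow> B\<close>.\<close>

definition ext_tens ::
  "('b, 'x) ring_scheme \<Rightarrow> ('a \<Rightarrow> 'b) \<Rightarrow> ('a, 'y) ring_scheme \<Rightarrow> ('a, 'm, 'z) module_scheme
    \<Rightarrow> 'b \<Rightarrow> 'm \<Rightarrow> ('b \<times> 'm \<Rightarrow>\<^sub>0 int) set"
  where "ext_tens B \<phi> A M = pure_tensor A B (\<lambda>b a. b \<otimes>\<^bsub>B\<^esub> \<phi> a) M"

definition ext_scalars ::
  "('b, 'x) ring_scheme \<Rightarrow> ('a \<Rightarrow> 'b) \<Rightarrow> ('a, 'y) ring_scheme \<Rightarrow> ('a, 'm, 'z) module_scheme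
    \<Rightarrow> ('b, ('b \<times> 'm \<Rightarrow>\<^sub>0 int) set) module"
  where "ext_scalars B \<phi> A M =
    (let T = tensor_group A B (\<lambda>b a. b \<otimes>\<^bsub>B\<^esub> \<phi> a) M
     in \<lparr>carrier = carrier T, mult = undefined, one = undefined, ring.zero = \<zero>\<^bsub>T\<^esub>, add = add T,
         smult = (\<lambda>b. tensor_lift T (\<lambda>b' m. ext_tens B \<phi> A M (b \<otimes>\<^bsub>B\<^esub> b') m))\<rparr>)"

text \<open>The map \<open>\<phi>\<^sup>*g = id\<^sub>B \<otimes>\<^sub>A g\<close> into \<open>\<phi>\<^sup>*N\<close>.\<close>

definition ext_map ::
  "('b, 'x) ring_scheme \<Rightarrow> ('a \<Rightarrow> 'b) \<Rightarrow> ('a, 'y) ring_scheme \<Rightarrow> ('a, 'n, 'z) module_scheme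
    \<Rightarrow> ('m \<Rightarrow> 'n) \<Rightarrow> ('b \<times> 'm \<Rightarrow>\<^sub>0 int) set \<Rightarrow> ('b \<times> 'n \<Rightarrow>\<^sub>0 int) set"
  where "ext_map B \<phi> A N g =
    tensor_lift (ext_scalars B \<phi> A N) (\<lambda>b m. ext_tens B \<phi> A N b (g m))"

definition ext_nat ::
  "('b, 'x) ring_scheme \<Rightarrow> ('a \<Rightarrow> 'b) \<Rightarrow> ('a, 'y) ring_scheme \<Rightarrow> ('a, 'm, 'z) module_scheme
    \<Rightarrow> 'm \<Rightarrow> ('b \<times> 'm \<Rightarrow>\<^sub>0 int) set"
  where "ext_nat B \<phi> A M m = ext_tens B \<phi> A M \<one>\<^bsub>B\<^esub> m"

text \<open>
  The unique isomorphism of \<open>B\<close>-modules from \<open>X\<close> to \<open>Y\<close> compatible with the maps \<open>i\<close>, \<open>j\<close> from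
  the set \<open>M\<close> to \<open>X\<close>, \<open>Y\<close>.
\<close>

definition canonical_iso ::
  "('b, 'x) ring_scheme \<Rightarrow> 'm set
    \<Rightarrow> ('b, 'v, 'y) module_scheme \<Rightarrow> ('m \<Rightarrow> 'v) \<Rightarrow> ('b, 'w, 'z) module_scheme \<Rightarrow> ('m \<Rightarrow> 'w) \<Rightarrow> 'v \<Rightarrow> 'w"
  where "canonical_iso B M X i Y j =
    (THE \<sigma>. \<sigma> \<in> lmod_iso B X Y \<inter> extensional (carrier X) \<and> (\<forall>m\<in>M. \<sigma> (i m) = j m))"


section \<open>The two conditions\<close>

text \<open>Via \<open>c \<mapsto> c \<cdot> 1\<close>, an \<open>A\<close>-module is a complex vector space.\<close>

definition underlying_space ::
  "(complex, 'a, 'x) module_scheme \<Rightarrow> ('a, 'm, 'y) module_scheme \<Rightarrow> (complex, 'm) module"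
  where "underlying_space A M =
    \<lparr>carrier = carrier M, mult = mult M, one = \<one>\<^bsub>M\<^esub>, ring.zero = \<zero>\<^bsub>M\<^esub>, add = add M,
     smult = (\<lambda>c m. (c \<odot>\<^bsub>A\<^esub> \<one>\<^bsub>A\<^esub>) \<odot>\<^bsub>M\<^esub> m)\<rparr>"

text \<open>\<open>H \<otimes> M\<close> as a left \<open>(H \<otimes> A)\<close>-module, for a left \<open>A\<close>-module \<open>M\<close>.\<close>

definition outer_tens ::
  "(complex, 'h, 'x) module_scheme \<Rightarrow> (complex, 'a, 'y) module_scheme \<Rightarrow> ('a, 'm, 'z) module_scheme
    \<Rightarrow> 'h \<Rightarrow> 'm \<Rightarrow> ('h \<times> 'm \<Rightarrow>\<^sub>0 int) set"
  where "outer_tens H A M = ctens H (underlying_space A M)"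

definition outer_tensor ::
  "(complex, 'h, 'x) module_scheme \<Rightarrow> (complex, 'a, 'y) module_scheme \<Rightarrow> ('a, 'm, 'z) module_scheme
    \<Rightarrow> (('h \<times> 'a \<Rightarrow>\<^sub>0 int) set, ('h \<times> 'm \<Rightarrow>\<^sub>0 int) set) module"
  where "outer_tensor H A M =
    (let T = ctensor H (underlying_space A M)
     in \<lparr>carrier = carrier T, mult = undefined, one = undefined, ring.zero = \<zero>\<^bsub>T\<^esub>, add = add T,
         smult = (\<lambda>t X. tensor_lift T (\<lambda>h a. tensor_lift T
                    (\<lambda>h' m. outer_tens H A M (h \<otimes>\<^bsub>H\<^esub> h') (a \<odot>\<^bsub>M\<^esub> m)) X) t)\<rparr>)"

text \<open>
  \<open>(id\<^sub>H \<otimes> \<delta>)\<^sup>*\<Theta> \<circ> (\<eta> \<otimes> id)\<^sup>*\<Theta> = (\<Delta> \<otimes> id\<^sub>A)\<^sup>*\<Theta>\<close> for \<open>\<Theta> : H \<otimes> M \<rightarrow> \<delta>\<^sup>*M\<close>, as maps from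
  \<open>(\<eta> \<otimes> id)\<^sup>*(H \<otimes> M)\<close> to \<open>(\<Delta> \<otimes> id\<^sub>A)\<^sup>*\<delta>\<^sup>*M\<close>. Here \<open>e\<close>, \<open>d\<close>, \<open>D\<close> are the algebra maps
  \<open>\<eta> \<otimes> id\<close>, \<open>id\<^sub>H \<otimes> \<delta>\<close>, \<open>\<Delta> \<otimes> id\<^sub>A\<close> from \<open>H \<otimes> A\<close> to \<open>H \<otimes> (H \<otimes> A)\<close>, \<open>HM\<close> stands for
  \<open>(\<eta> \<otimes> id\<^sub>A)\<^sup>*M\<close>, and the three canonical isomorphisms are the identifications
  \<open>e\<^sup>*\<delta>\<^sup>*M = d\<^sup>*HM\<close>, \<open>d\<^sup>*\<delta>\<^sup>*M = D\<^sup>*\<delta>\<^sup>*M\<close> and \<open>e\<^sup>*HM = D\<^sup>*HM\<close>.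
\<close>

definition comult_condition ::
  "('h, 'x) coalg_scheme \<Rightarrow> (complex, 'a, 'y) module_scheme \<Rightarrow> ('a \<Rightarrow> ('h \<times> 'a \<Rightarrow>\<^sub>0 int) set)
    \<Rightarrow> ('a, 'm, 'z) module_scheme
    \<Rightarrow> (('h \<times> 'm \<Rightarrow>\<^sub>0 int) set \<Rightarrow> (('h \<times> 'a \<Rightarrow>\<^sub>0 int) set \<times> 'm \<Rightarrow>\<^sub>0 int) set) \<Rightarrow> bool"
  where "comult_condition H A \<delta> M \<Theta> \<longleftrightarrow>
    (let HA = ctensor H A;
         B = ctensor H HA;
         e = ctens H HA \<one>\<^bsub>H\<^esub>;
         d = ctensor_map H HA id \<delta>;
         D = ctensor_assoc H H A \<circ> ctensor_map (ctensor H H) A (comult H) id;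
         HM = outer_tensor H A M;
         i = outer_tens H A M \<one>\<^bsub>H\<^esub>;
         \<delta>M = ext_scalars HA \<delta> A M;
         j = ext_nat HA \<delta> A M;
         \<sigma>\<^sub>1 = canonical_iso B (carrier M)
                (ext_scalars B e HA \<delta>M) (ext_nat B e HA \<delta>M \<circ> j)
                (ext_scalars B d HA HM) (ext_nat B d HA HM \<circ> i);
         \<sigma>\<^sub>2 = canonical_iso B (carrier M)
                (ext_scalars B d HA \<delta>M) (ext_nat B d HA \<delta>M \<circ> j)
                (ext_scalars B D HA \<delta>M) (ext_nat B D HA \<delta>M \<circ> j);
         \<sigma>\<^sub>3 = canonical_iso B (carrier M)
                (ext_scalars B e HA HM) (ext_nat B e HA HM \<circ> i)
                (ext_scalars B D HA HM) (ext_nat B D HA HM \<circ> i)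
     in \<forall>x\<in>carrier (ext_scalars B e HA HM).
          \<sigma>\<^sub>2 (ext_map B d HA \<delta>M \<Theta> (\<sigma>\<^sub>1 (ext_map B e HA \<delta>M \<Theta> x))) =
          ext_map B D HA \<delta>M \<Theta> (\<sigma>\<^sub>3 x))"

text \<open>
  \<open>(\<epsilon> \<otimes> id\<^sub>A)\<^sup>*\<Theta> = id\<^sub>M\<close>, with \<open>E = \<epsilon> \<otimes> id\<^sub>A\<close> from \<open>H \<otimes> A\<close> to \<open>A\<close> and the identifications
  \<open>M = E\<^sup>*HM\<close>, \<open>E\<^sup>*\<delta>\<^sup>*M = M\<close>.
\<close>

definition counit_condition ::
  "('h, 'x) coalg_scheme \<Rightarrow> (complex, 'a, 'y) module_scheme \<Rightarrow> ('a \<Rightarrow> ('h \<times> 'a \<Rightarrow>\<^sub>0 int) set)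
    \<Rightarrow> ('a, 'm, 'z) module_scheme
    \<Rightarrow> (('h \<times> 'm \<Rightarrow>\<^sub>0 int) set \<Rightarrow> (('h \<times> 'a \<Rightarrow>\<^sub>0 int) set \<times> 'm \<Rightarrow>\<^sub>0 int) set) \<Rightarrow> bool"
  where "counit_condition H A \<delta> M \<Theta> \<longleftrightarrow>
    (let HA = ctensor H A;
         E = tensor_lift A (\<lambda>h a. counit H h \<odot>\<^bsub>A\<^esub> a);
         HM = outer_tensor H A M;
         i = outer_tens H A M \<one>\<^bsub>H\<^esub>;
         \<delta>M = ext_scalars HA \<delta> A M;
         j = ext_nat HA \<delta> A M;
         \<tau>\<^sub>1 = canonical_iso A (carrier M) M id (ext_scalars A E HA HM) (ext_nat A E HA HM \<circ> i);
         \<tau>\<^sub>2 = canonical_iso A (carrier M) (ext_scalars A E HA \<delta>M) (ext_nat A E HA \<delta>M \<circ> j) M id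
     in \<forall>m\<in>carrier M. \<tau>\<^sub>2 (ext_map A E HA \<delta>M \<Theta> (\<tau>\<^sub>1 m)) = m)"

end

(* All modules involved are free of rank two, the identifications are the evident changes of bases, and
   Theta is right multiplication by the transposed matrix a^t; the two conditions are then the formulas
   for Delta(a) and epsilon(a). If Theta were onto, applying id (x) epsilon would yield a left inverse of
   a^t over H, and hence, by universality, over every Hopf algebra K on the type of H to which the matrix
   coalgebra maps.

   Let K be generated by the entries of matrices x_0, x_1, x_2, ... such that x_(k+1) is the transposed
   inverse of x_k, with matrix comultiplication and antipode x_k |-> x_(k+1)^t. A representation of K is
   a sequence of operator matrices of this kind. There is one on two-sided complex sequences, with
   entries built from the shift and from multiplication by 2^n, for which x_0^t has a nonzero kernel
   vector and so no left inverse. As K has at most continuum many elements and H contains a copy of the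
   complex numbers, K can be realised on the type of H. *)

theory Submission
  imports Defs
begin

text \<open>An inverse of x_0^t would be a matrix x_(-1) preceding x_0, because x_0 is the
  transposed inverse of y exactly when y and x_0^t are inverse to each other. What is wanted is
  therefore an operator matrix on which transposed inversion can be repeated for ever, but which has
  no predecessor. The matrices used have A w^-1, B w on the diagonal and C T, D T^-1 off it, where w
  is a weight and T a shift with T w = 2 w T. As w and T do not commute, such a matrix and its
  transpose have different determinants: A B - C D / 2 and, for the transpose, A B - 2 C D.
  Transposed inversion multiplies A B / (C D) by 4. Starting with A B = 2 C D makes the determinant
  of the transpose vanish at k = 0, while A B - C D / 2 stays nonzero for all k \<ge> 0.

  K is made of terms modulo provable equality, and no normal form of its elements is ever computed:
  maps out of K are evaluations of terms, and the representation alone shows that x_0^t has no left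
  inverse.\<close>

section \<open>Additive maps between abelian groups\<close>

text \<open>A bare predicate on functions that reads only carriers and additions: it composes by
  simple rules, and the several records that share one additive group can be exchanged in
  it.\<close>

definition additive_map :: "('a, 'x) ring_scheme \<Rightarrow> ('b, 'y) ring_scheme \<Rightarrow> ('a \<Rightarrow> 'b) \<Rightarrow> bool"
  where "additive_map G K f \<longleftrightarrow> f \<in> carrier G \<rightarrow> carrier K \<and>
    (\<forall>x\<in>carrier G. \<forall>y\<in>carrier G. f (x \<oplus>\<^bsub>G\<^esub> y) = f x \<oplus>\<^bsub>K\<^esub> f y)"

lemma additive_mapI:
  assumes "\<And>x. x \<in> carrier G \<Longrightarrow> f x \<in> carrier K"
    and "\<And>x y. x \<in> carrier G \<Longrightarrow> y \<in> carrier G \<Longrightarrow> f (x \<oplus>\<^bsub>G\<^esub> y) = f x \<oplus>\<^bsub>K\<^esub> f y"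
  shows "additive_map G K f"
  using assms by (auto simp: additive_map_def)

lemma additive_map_closed: "additive_map G K f \<Longrightarrow> x \<in> carrier G \<Longrightarrow> f x \<in> carrier K"
  by (auto simp: additive_map_def)

lemma additive_map_add:
  "additive_map G K f \<Longrightarrow> x \<in> carrier G \<Longrightarrow> y \<in> carrier G \<Longrightarrow> f (x \<oplus>\<^bsub>G\<^esub> y) = f x \<oplus>\<^bsub>K\<^esub> f y"
  by (auto simp: additive_map_def)

lemma additive_map_comp:
  "additive_map G K f \<Longrightarrow> additive_map K L g \<Longrightarrow> additive_map G L (\<lambda>x. g (f x))"
  by (auto simp: additive_map_def Pi_def)

lemma additive_map_zero:
  assumes "abelian_group G" "abelian_group K" "additive_map G K f"
  shows "f \<zero>\<^bsub>G\<^esub> = \<zero>\<^bsub>K\<^esub>"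
proof -
  interpret G: abelian_group G by fact
  interpret K: abelian_group K by fact
  have c: "f \<zero>\<^bsub>G\<^esub> \<in> carrier K" using assms(3) by (auto simp: additive_map_def)
  have "f \<zero>\<^bsub>G\<^esub> \<oplus>\<^bsub>K\<^esub> f \<zero>\<^bsub>G\<^esub> = f (\<zero>\<^bsub>G\<^esub> \<oplus>\<^bsub>G\<^esub> \<zero>\<^bsub>G\<^esub>)"
    using additive_map_add[OF assms(3) G.zero_closed G.zero_closed] by (rule sym)
  then have "f \<zero>\<^bsub>G\<^esub> \<oplus>\<^bsub>K\<^esub> f \<zero>\<^bsub>G\<^esub> = f \<zero>\<^bsub>G\<^esub> \<oplus>\<^bsub>K\<^esub> \<zero>\<^bsub>K\<^esub>" using c by simp
  then show ?thesis using c by (metis K.r_neg1 K.r_neg2 K.l_neg K.r_zero K.a_assoc K.l_zero K.a_inv_closed)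
qed

lemma additive_map_plus:
  assumes "abelian_group K" "additive_map G K f" "additive_map G K g"
  shows "additive_map G K (\<lambda>x. f x \<oplus>\<^bsub>K\<^esub> g x)"
proof -
  interpret K: abelian_group K by fact
  show ?thesis
    using assms(2,3) by (auto simp: additive_map_def Pi_def K.a_ac)
qed

lemma additive_map_id: "additive_map G G id" "additive_map G G (\<lambda>x. x)"
  by (auto simp: additive_map_def)

text \<open>Only the additive structure of a record enters \<^const>\<open>additive_map\<close> and \<^const>\<open>tensor_lift\<close>.\<close>

definition same_group :: "('a, 'x) ring_scheme \<Rightarrow> ('a, 'y) ring_scheme \<Rightarrow> bool"
  where "same_group G K \<longleftrightarrow> carrier G = carrier K \<and> add G = add K \<and> \<zero>\<^bsub>G\<^esub> = \<zero>\<^bsub>K\<^esub>"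

lemma same_group_abelian:
  assumes "same_group G K" "abelian_group K" shows "abelian_group G"
proof -
  interpret K: abelian_group K by fact
  show ?thesis
    using assms(1) K.l_neg
    by (intro abelian_groupI) (auto simp: same_group_def K.a_ac intro!: bexI[of _ "\<ominus>\<^bsub>K\<^esub> _"])
qed

lemma same_group_additive_map:
  "same_group G K \<Longrightarrow> additive_map G L f \<longleftrightarrow> additive_map K L f"
  "same_group G K \<Longrightarrow> additive_map L G g \<longleftrightarrow> additive_map L K g"
  by (simp_all add: additive_map_def same_group_def)

lemma same_group_sym: "same_group G K \<Longrightarrow> same_group K G"
  by (simp add: same_group_def)


section \<open>Tensor products\<close>

definition balanced ::
  "('r, 'x) ring_scheme \<Rightarrow> ('b, 'y) ring_scheme \<Rightarrow> ('b \<Rightarrow> 'r \<Rightarrow> 'b) \<Rightarrow> ('r, 'm, 'z) module_scheme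
    \<Rightarrow> ('c, 'w) ring_scheme \<Rightarrow> ('b \<Rightarrow> 'm \<Rightarrow> 'c) \<Rightarrow> bool"
  where "balanced R B act M G f \<longleftrightarrow>
    (\<forall>b\<in>carrier B. additive_map M G (f b)) \<and>
    (\<forall>m\<in>carrier M. additive_map B G (\<lambda>b. f b m)) \<and>
    (\<forall>b\<in>carrier B. \<forall>r\<in>carrier R. \<forall>m\<in>carrier M. f (act b r) m = f b (r \<odot>\<^bsub>M\<^esub> m))"

lemma balancedI:
  assumes "\<And>b. b \<in> carrier B \<Longrightarrow> additive_map M G (f b)"
    and "\<And>m. m \<in> carrier M \<Longrightarrow> additive_map B G (\<lambda>b. f b m)"
    and "\<And>b r m. b \<in> carrier B \<Longrightarrow> r \<in> carrier R \<Longrightarrow> m \<in> carrier M \<Longrightarrow> f (act b r) m = f b (r \<odot>\<^bsub>M\<^esub> m)"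
  shows "balanced R B act M G f"
  using assms by (auto simp: balanced_def)

text \<open>Only closure of the two actions is assumed. The quotient by the relators and its
  universal property exist for any such data; module axioms enter only when the tensor product
  itself is to carry an action.\<close>

locale tensor_data = B: abelian_group B + M: abelian_group M
  for R :: "('r, 'x) ring_scheme" and B :: "('b, 'y) ring_scheme"
    and act :: "'b \<Rightarrow> 'r \<Rightarrow> 'b" and M :: "('r, 'm, 'z) module_scheme" +
  assumes act_closed: "b \<in> carrier B \<Longrightarrow> r \<in> carrier R \<Longrightarrow> act b r \<in> carrier B"
    and smult_closed: "r \<in> carrier R \<Longrightarrow> m \<in> carrier M \<Longrightarrow> r \<odot>\<^bsub>M\<^esub> m \<in> carrier M"
begin

abbreviation "FF \<equiv> free_Abelian_group (carrier B \<times> carrier M)"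
abbreviation "NN \<equiv> tensor_subgroup R B act M"
abbreviation "TT \<equiv> tensor_group R B act M"
abbreviation "pt \<equiv> pure_tensor R B act M"

lemma FF_comm: "comm_group FF" by (rule abelian_free_Abelian_group)

lemma relators_subset: "tensor_relators R B act M \<subseteq> carrier FF"
proof -
  have *: "frag_of p - frag_of q \<in> carrier FF" if "p \<in> carrier B \<times> carrier M" "q \<in> carrier B \<times> carrier M" for p q
    using that keys_diff[of "frag_of p" "frag_of q"] by auto
  have **: "frag_of p - frag_of q - frag_of s \<in> carrier FF"
    if "p \<in> carrier B \<times> carrier M" "q \<in> carrier B \<times> carrier M" "s \<in> carrier B \<times> carrier M" for p q s
    using *[OF that(1,2)] that(3) keys_diff[of "frag_of p - frag_of q" "frag_of s"]
    unfolding carrier_free_Abelian_group_iff by fastforce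
  show ?thesis
    unfolding tensor_relators_def
    by (intro Un_least subsetI; clarsimp simp del: carrier_free_Abelian_group_iff;
        intro * **; simp add: act_closed smult_closed)
qed

lemma NN_subgroup: "subgroup NN FF"
  unfolding tensor_subgroup_def
  by (rule group.generate_is_subgroup[OF group_free_Abelian_group relators_subset])

lemma NN_normal: "NN \<lhd> FF"
  using comm_group.normal_iff_subgroup[OF FF_comm] NN_subgroup by blast

lemma add_monoid_TT: "add_monoid TT = FF Mod NN"
  by (simp add: tensor_group_def Let_def)

lemma abelian_TT: "abelian_group TT"
proof (rule comm_group_abelian_groupI)
  show "comm_group (add_monoid TT)"
    unfolding add_monoid_TT
    using comm_group.abelian_FactGroup[OF FF_comm NN_subgroup] .
qed

lemma carrier_TT: "carrier TT = {NN #>\<^bsub>FF\<^esub> x | x. x \<in> carrier FF}"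
  by (auto simp: tensor_group_def FactGroup_def RCOSETS_def Let_def)

lemma add_TT: "x \<in> carrier FF \<Longrightarrow> y \<in> carrier FF \<Longrightarrow>
  (NN #>\<^bsub>FF\<^esub> x) \<oplus>\<^bsub>TT\<^esub> (NN #>\<^bsub>FF\<^esub> y) = NN #>\<^bsub>FF\<^esub> (x + y)"
  using normal.rcos_sum[OF NN_normal, of x y]
  by (simp add: tensor_group_def FactGroup_def Let_def del: carrier_free_Abelian_group_iff)

lemma coset_eqI:
  assumes "x \<in> carrier FF" "y \<in> carrier FF" "x - y \<in> NN"
  shows "NN #>\<^bsub>FF\<^esub> x = NN #>\<^bsub>FF\<^esub> y"
proof -
  have "x \<in> NN #>\<^bsub>FF\<^esub> y"
    using assms(3) unfolding r_coset_def by (auto intro!: bexI[of _ "x - y"])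
  then show ?thesis
    using group.repr_independence[OF group_free_Abelian_group _ _ NN_subgroup] assms(2) by metis
qed

lemma relator_in_NN: "z \<in> tensor_relators R B act M \<Longrightarrow> z \<in> NN"
  unfolding tensor_subgroup_def by (rule generate.incl)

lemma pt_closed: "b \<in> carrier B \<Longrightarrow> m \<in> carrier M \<Longrightarrow> pt b m \<in> carrier TT"
  unfolding carrier_TT pure_tensor_def
  by (rule CollectI, rule exI[of _ "frag_of (b, m)"]) simp

lemma frag_add_closed: "x \<in> carrier FF \<Longrightarrow> y \<in> carrier FF \<Longrightarrow> x + y \<in> carrier FF"
  using group.is_monoid[OF group_free_Abelian_group[of "carrier B \<times> carrier M"]]
  by (metis monoid.m_closed mult_free_Abelian_group)

lemma pt_balanced: "balanced R B act M TT pt"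
proof (rule balancedI)
  fix b assume b: "b \<in> carrier B"
  show "additive_map M TT (pt b)"
  proof (rule additive_mapI)
    fix m m' assume m: "m \<in> carrier M" "m' \<in> carrier M"
    have "pt b (m \<oplus>\<^bsub>M\<^esub> m') = NN #>\<^bsub>FF\<^esub> (frag_of (b, m) + frag_of (b, m'))"
      unfolding pure_tensor_def
    proof (rule coset_eqI)
      show "frag_of (b, m) + frag_of (b, m') \<in> carrier FF"
        by (rule frag_add_closed) (use b m in auto)
      show "frag_of (b, m \<oplus>\<^bsub>M\<^esub> m') - (frag_of (b, m) + frag_of (b, m')) \<in> NN"
        unfolding diff_diff_eq[symmetric]
        by (rule relator_in_NN) (unfold tensor_relators_def, use b m in blast)
    qed (use b m in auto)
    also have "\<dots> = pt b m \<oplus>\<^bsub>TT\<^esub> pt b m'"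
      unfolding pure_tensor_def by (subst add_TT) (use b m in auto)
    finally show "pt b (m \<oplus>\<^bsub>M\<^esub> m') = pt b m \<oplus>\<^bsub>TT\<^esub> pt b m'" .
  qed (use b pt_closed in auto)
next
  fix m assume m: "m \<in> carrier M"
  show "additive_map B TT (\<lambda>b. pt b m)"
  proof (rule additive_mapI)
    fix b b' assume b: "b \<in> carrier B" "b' \<in> carrier B"
    have "pt (b \<oplus>\<^bsub>B\<^esub> b') m = NN #>\<^bsub>FF\<^esub> (frag_of (b, m) + frag_of (b', m))"
      unfolding pure_tensor_def
    proof (rule coset_eqI)
      show "frag_of (b, m) + frag_of (b', m) \<in> carrier FF"
        by (rule frag_add_closed) (use b m in auto)
      show "frag_of (b \<oplus>\<^bsub>B\<^esub> b', m) - (frag_of (b, m) + frag_of (b', m)) \<in> NN"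
        unfolding diff_diff_eq[symmetric]
        by (rule relator_in_NN) (unfold tensor_relators_def, use b m in blast)
    qed (use b m in auto)
    also have "\<dots> = pt b m \<oplus>\<^bsub>TT\<^esub> pt b' m"
      unfolding pure_tensor_def by (subst add_TT) (use b m in auto)
    finally show "pt (b \<oplus>\<^bsub>B\<^esub> b') m = pt b m \<oplus>\<^bsub>TT\<^esub> pt b' m" .
  qed (use m pt_closed in auto)
next
  fix b r m assume *: "b \<in> carrier B" "r \<in> carrier R" "m \<in> carrier M"
  show "pt (act b r) m = pt b (r \<odot>\<^bsub>M\<^esub> m)"
    unfolding pure_tensor_def
  proof (rule coset_eqI)
    show "frag_of (act b r, m) - frag_of (b, r \<odot>\<^bsub>M\<^esub> m) \<in> NN"
      by (rule relator_in_NN) (unfold tensor_relators_def, use * in blast)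
  qed (use * act_closed smult_closed in auto)
qed

lemma pt_zero: "m \<in> carrier M \<Longrightarrow> pt \<zero>\<^bsub>B\<^esub> m = \<zero>\<^bsub>TT\<^esub>"
  using additive_map_zero[OF B.abelian_group_axioms abelian_TT] pt_balanced
  unfolding balanced_def by fastforce

text \<open>Sums of pure tensors exhaust the group, since the negative of a pure tensor is pure: -(b
  \<otimes> m) = (-b) \<otimes> m. The induction principle for free abelian groups has a step for
  differences, so \<open>main\<close> carries \<open>P\<close> for a coset and for its negative
  together.\<close>

lemma TT_induct [consumes 1, case_names pure add]:
  assumes X: "X \<in> carrier TT"
    and pure: "\<And>b m. b \<in> carrier B \<Longrightarrow> m \<in> carrier M \<Longrightarrow> P (pt b m)"
    and add: "\<And>X Y. X \<in> carrier TT \<Longrightarrow> Y \<in> carrier TT \<Longrightarrow> P X \<Longrightarrow> P Y \<Longrightarrow> P (X \<oplus>\<^bsub>TT\<^esub> Y)"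
  shows "P X"
proof -
  interpret T: abelian_group TT by (rule abelian_TT)
  have neg_pt: "\<ominus>\<^bsub>TT\<^esub> pt b m = pt (\<ominus>\<^bsub>B\<^esub> b) m" if "b \<in> carrier B" "m \<in> carrier M" for b m
  proof (rule T.minus_equality)
    have "pt (\<ominus>\<^bsub>B\<^esub> b) m \<oplus>\<^bsub>TT\<^esub> pt b m = pt (\<ominus>\<^bsub>B\<^esub> b \<oplus>\<^bsub>B\<^esub> b) m"
      using pt_balanced that unfolding balanced_def additive_map_def by simp
    then show "pt (\<ominus>\<^bsub>B\<^esub> b) m \<oplus>\<^bsub>TT\<^esub> pt b m = \<zero>\<^bsub>TT\<^esub>"
      using that by (simp add: B.l_neg pt_zero)
  qed (use that pt_closed in auto)
  have main: "P (NN #>\<^bsub>FF\<^esub> x) \<and> P (\<ominus>\<^bsub>TT\<^esub> (NN #>\<^bsub>FF\<^esub> x))" if "x \<in> carrier FF" for x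
  proof -
    have "Poly_Mapping.keys x \<subseteq> carrier B \<times> carrier M" using that by simp
    then show ?thesis
    proof (induction x rule: free_Abelian_group_induct[consumes 1, case_names 1 2 3])
      case 1
      have z: "pt \<zero>\<^bsub>B\<^esub> \<zero>\<^bsub>M\<^esub> = \<zero>\<^bsub>TT\<^esub>" by (simp add: pt_zero)
      have "P \<zero>\<^bsub>TT\<^esub>" using pure[of "\<zero>\<^bsub>B\<^esub>" "\<zero>\<^bsub>M\<^esub>"] z by simp
      moreover have "NN #>\<^bsub>FF\<^esub> 0 = \<zero>\<^bsub>TT\<^esub>"
      proof -
        have "NN #>\<^bsub>FF\<^esub> 0 = NN"
          using group.coset_mult_one[OF group_free_Abelian_group[of "carrier B \<times> carrier M"], of NN]
            subgroup.subset[OF NN_subgroup] by simp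
        then show ?thesis by (simp add: tensor_group_def FactGroup_def Let_def)
      qed
      moreover have "\<ominus>\<^bsub>TT\<^esub> \<zero>\<^bsub>TT\<^esub> = \<zero>\<^bsub>TT\<^esub>" by (rule T.minus_equality) simp_all
      ultimately show ?case by (simp only: simp_thms)
    next
      case (2 x y)
      have c: "NN #>\<^bsub>FF\<^esub> x \<in> carrier TT" "NN #>\<^bsub>FF\<^esub> y \<in> carrier TT" "NN #>\<^bsub>FF\<^esub> (x - y) \<in> carrier TT"
        unfolding carrier_TT using 2(1,2) keys_diff[of x y] by auto
      have "(NN #>\<^bsub>FF\<^esub> (x - y)) \<oplus>\<^bsub>TT\<^esub> (NN #>\<^bsub>FF\<^esub> y) = NN #>\<^bsub>FF\<^esub> x"
        using 2(1,2) keys_diff[of x y] by (subst add_TT) auto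
      then have e: "NN #>\<^bsub>FF\<^esub> (x - y) = (NN #>\<^bsub>FF\<^esub> x) \<oplus>\<^bsub>TT\<^esub> (\<ominus>\<^bsub>TT\<^esub> (NN #>\<^bsub>FF\<^esub> y))"
        using c by (metis T.a_assoc T.a_inv_closed T.r_neg T.r_zero)
      have "\<ominus>\<^bsub>TT\<^esub> (NN #>\<^bsub>FF\<^esub> (x - y)) = (\<ominus>\<^bsub>TT\<^esub> (NN #>\<^bsub>FF\<^esub> x)) \<oplus>\<^bsub>TT\<^esub> (NN #>\<^bsub>FF\<^esub> y)"
        unfolding e using c by (simp add: T.minus_add)
      then show ?case using 2(3,4) c by (auto simp: e intro!: add)
    next
      case (3 p)
      then obtain b m where p: "p = (b, m)" "b \<in> carrier B" "m \<in> carrier M" by auto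
      have "NN #>\<^bsub>FF\<^esub> frag_of p = pt b m" by (simp add: p(1) pure_tensor_def)
      then show ?case using p(2,3) by (simp add: pure neg_pt)
    qed
  qed
  then show ?thesis using X unfolding carrier_TT by auto
qed

context
  fixes G :: "('c, 'w) ring_scheme" and f :: "'b \<Rightarrow> 'm \<Rightarrow> 'c"
  assumes G: "abelian_group G" and f: "balanced R B act M G f"
begin

text \<open>The extension \<open>h\<close> of \<open>f\<close> to the free abelian group kills the
  relators, hence the subgroup they generate. The last clause identifies the sum in the body of
  \<open>tensor_lift\<close> with \<open>h\<close>, so that nothing needs to be known later about
  finite sums.\<close>

lemma lift_hom_exists:
  obtains h where "h \<in> hom FF (add_monoid G)"
    "\<And>b m. b \<in> carrier B \<Longrightarrow> m \<in> carrier M \<Longrightarrow> h (frag_of (b, m)) = f b m"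
    "\<And>x. x \<in> NN \<Longrightarrow> h x = \<zero>\<^bsub>G\<^esub>"
    "\<And>x. x \<in> carrier FF \<Longrightarrow>
      finsum G (\<lambda>p. add_pow G (Poly_Mapping.lookup x p) (f (fst p) (snd p))) (Poly_Mapping.keys x) = h x"
proof -
  interpret G: abelian_group G by (rule G)
  have Gc: "comm_group (add_monoid G)" by (rule G.a_comm_group)
  have fc: "f b m \<in> carrier G" if "b \<in> carrier B" "m \<in> carrier M" for b m
    using f that unfolding balanced_def additive_map_def by auto
  have "(\<lambda>p. f (fst p) (snd p)) ` (carrier B \<times> carrier M) \<subseteq> carrier (add_monoid G)"
    using fc by auto
  then obtain h where h: "h \<in> hom FF (add_monoid G)"
    "\<And>p. p \<in> carrier B \<times> carrier M \<Longrightarrow> h (frag_of p) = f (fst p) (snd p)"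
    using comm_group.free_Abelian_group_universal[OF Gc] by blast
  interpret hh: group_hom FF "add_monoid G" h
    by (intro group_hom.intro group_hom_axioms.intro group_free_Abelian_group h(1) comm_group.axioms(2)[OF Gc])
  have hadd: "h (x + y) = h x \<oplus>\<^bsub>G\<^esub> h y" if "x \<in> carrier FF" "y \<in> carrier FF" for x y
    using hh.hom_mult[OF that] by simp
  have hneg: "h (x - y) = h x \<ominus>\<^bsub>G\<^esub> h y" if "x \<in> carrier FF" "y \<in> carrier FF" for x y
  proof -
    have c: "x - y \<in> carrier FF" using that keys_diff[of x y] by auto
    have "h x = h (x - y) \<oplus>\<^bsub>G\<^esub> h y" using hadd[OF c that(2)] by simp
    moreover have "h (x - y) \<in> carrier G" "h y \<in> carrier G" using hh.hom_closed c that(2) by auto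
    ultimately show ?thesis by (simp add: a_minus_def G.a_assoc G.r_neg)
  qed
  have hf: "h (frag_of (b, m)) = f b m" if "b \<in> carrier B" "m \<in> carrier M" for b m
    using h(2)[of "(b, m)"] that by simp
  have rel: "tensor_relators R B act M \<subseteq> kernel FF (add_monoid G) h"
  proof
    fix z assume z: "z \<in> tensor_relators R B act M"
    then have zc: "z \<in> carrier FF" using relators_subset by blast
    have sub: "frag_of p - frag_of q \<in> carrier FF" if "p \<in> carrier B \<times> carrier M" "q \<in> carrier B \<times> carrier M" for p q
      using that keys_diff[of "frag_of p" "frag_of q"] by auto
    from z have "h z = \<zero>\<^bsub>G\<^esub>"
      unfolding tensor_relators_def
    proof (elim UnE CollectE exE conjE)
      fix b b' m assume *: "z = frag_of (b \<oplus>\<^bsub>B\<^esub> b', m) - frag_of (b, m) - frag_of (b', m)"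
        "b \<in> carrier B" "b' \<in> carrier B" "m \<in> carrier M"
      have "h z = f (b \<oplus>\<^bsub>B\<^esub> b') m \<ominus>\<^bsub>G\<^esub> f b m \<ominus>\<^bsub>G\<^esub> f b' m"
        unfolding *(1) using * by (subst hneg; (subst hneg)?) (auto simp: hf sub simp del: carrier_free_Abelian_group_iff)
      moreover have "f (b \<oplus>\<^bsub>B\<^esub> b') m = f b m \<oplus>\<^bsub>G\<^esub> f b' m"
        using f * unfolding balanced_def additive_map_def by auto
      ultimately show ?thesis using fc * by (simp add: a_minus_def G.a_ac G.r_neg G.r_neg1 G.r_neg2)
    next
      fix b m m' assume *: "z = frag_of (b, m \<oplus>\<^bsub>M\<^esub> m') - frag_of (b, m) - frag_of (b, m')"
        "b \<in> carrier B" "m \<in> carrier M" "m' \<in> carrier M"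
      have "h z = f b (m \<oplus>\<^bsub>M\<^esub> m') \<ominus>\<^bsub>G\<^esub> f b m \<ominus>\<^bsub>G\<^esub> f b m'"
        unfolding *(1) using * by (subst hneg; (subst hneg)?) (auto simp: hf sub simp del: carrier_free_Abelian_group_iff)
      moreover have "f b (m \<oplus>\<^bsub>M\<^esub> m') = f b m \<oplus>\<^bsub>G\<^esub> f b m'"
        using f * unfolding balanced_def additive_map_def by auto
      ultimately show ?thesis using fc * by (simp add: a_minus_def G.a_ac G.r_neg G.r_neg1 G.r_neg2)
    next
      fix b r m assume *: "z = frag_of (act b r, m) - frag_of (b, r \<odot>\<^bsub>M\<^esub> m)"
        "b \<in> carrier B" "r \<in> carrier R" "m \<in> carrier M"
      have "h z = f (act b r) m \<ominus>\<^bsub>G\<^esub> f b (r \<odot>\<^bsub>M\<^esub> m)"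
        unfolding *(1) using * by (subst hneg) (auto simp: hf act_closed smult_closed)
      moreover have "f (act b r) m = f b (r \<odot>\<^bsub>M\<^esub> m)"
        using f * unfolding balanced_def by auto
      ultimately show ?thesis using fc * smult_closed by (simp add: a_minus_def G.r_neg)
    qed
    then show "z \<in> kernel FF (add_monoid G) h" using zc by (simp add: kernel_def)
  qed
  have "NN \<subseteq> kernel FF (add_monoid G) h"
    unfolding tensor_subgroup_def
    by (rule group.generate_subgroup_incl[OF group_free_Abelian_group rel hh.subgroup_kernel])
  then have hN: "h x = \<zero>\<^bsub>G\<^esub>" if "x \<in> NN" for x using that by (auto simp: kernel_def)
  have hfin: "finsum G (\<lambda>p. add_pow G (Poly_Mapping.lookup x p) (f (fst p) (snd p))) (Poly_Mapping.keys x) = h x"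
    if x: "x \<in> carrier FF" for x
  proof -
    have *: "finsum G (\<lambda>p. add_pow G (c p) (f (fst p) (snd p))) I = h (\<Sum>p\<in>I. frag_cmul (c p) (frag_of p))
        \<and> (\<Sum>p\<in>I. frag_cmul (c p) (frag_of p)) \<in> carrier FF"
      if "finite I" "I \<subseteq> carrier B \<times> carrier M" for I and c :: "'b \<times> 'm \<Rightarrow> int"
      using that
    proof (induction I)
      case empty
      then show ?case using hh.hom_one by simp
    next
      case (insert p I)
      have p: "p \<in> carrier B \<times> carrier M" using insert.prems by auto
      have pk: "frag_cmul (c p) (frag_of p) \<in> carrier FF"
        using p keys_cmul[of "c p" "frag_of p"] by auto
      have "h (frag_cmul (c p) (frag_of p)) = h (frag_of p [^]\<^bsub>FF\<^esub> c p)"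
        using p by simp
      also have "\<dots> = h (frag_of p) [^]\<^bsub>add_monoid G\<^esub> c p"
        using p by (intro hh.hom_int_pow) simp
      also have "\<dots> = add_pow G (c p) (f (fst p) (snd p))"
        using h(2)[OF p] by (simp add: add_pow_def)
      finally have e: "h (frag_cmul (c p) (frag_of p)) = add_pow G (c p) (f (fst p) (snd p))" .
      have cl: "add_pow G (c q) (f (fst q) (snd q)) \<in> carrier G" if "q \<in> carrier B \<times> carrier M" for q
        using fc that by (auto intro!: G.add.int_pow_closed)
      have IH: "finsum G (\<lambda>p. add_pow G (c p) (f (fst p) (snd p))) I = h (\<Sum>p\<in>I. frag_cmul (c p) (frag_of p))"
        "(\<Sum>p\<in>I. frag_cmul (c p) (frag_of p)) \<in> carrier FF"
        using insert by auto
      have "finsum G (\<lambda>p. add_pow G (c p) (f (fst p) (snd p))) (insert p I)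
        = add_pow G (c p) (f (fst p) (snd p)) \<oplus>\<^bsub>G\<^esub> finsum G (\<lambda>p. add_pow G (c p) (f (fst p) (snd p))) I"
        using insert cl by (intro G.finsum_insert) auto
      also have "\<dots> = h (frag_cmul (c p) (frag_of p) + (\<Sum>p\<in>I. frag_cmul (c p) (frag_of p)))"
        unfolding hadd[OF pk IH(2)] e IH(1) ..
      finally show ?case using insert frag_add_closed[OF pk IH(2)] by simp
    qed
    have "x = (\<Sum>p\<in>Poly_Mapping.keys x. frag_cmul (Poly_Mapping.lookup x p) (frag_of p))"
      using frag_expansion[of x] unfolding frag_extend_def .
    then show ?thesis
      using *[of "Poly_Mapping.keys x" "Poly_Mapping.lookup x"] x by simp
  qed
  show thesis using that h(1) hf hN hfin by blast
qed

lemma tensor_lift_coset: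
  obtains h where "h \<in> hom FF (add_monoid G)"
    "\<And>b m. b \<in> carrier B \<Longrightarrow> m \<in> carrier M \<Longrightarrow> h (frag_of (b, m)) = f b m"
    "\<And>x. x \<in> carrier FF \<Longrightarrow> tensor_lift G f (NN #>\<^bsub>FF\<^esub> x) = h x"
proof -
  interpret G: abelian_group G by (rule G)
  obtain h where h: "h \<in> hom FF (add_monoid G)"
    "\<And>b m. b \<in> carrier B \<Longrightarrow> m \<in> carrier M \<Longrightarrow> h (frag_of (b, m)) = f b m"
    "\<And>x. x \<in> NN \<Longrightarrow> h x = \<zero>\<^bsub>G\<^esub>"
    "\<And>x. x \<in> carrier FF \<Longrightarrow>
      finsum G (\<lambda>p. add_pow G (Poly_Mapping.lookup x p) (f (fst p) (snd p))) (Poly_Mapping.keys x) = h x"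
    by (rule lift_hom_exists) (rule that)
  have "tensor_lift G f (NN #>\<^bsub>FF\<^esub> x) = h x" if x: "x \<in> carrier FF" for x
  proof -
    have "x \<in> NN #>\<^bsub>FF\<^esub> x"
      using group.rcos_self[OF group_free_Abelian_group x NN_subgroup] .
    then have "(SOME y. y \<in> NN #>\<^bsub>FF\<^esub> x) \<in> NN #>\<^bsub>FF\<^esub> x" by (rule someI)
    \<comment> \<open>The representative picked by \<open>SOME\<close> is known only up to an
      element \<open>n\<close> of the subgroup, and \<open>h\<close> vanishes there.\<close>
    then obtain n where n: "n \<in> NN" "(SOME y. y \<in> NN #>\<^bsub>FF\<^esub> x) = n + x"
      unfolding r_coset_def by auto
    have nc: "n \<in> carrier FF" using n(1) subgroup.subset[OF NN_subgroup] by blast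
    have hx: "h x \<in> carrier G" using h(1) x unfolding hom_def by auto
    have "tensor_lift G f (NN #>\<^bsub>FF\<^esub> x) = h (n + x)"
      unfolding tensor_lift_def Let_def n(2) by (rule h(4)) (rule frag_add_closed[OF nc x])
    also have "\<dots> = h n \<oplus>\<^bsub>G\<^esub> h x" using h(1) nc x unfolding hom_def by auto
    finally show ?thesis using h(3)[OF n(1)] hx by simp
  qed
  then show thesis using that h(1,2) by blast
qed

lemma tensor_lift_additive: "additive_map TT G (tensor_lift G f)"
proof -
  obtain h where h: "h \<in> hom FF (add_monoid G)"
    and hf: "\<And>b m. b \<in> carrier B \<Longrightarrow> m \<in> carrier M \<Longrightarrow> h (frag_of (b, m)) = f b m"
    and hl: "\<And>x. x \<in> carrier FF \<Longrightarrow> tensor_lift G f (NN #>\<^bsub>FF\<^esub> x) = h x"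
    by (rule tensor_lift_coset) (rule that)
  show ?thesis
  proof (rule additive_mapI)
    fix X assume "X \<in> carrier TT"
    then obtain x where x: "X = NN #>\<^bsub>FF\<^esub> x" "x \<in> carrier FF"
      unfolding carrier_TT by blast
    have "h x \<in> carrier G" using h x(2) unfolding hom_def by auto
    then show "tensor_lift G f X \<in> carrier G"
      unfolding x(1) hl[OF x(2)] .
  next
    fix X Y assume "X \<in> carrier TT" "Y \<in> carrier TT"
    then obtain x y where *: "X = NN #>\<^bsub>FF\<^esub> x" "Y = NN #>\<^bsub>FF\<^esub> y" "x \<in> carrier FF" "y \<in> carrier FF"
      unfolding carrier_TT by blast
    have "tensor_lift G f (X \<oplus>\<^bsub>TT\<^esub> Y) = h (x + y)"
      unfolding *(1,2) add_TT[OF *(3,4)] by (rule hl[OF frag_add_closed[OF *(3,4)]])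
    also have "\<dots> = h x \<oplus>\<^bsub>G\<^esub> h y"
      using hom_mult[OF h *(3,4)] by simp
    also have "h x = tensor_lift G f X" using hl[OF *(3)] *(1) by simp
    also have "h y = tensor_lift G f Y" using hl[OF *(4)] *(2) by simp
    finally show "tensor_lift G f (X \<oplus>\<^bsub>TT\<^esub> Y) = tensor_lift G f X \<oplus>\<^bsub>G\<^esub> tensor_lift G f Y" .
  qed
qed

lemma tensor_lift_pure: "b \<in> carrier B \<Longrightarrow> m \<in> carrier M \<Longrightarrow> tensor_lift G f (pt b m) = f b m"
proof -
  assume *: "b \<in> carrier B" "m \<in> carrier M"
  obtain h where h: "h \<in> hom FF (add_monoid G)"
    and hf: "\<And>b m. b \<in> carrier B \<Longrightarrow> m \<in> carrier M \<Longrightarrow> h (frag_of (b, m)) = f b m"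
    and hl: "\<And>x. x \<in> carrier FF \<Longrightarrow> tensor_lift G f (NN #>\<^bsub>FF\<^esub> x) = h x"
    by (rule tensor_lift_coset) (rule that)
  show ?thesis unfolding pure_tensor_def using hl[of "frag_of (b, m)"] hf[OF *] * by simp
qed

end

end

text \<open>
  The various tensor products of the definitions are records that share their additive group with
  \<^const>\<open>tensor_group\<close>.
\<close>

locale tensor_product = tensor_data R B act M
  for R :: "('r, 'x) ring_scheme" and B :: "('b, 'y) ring_scheme" and act and M :: "('r, 'm, 'z) module_scheme" +
  fixes T :: "(('b \<times> 'm \<Rightarrow>\<^sub>0 int) set, 't) ring_scheme" and tens
  assumes same: "same_group T TT" and tens_eq: "tens = pt"
begin

lemma abelian_T: "abelian_group T"
  by (rule same_group_abelian[OF same abelian_TT])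

lemma balanced_TT: "balanced R B act M TT f \<longleftrightarrow> balanced R B act M T f"
  by (simp add: balanced_def same_group_additive_map(2)[OF same])

lemma tens_balanced: "balanced R B act M T tens"
  unfolding balanced_TT[symmetric] tens_eq by (rule pt_balanced)

lemma tens_closed: "b \<in> carrier B \<Longrightarrow> m \<in> carrier M \<Longrightarrow> tens b m \<in> carrier T"
  and tens_add_left: "b \<in> carrier B \<Longrightarrow> b' \<in> carrier B \<Longrightarrow> m \<in> carrier M \<Longrightarrow>
    tens (b \<oplus>\<^bsub>B\<^esub> b') m = tens b m \<oplus>\<^bsub>T\<^esub> tens b' m"
  and tens_add_right: "b \<in> carrier B \<Longrightarrow> m \<in> carrier M \<Longrightarrow> m' \<in> carrier M \<Longrightarrow>
    tens b (m \<oplus>\<^bsub>M\<^esub> m') = tens b m \<oplus>\<^bsub>T\<^esub> tens b m'"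
  and tens_swap: "b \<in> carrier B \<Longrightarrow> r \<in> carrier R \<Longrightarrow> m \<in> carrier M \<Longrightarrow> tens (act b r) m = tens b (r \<odot>\<^bsub>M\<^esub> m)"
  using tens_balanced by (auto simp: balanced_def additive_map_def)

lemma T_induct [consumes 1, case_names pure add]:
  assumes "X \<in> carrier T"
    and "\<And>b m. b \<in> carrier B \<Longrightarrow> m \<in> carrier M \<Longrightarrow> P (tens b m)"
    and "\<And>X Y. X \<in> carrier T \<Longrightarrow> Y \<in> carrier T \<Longrightarrow> P X \<Longrightarrow> P Y \<Longrightarrow> P (X \<oplus>\<^bsub>T\<^esub> Y)"
  shows "P X"
proof -
  have e: "carrier T = carrier TT" "add T = add TT" using same by (auto simp: same_group_def)
  show ?thesis using TT_induct[of X P] assms unfolding e tens_eq by blast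
qed

text \<open>The main tool for identities in tensor products: each side is additive in every
  variable, and one use of this rule per variable leaves an identity between pure tensors.\<close>

lemma T_ext:
  assumes "additive_map T G f" "additive_map T G g"
    and "\<And>b m. b \<in> carrier B \<Longrightarrow> m \<in> carrier M \<Longrightarrow> f (tens b m) = g (tens b m)"
    and "X \<in> carrier T"
  shows "f X = g X"
  using assms(4) by (induction rule: T_induct) (auto simp: assms additive_map_add[OF assms(1)] additive_map_add[OF assms(2)])

lemma lift_additive:
  assumes "abelian_group G" "balanced R B act M G f"
  shows "additive_map T G (tensor_lift G f)"
  unfolding same_group_additive_map(1)[OF same] by (rule tensor_lift_additive[OF assms])

lemma lift_tens:
  assumes "abelian_group G" "balanced R B act M G f" "b \<in> carrier B" "m \<in> carrier M"
  shows "tensor_lift G f (tens b m) = f b m"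
  unfolding tens_eq by (rule tensor_lift_pure[OF assms])

text \<open>The lift into \<open>T\<close> may also be computed in \<^const>\<open>tensor_group\<close>, as in the definitions of the actions.\<close>

lemma lift_TT:
  assumes f: "balanced R B act M T f"
  shows "additive_map T T (tensor_lift TT f)"
    and "b \<in> carrier B \<Longrightarrow> m \<in> carrier M \<Longrightarrow> tensor_lift TT f (tens b m) = f b m"
  using lift_additive[OF abelian_TT f[folded balanced_TT]] lift_tens[OF abelian_TT f[folded balanced_TT]]
  unfolding same_group_additive_map(2)[OF same] by auto

end

section \<open>Complex vector spaces, bilinear maps and their tensor products\<close>

lemma complex_alg_simps [simp]:
  "carrier complex_alg = UNIV" "mult complex_alg = (*)" "\<one>\<^bsub>complex_alg\<^esub> = 1"
  "\<zero>\<^bsub>complex_alg\<^esub> = 0" "add complex_alg = (+)" "smult complex_alg = (*)"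
  by (simp_all add: complex_alg_def)

lemma cring_complex_alg: "cring complex_alg"
proof (rule cringI)
  show "abelian_group complex_alg"
    by (rule abelian_groupI) (auto simp: algebra_simps intro: exI[of _ "- _"] left_minus)
  show "Group.comm_monoid complex_alg"
    by (rule comm_monoidI) (auto simp: algebra_simps)
qed (auto simp: algebra_simps)

abbreviation cmodule :: "(complex, 'v, 'x) module_scheme \<Rightarrow> bool"
  where "cmodule \<equiv> Module.module complex_alg"

abbreviation clinear :: "(complex, 'v, 'x) module_scheme \<Rightarrow> (complex, 'w, 'y) module_scheme \<Rightarrow> ('v \<Rightarrow> 'w) \<Rightarrow> bool"
  where "clinear V W f \<equiv> f \<in> lmod_hom complex_alg V W"

lemma clinearI:
  assumes "additive_map V W f" "\<And>c v. v \<in> carrier V \<Longrightarrow> f (c \<odot>\<^bsub>V\<^esub> v) = c \<odot>\<^bsub>W\<^esub> f v"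
  shows "clinear V W f"
  using assms by (auto simp: lmod_hom_def additive_map_def)

lemma clinear_additive: "clinear V W f \<Longrightarrow> additive_map V W f"
  by (auto simp: lmod_hom_def additive_map_def)

lemma clinear_smult: "clinear V W f \<Longrightarrow> v \<in> carrier V \<Longrightarrow> f (c \<odot>\<^bsub>V\<^esub> v) = c \<odot>\<^bsub>W\<^esub> f v"
  by (auto simp: lmod_hom_def)

lemma clinear_id: "clinear V V id" "clinear V V (\<lambda>x. x)"
  by (auto simp: lmod_hom_def)

lemma clinear_comp: "clinear U V f \<Longrightarrow> clinear V W g \<Longrightarrow> clinear U W (\<lambda>x. g (f x))"
  by (auto simp: lmod_hom_def Pi_def)

lemma cmoduleI:
  assumes "abelian_group V" "\<And>c v. v \<in> carrier V \<Longrightarrow> c \<odot>\<^bsub>V\<^esub> v \<in> carrier V"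
    "\<And>c d v. v \<in> carrier V \<Longrightarrow> (c + d) \<odot>\<^bsub>V\<^esub> v = c \<odot>\<^bsub>V\<^esub> v \<oplus>\<^bsub>V\<^esub> d \<odot>\<^bsub>V\<^esub> v"
    "\<And>c v w. v \<in> carrier V \<Longrightarrow> w \<in> carrier V \<Longrightarrow> c \<odot>\<^bsub>V\<^esub> (v \<oplus>\<^bsub>V\<^esub> w) = c \<odot>\<^bsub>V\<^esub> v \<oplus>\<^bsub>V\<^esub> c \<odot>\<^bsub>V\<^esub> w"
    "\<And>c d v. v \<in> carrier V \<Longrightarrow> (c * d) \<odot>\<^bsub>V\<^esub> v = c \<odot>\<^bsub>V\<^esub> (d \<odot>\<^bsub>V\<^esub> v)"
    "\<And>v. v \<in> carrier V \<Longrightarrow> 1 \<odot>\<^bsub>V\<^esub> v = v"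
  shows "cmodule V"
  by (rule moduleI[OF cring_complex_alg]) (use assms in auto)

lemma cmodule_abelian: "cmodule V \<Longrightarrow> abelian_group V"
  by (simp add: Module.module_def)

lemma cmodule_simps:
  assumes "cmodule V" "v \<in> carrier V"
  shows "c \<odot>\<^bsub>V\<^esub> v \<in> carrier V"
    "(c + d) \<odot>\<^bsub>V\<^esub> v = c \<odot>\<^bsub>V\<^esub> v \<oplus>\<^bsub>V\<^esub> d \<odot>\<^bsub>V\<^esub> v"
    "w \<in> carrier V \<Longrightarrow> c \<odot>\<^bsub>V\<^esub> (v \<oplus>\<^bsub>V\<^esub> w) = c \<odot>\<^bsub>V\<^esub> v \<oplus>\<^bsub>V\<^esub> c \<odot>\<^bsub>V\<^esub> w"
    "(c * d) \<odot>\<^bsub>V\<^esub> v = c \<odot>\<^bsub>V\<^esub> (d \<odot>\<^bsub>V\<^esub> v)"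
    "1 \<odot>\<^bsub>V\<^esub> v = v"
  using assms module.smult_closed[OF assms(1)] module.smult_l_distr[OF assms(1)]
    module.smult_r_distr[OF assms(1)] module.smult_assoc1[OF assms(1)] module.smult_one[OF assms(1)]
  by auto

lemma cmodule_complex: "cmodule complex_alg"
  by (rule cmoduleI) (auto simp: algebra_simps cring.axioms(1)[OF cring_complex_alg] ring.is_abelian_group)

definition cbilinear ::
  "(complex, 'v, 'x) module_scheme \<Rightarrow> (complex, 'w, 'y) module_scheme \<Rightarrow> (complex, 'u, 'z) module_scheme
    \<Rightarrow> ('v \<Rightarrow> 'w \<Rightarrow> 'u) \<Rightarrow> bool"
  where "cbilinear V W U f \<longleftrightarrow>
    (\<forall>v\<in>carrier V. clinear W U (f v)) \<and> (\<forall>w\<in>carrier W. clinear V U (\<lambda>v. f v w))"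

lemma cbilinearI:
  assumes "\<And>v. v \<in> carrier V \<Longrightarrow> clinear W U (f v)" "\<And>w. w \<in> carrier W \<Longrightarrow> clinear V U (\<lambda>v. f v w)"
  shows "cbilinear V W U f"
  using assms by (auto simp: cbilinear_def)

lemma cbilinearD:
  assumes "cbilinear V W U f"
  shows "v \<in> carrier V \<Longrightarrow> clinear W U (f v)" "w \<in> carrier W \<Longrightarrow> clinear V U (\<lambda>v. f v w)"
  using assms by (auto simp: cbilinear_def)

abbreviation cbalanced ::
  "(complex, 'v, 'x) module_scheme \<Rightarrow> (complex, 'w, 'y) module_scheme \<Rightarrow> ('u, 'z) ring_scheme
    \<Rightarrow> ('v \<Rightarrow> 'w \<Rightarrow> 'u) \<Rightarrow> bool"
  where "cbalanced V W \<equiv> balanced complex_alg V (\<lambda>v c. c \<odot>\<^bsub>V\<^esub> v) W"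

lemma cbilinear_balanced: "cbilinear V W U f \<Longrightarrow> cbalanced V W U f"
  by (rule balancedI)
     (auto simp: clinear_additive cbilinearD clinear_smult[OF cbilinearD(1)] clinear_smult[OF cbilinearD(2)])

lemma ctensor_simps:
  shows "carrier (ctensor V W) = carrier (tensor_group complex_alg V (\<lambda>v c. c \<odot>\<^bsub>V\<^esub> v) W)"
    "add (ctensor V W) = add (tensor_group complex_alg V (\<lambda>v c. c \<odot>\<^bsub>V\<^esub> v) W)"
    "\<zero>\<^bsub>ctensor V W\<^esub> = \<zero>\<^bsub>tensor_group complex_alg V (\<lambda>v c. c \<odot>\<^bsub>V\<^esub> v) W\<^esub>"
  by (simp_all add: ctensor_def Let_def)

lemma ctensor_same_group:
  "same_group (ctensor V W) (tensor_group complex_alg V (\<lambda>v c. c \<odot>\<^bsub>V\<^esub> v) W)"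
  by (simp add: same_group_def ctensor_simps)

locale cmodule_pair =
  fixes V :: "(complex, 'v, 'x) module_scheme" and W :: "(complex, 'w, 'y) module_scheme"
  assumes V: "cmodule V" and W: "cmodule W"
begin

abbreviation "T \<equiv> ctensor V W"
abbreviation tens (infixl \<open>\<otimes>\<otimes>\<close> 72) where "v \<otimes>\<otimes> w \<equiv> ctens V W v w"

lemma tensor_data: "tensor_data complex_alg V (\<lambda>v c. c \<odot>\<^bsub>V\<^esub> v) W"
  by (intro tensor_data.intro tensor_data_axioms.intro cmodule_abelian V W)
     (simp_all add: cmodule_simps(1) V W)

sublocale td?: tensor_product complex_alg V "\<lambda>v c. c \<odot>\<^bsub>V\<^esub> v" W "ctensor V W" "ctens V W"
  by (intro tensor_product.intro tensor_data tensor_product_axioms.intro ctensor_same_group) (simp add: ctens_def fun_eq_iff)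

lemma tens_smult_swap: "v \<in> carrier V \<Longrightarrow> w \<in> carrier W \<Longrightarrow> (c \<odot>\<^bsub>V\<^esub> v) \<otimes>\<otimes> w = v \<otimes>\<otimes> (c \<odot>\<^bsub>W\<^esub> w)"
  by (rule tens_swap) simp_all

lemma smult_balanced: "cbalanced V W T (\<lambda>v w. (c \<odot>\<^bsub>V\<^esub> v) \<otimes>\<otimes> w)"
proof (rule balancedI)
  show "additive_map W T (\<lambda>w. (c \<odot>\<^bsub>V\<^esub> v) \<otimes>\<otimes> w)" if "v \<in> carrier V" for v
    using that by (intro additive_mapI) (simp_all add: tens_closed tens_add_right cmodule_simps(1)[OF V])
  show "additive_map V T (\<lambda>v. (c \<odot>\<^bsub>V\<^esub> v) \<otimes>\<otimes> w)" if "w \<in> carrier W" for w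
    using that by (intro additive_mapI) (simp_all add: tens_closed tens_add_left cmodule_simps(1,3)[OF V])
  show "(c \<odot>\<^bsub>V\<^esub> (d \<odot>\<^bsub>V\<^esub> v)) \<otimes>\<otimes> w = (c \<odot>\<^bsub>V\<^esub> v) \<otimes>\<otimes> (d \<odot>\<^bsub>W\<^esub> w)"
    if "v \<in> carrier V" "w \<in> carrier W" for v w d
  proof -
    have "c \<odot>\<^bsub>V\<^esub> (d \<odot>\<^bsub>V\<^esub> v) = d \<odot>\<^bsub>V\<^esub> (c \<odot>\<^bsub>V\<^esub> v)"
      using that cmodule_simps(4)[OF V, of v c d] cmodule_simps(4)[OF V, of v d c] by (simp add: mult.commute)
    then show ?thesis using that by (simp add: tens_smult_swap cmodule_simps(1)[OF V])
  qed
qed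

lemma smult_T: "(\<odot>\<^bsub>T\<^esub>) c = tensor_lift (tensor_group complex_alg V (\<lambda>v c. c \<odot>\<^bsub>V\<^esub> v) W) (\<lambda>v w. (c \<odot>\<^bsub>V\<^esub> v) \<otimes>\<otimes> w)"
  by (simp add: ctensor_def Let_def)

lemma smult_additive: "additive_map T T ((\<odot>\<^bsub>T\<^esub>) c)"
  unfolding smult_T by (rule lift_TT(1)[OF smult_balanced])

lemma smult_tens: "v \<in> carrier V \<Longrightarrow> w \<in> carrier W \<Longrightarrow> c \<odot>\<^bsub>T\<^esub> (v \<otimes>\<otimes> w) = (c \<odot>\<^bsub>V\<^esub> v) \<otimes>\<otimes> w"
  unfolding smult_T by (rule lift_TT(2)[OF smult_balanced])

lemma smult_tens_right: "v \<in> carrier V \<Longrightarrow> w \<in> carrier W \<Longrightarrow> c \<odot>\<^bsub>T\<^esub> (v \<otimes>\<otimes> w) = v \<otimes>\<otimes> (c \<odot>\<^bsub>W\<^esub> w)"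
  by (simp add: smult_tens tens_smult_swap)

lemma smult_closed: "X \<in> carrier T \<Longrightarrow> c \<odot>\<^bsub>T\<^esub> X \<in> carrier T"
  by (rule additive_map_closed[OF smult_additive])

lemma cmodule_T: "cmodule T"
proof (rule cmoduleI[OF abelian_T smult_closed])
  interpret T: abelian_group T by (rule abelian_T)
  fix c d X assume X: "X \<in> carrier T"
  show "(c + d) \<odot>\<^bsub>T\<^esub> X = c \<odot>\<^bsub>T\<^esub> X \<oplus>\<^bsub>T\<^esub> d \<odot>\<^bsub>T\<^esub> X"
    by (rule T_ext[OF smult_additive additive_map_plus[OF abelian_T smult_additive smult_additive] _ X])
       (simp add: smult_tens cmodule_simps[OF V] tens_add_left)
  show "(c * d) \<odot>\<^bsub>T\<^esub> X = c \<odot>\<^bsub>T\<^esub> (d \<odot>\<^bsub>T\<^esub> X)"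
    by (rule T_ext[OF smult_additive additive_map_comp[OF smult_additive smult_additive] _ X])
       (simp add: smult_tens cmodule_simps[OF V])
  show "1 \<odot>\<^bsub>T\<^esub> X = X"
    by (rule T_ext[OF smult_additive additive_map_id(2) _ X])
       (simp add: smult_tens cmodule_simps[OF V])
qed (use additive_map_add[OF smult_additive] in auto)

lemma tens_cbilinear: "cbilinear V W T (ctens V W)"
  by (intro cbilinearI clinearI additive_mapI)
     (simp_all add: tens_closed tens_add_left tens_add_right smult_tens tens_smult_swap)

lemma lift_clinear:
  assumes U: "cmodule U" and f: "cbilinear V W U f"
  shows "clinear T U (tensor_lift U f)"
proof (rule clinearI)
  show a: "additive_map T U (tensor_lift U f)"
    by (rule lift_additive[OF cmodule_abelian[OF U] cbilinear_balanced[OF f]])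
  fix c X assume X: "X \<in> carrier T"
  have s: "additive_map U U ((\<odot>\<^bsub>U\<^esub>) c)"
    by (rule additive_mapI) (simp_all add: cmodule_simps[OF U])
  show "tensor_lift U f (c \<odot>\<^bsub>T\<^esub> X) = c \<odot>\<^bsub>U\<^esub> tensor_lift U f X"
    by (rule T_ext[OF additive_map_comp[OF smult_additive a] additive_map_comp[OF a s] _ X])
       (simp add: smult_tens lift_tens[OF cmodule_abelian[OF U] cbilinear_balanced[OF f]] cmodule_simps[OF V]
          clinear_smult[OF cbilinearD(2)[OF f]])
qed

end

lemma cmodule_pairI: "cmodule V \<Longrightarrow> cmodule W \<Longrightarrow> cmodule_pair V W"
  by (rule cmodule_pair.intro)

lemma unital_algebraD:
  assumes "unital_algebra A"
  shows "cmodule A" "ring A"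
    "\<And>c x y. x \<in> carrier A \<Longrightarrow> y \<in> carrier A \<Longrightarrow> (c \<odot>\<^bsub>A\<^esub> x) \<otimes>\<^bsub>A\<^esub> y = c \<odot>\<^bsub>A\<^esub> (x \<otimes>\<^bsub>A\<^esub> y)"
    "\<And>c x y. x \<in> carrier A \<Longrightarrow> y \<in> carrier A \<Longrightarrow> x \<otimes>\<^bsub>A\<^esub> (c \<odot>\<^bsub>A\<^esub> y) = c \<odot>\<^bsub>A\<^esub> (x \<otimes>\<^bsub>A\<^esub> y)"
  using assms by (auto simp: unital_algebra_def)

lemma ctensor_map_bilinear:
  assumes V': "cmodule V'" and W': "cmodule W'" and f: "clinear V V' f" and g: "clinear W W' g"
  shows "cbilinear V W (ctensor V' W') (\<lambda>v w. ctens V' W' (f v) (g w))"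
proof -
  interpret P': cmodule_pair V' W' by (rule cmodule_pairI[OF V' W'])
  note fc = additive_map_closed[OF clinear_additive[OF f]] and gc = additive_map_closed[OF clinear_additive[OF g]]
  show ?thesis
    by (intro cbilinearI clinear_comp[OF g cbilinearD(1)[OF P'.tens_cbilinear]]
        clinear_comp[OF f cbilinearD(2)[OF P'.tens_cbilinear]] fc gc)
qed

text \<open>Common to the multiplication of a tensor product algebra and to the action of H
  \<otimes> A on H \<otimes> M. The record \<open>G\<close> is kept apart because the two
  definitions lift into different records over the same group: \<open>tensor_group\<close> in
  \<open>ctensor\<close>, but \<open>ctensor\<close> in \<open>outer_tensor\<close>.\<close>

locale tensor_action = P: cmodule_pair V W + Q: cmodule_pair V' W'
  for V :: "(complex, 'v, 'x) module_scheme" and W :: "(complex, 'w, 'y) module_scheme"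
    and V' :: "(complex, 'v1, 'x1) module_scheme" and W' :: "(complex, 'w1, 'y1) module_scheme" +
  fixes G :: "(('v1 \<times> 'w1 \<Rightarrow>\<^sub>0 int) set, 'z) ring_scheme" and f :: "'v \<Rightarrow> 'v1 \<Rightarrow> 'v1" and g :: "'w \<Rightarrow> 'w1 \<Rightarrow> 'w1"
  assumes G: "same_group G Q.T" and f: "cbilinear V V' V' f" and g: "cbilinear W W' W' g"
begin

definition inner where
  "inner v w = tensor_lift G (\<lambda>v' w'. Q.tens (f v v') (g w w'))"

definition act where
  "act X Y = tensor_lift G (\<lambda>v w. inner v w Y) X"

lemma abelian_G: "abelian_group G"
  by (rule same_group_abelian[OF G Q.abelian_T])

lemma balanced_G: "balanced R B b N Q.T h \<Longrightarrow> balanced R B b N G h"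
  by (simp add: balanced_def same_group_additive_map(2)[OF G])

lemma inner_balanced: "v \<in> carrier V \<Longrightarrow> w \<in> carrier W \<Longrightarrow> cbalanced V' W' G (\<lambda>v' w'. Q.tens (f v v') (g w w'))"
  by (rule balanced_G[OF cbilinear_balanced[OF ctensor_map_bilinear[OF Q.V Q.W cbilinearD(1)[OF f] cbilinearD(1)[OF g]]]])

lemma inner_additive: "v \<in> carrier V \<Longrightarrow> w \<in> carrier W \<Longrightarrow> additive_map Q.T Q.T (inner v w)"
  using Q.lift_additive[OF abelian_G inner_balanced] unfolding inner_def same_group_additive_map(2)[OF G] .

lemma inner_tens: "v \<in> carrier V \<Longrightarrow> w \<in> carrier W \<Longrightarrow> v' \<in> carrier V' \<Longrightarrow> w' \<in> carrier W' \<Longrightarrow>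
    inner v w (Q.tens v' w') = Q.tens (f v v') (g w w')"
  unfolding inner_def by (rule Q.lift_tens[OF abelian_G inner_balanced])

lemma fg_closed: "v \<in> carrier V \<Longrightarrow> v' \<in> carrier V' \<Longrightarrow> f v v' \<in> carrier V'"
  "w \<in> carrier W \<Longrightarrow> w' \<in> carrier W' \<Longrightarrow> g w w' \<in> carrier W'"
  using additive_map_closed[OF clinear_additive[OF cbilinearD(1)[OF f]]]
    additive_map_closed[OF clinear_additive[OF cbilinearD(1)[OF g]]] by auto

lemma inner_balanced_left:
  assumes Y: "Y \<in> carrier Q.T"
  shows "cbalanced V W Q.T (\<lambda>v w. inner v w Y)"
proof (rule balancedI)
  have c: "inner v w Y \<in> carrier Q.T" if "v \<in> carrier V" "w \<in> carrier W" for v w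
    using additive_map_closed[OF inner_additive[OF that] Y] .
  note plus = additive_map_plus[OF Q.abelian_T inner_additive inner_additive]
  show "additive_map W Q.T (\<lambda>w. inner v w Y)" if v: "v \<in> carrier V" for v
  proof (rule additive_mapI)
    fix w w' assume *: "w \<in> carrier W" "w' \<in> carrier W"
    show "inner v (w \<oplus>\<^bsub>W\<^esub> w') Y = inner v w Y \<oplus>\<^bsub>Q.T\<^esub> inner v w' Y"
      by (rule Q.T_ext[OF inner_additive plus _ Y])
         (use v * in \<open>simp_all add: inner_tens fg_closed Q.tens_add_right
            additive_map_add[OF clinear_additive[OF cbilinearD(2)[OF g]]]\<close>)
  qed (use v c in auto)
  show "additive_map V Q.T (\<lambda>v. inner v w Y)" if w: "w \<in> carrier W" for w
  proof (rule additive_mapI)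
    fix v v' assume *: "v \<in> carrier V" "v' \<in> carrier V"
    show "inner (v \<oplus>\<^bsub>V\<^esub> v') w Y = inner v w Y \<oplus>\<^bsub>Q.T\<^esub> inner v' w Y"
      by (rule Q.T_ext[OF inner_additive plus _ Y])
         (use w * in \<open>simp_all add: inner_tens fg_closed Q.tens_add_left
            additive_map_add[OF clinear_additive[OF cbilinearD(2)[OF f]]]\<close>)
  qed (use w c in auto)
  show "inner (c \<odot>\<^bsub>V\<^esub> v) w Y = inner v (c \<odot>\<^bsub>W\<^esub> w) Y" if "v \<in> carrier V" "w \<in> carrier W" for v w c
    by (rule Q.T_ext[OF inner_additive inner_additive _ Y])
       (use that in \<open>simp_all add: inner_tens fg_closed Q.tens_smult_swap clinear_smult[OF cbilinearD(2)[OF f]]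
          clinear_smult[OF cbilinearD(2)[OF g]] cmodule_simps(1)[OF P.V] cmodule_simps(1)[OF P.W]\<close>)
qed

lemma act_additive_left: "Y \<in> carrier Q.T \<Longrightarrow> additive_map P.T Q.T (\<lambda>X. act X Y)"
  using P.lift_additive[OF abelian_G balanced_G[OF inner_balanced_left]]
  unfolding act_def same_group_additive_map(2)[OF G] .

lemma act_tens_left: "v \<in> carrier V \<Longrightarrow> w \<in> carrier W \<Longrightarrow> Y \<in> carrier Q.T \<Longrightarrow> act (P.tens v w) Y = inner v w Y"
  unfolding act_def by (rule P.lift_tens[OF abelian_G balanced_G[OF inner_balanced_left]])

lemma act_tens: "v \<in> carrier V \<Longrightarrow> w \<in> carrier W \<Longrightarrow> v' \<in> carrier V' \<Longrightarrow> w' \<in> carrier W' \<Longrightarrow>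
    act (P.tens v w) (Q.tens v' w') = Q.tens (f v v') (g w w')"
  by (simp add: act_tens_left Q.tens_closed inner_tens)

lemma act_additive_right:
  assumes X: "X \<in> carrier P.T"
  shows "additive_map Q.T Q.T (act X)"
proof (rule additive_mapI)
  fix Y Y' assume Y: "Y \<in> carrier Q.T" "Y' \<in> carrier Q.T"
  note al = act_additive_left
  show "act X (Y \<oplus>\<^bsub>Q.T\<^esub> Y') = act X Y \<oplus>\<^bsub>Q.T\<^esub> act X Y'"
    by (rule P.T_ext[OF al additive_map_plus[OF Q.abelian_T al al] _ X])
       (use Y abelian_groupE(1)[OF Q.abelian_T] in \<open>simp_all add: act_tens_left additive_map_add[OF inner_additive]\<close>)
qed (rule additive_map_closed[OF act_additive_left X])

end

section \<open>Tensor products of algebras\<close>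

locale algebra_pair =
  fixes V :: "(complex, 'v, 'x) module_scheme" and W :: "(complex, 'w, 'y) module_scheme"
  assumes V_alg: "unital_algebra V" and W_alg: "unital_algebra W"
begin

sublocale cmodule_pair V W
  by (intro cmodule_pair.intro unital_algebraD V_alg W_alg)

sublocale VR: ring V by (intro unital_algebraD V_alg)
sublocale WR: ring W by (intro unital_algebraD V_alg W_alg)

lemma mult_bilinear: "cbilinear V V V (\<otimes>\<^bsub>V\<^esub>)" "cbilinear W W W (\<otimes>\<^bsub>W\<^esub>)"
  by (intro cbilinearI clinearI additive_mapI; simp add: VR.l_distr VR.r_distr WR.l_distr WR.r_distr
      unital_algebraD(3,4)[OF V_alg] unital_algebraD(3,4)[OF W_alg])+

sublocale act: tensor_action V W V W "tensor_group complex_alg V (\<lambda>v c. c \<odot>\<^bsub>V\<^esub> v) W" "(\<otimes>\<^bsub>V\<^esub>)" "(\<otimes>\<^bsub>W\<^esub>)"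
  by unfold_locales (rule same_group_sym[OF ctensor_same_group] mult_bilinear)+

lemma mult_T: "(\<otimes>\<^bsub>T\<^esub>) = act.act"
  by (simp add: ctensor_def Let_def act.act_def act.inner_def fun_eq_iff)

lemma mult_additive_left: "Y \<in> carrier T \<Longrightarrow> additive_map T T (\<lambda>X. X \<otimes>\<^bsub>T\<^esub> Y)"
  and mult_additive_right: "X \<in> carrier T \<Longrightarrow> additive_map T T ((\<otimes>\<^bsub>T\<^esub>) X)"
  and mult_tens: "v \<in> carrier V \<Longrightarrow> w \<in> carrier W \<Longrightarrow> v' \<in> carrier V \<Longrightarrow> w' \<in> carrier W \<Longrightarrow>
    (v \<otimes>\<otimes> w) \<otimes>\<^bsub>T\<^esub> (v' \<otimes>\<otimes> w') = (v \<otimes>\<^bsub>V\<^esub> v') \<otimes>\<otimes> (w \<otimes>\<^bsub>W\<^esub> w')"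
  unfolding mult_T by (fact act.act_additive_left act.act_additive_right act.act_tens)+

lemma mult_closed: "X \<in> carrier T \<Longrightarrow> Y \<in> carrier T \<Longrightarrow> X \<otimes>\<^bsub>T\<^esub> Y \<in> carrier T"
  using additive_map_closed[OF mult_additive_left] .

lemma unital_algebra_T: "unital_algebra T"
  unfolding unital_algebra_def
proof (intro conjI allI ballI)
  show "cmodule T" by (rule cmodule_T)
  have one_T: "\<one>\<^bsub>T\<^esub> = \<one>\<^bsub>V\<^esub> \<otimes>\<otimes> \<one>\<^bsub>W\<^esub>" by (simp add: ctensor_def Let_def)
  have oc: "\<one>\<^bsub>T\<^esub> \<in> carrier T" by (simp add: one_T tens_closed)
  have assoc: "X \<otimes>\<^bsub>T\<^esub> Y \<otimes>\<^bsub>T\<^esub> Z = X \<otimes>\<^bsub>T\<^esub> (Y \<otimes>\<^bsub>T\<^esub> Z)"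
    if X: "X \<in> carrier T" and Y: "Y \<in> carrier T" and Z: "Z \<in> carrier T" for X Y Z
  proof (rule T_ext[OF _ _ _ X])
    show "additive_map T T (\<lambda>X. X \<otimes>\<^bsub>T\<^esub> Y \<otimes>\<^bsub>T\<^esub> Z)"
      by (rule additive_map_comp[OF mult_additive_left[OF Y] mult_additive_left[OF Z]])
    show "additive_map T T (\<lambda>X. X \<otimes>\<^bsub>T\<^esub> (Y \<otimes>\<^bsub>T\<^esub> Z))"
      by (rule mult_additive_left[OF mult_closed[OF Y Z]])
    fix v w assume vw: "v \<in> carrier V" "w \<in> carrier W"
    show "v \<otimes>\<otimes> w \<otimes>\<^bsub>T\<^esub> Y \<otimes>\<^bsub>T\<^esub> Z = v \<otimes>\<otimes> w \<otimes>\<^bsub>T\<^esub> (Y \<otimes>\<^bsub>T\<^esub> Z)"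
    proof (rule T_ext[OF _ _ _ Y])
      show "additive_map T T (\<lambda>Y. v \<otimes>\<otimes> w \<otimes>\<^bsub>T\<^esub> Y \<otimes>\<^bsub>T\<^esub> Z)"
        by (rule additive_map_comp[OF mult_additive_right[OF tens_closed[OF vw]] mult_additive_left[OF Z]])
      show "additive_map T T (\<lambda>Y. v \<otimes>\<otimes> w \<otimes>\<^bsub>T\<^esub> (Y \<otimes>\<^bsub>T\<^esub> Z))"
        by (rule additive_map_comp[OF mult_additive_left[OF Z] mult_additive_right[OF tens_closed[OF vw]]])
      fix v' w' assume vw': "v' \<in> carrier V" "w' \<in> carrier W"
      show "v \<otimes>\<otimes> w \<otimes>\<^bsub>T\<^esub> (v' \<otimes>\<otimes> w') \<otimes>\<^bsub>T\<^esub> Z = v \<otimes>\<otimes> w \<otimes>\<^bsub>T\<^esub> (v' \<otimes>\<otimes> w' \<otimes>\<^bsub>T\<^esub> Z)"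
      proof (rule T_ext[OF _ _ _ Z])
        show "additive_map T T (\<lambda>Z. v \<otimes>\<otimes> w \<otimes>\<^bsub>T\<^esub> (v' \<otimes>\<otimes> w') \<otimes>\<^bsub>T\<^esub> Z)"
          by (intro mult_additive_right mult_closed tens_closed vw vw')
        show "additive_map T T (\<lambda>Z. v \<otimes>\<otimes> w \<otimes>\<^bsub>T\<^esub> (v' \<otimes>\<otimes> w' \<otimes>\<^bsub>T\<^esub> Z))"
          by (rule additive_map_comp[OF mult_additive_right mult_additive_right]; intro tens_closed vw vw')
      qed (use vw vw' in \<open>simp add: mult_tens VR.m_assoc WR.m_assoc\<close>)
    qed
  qed
  have l1: "\<one>\<^bsub>T\<^esub> \<otimes>\<^bsub>T\<^esub> X = X" if "X \<in> carrier T" for X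
    by (rule T_ext[OF mult_additive_right[OF oc] additive_map_id(2) _ that]) (simp add: one_T mult_tens)
  have r1: "X \<otimes>\<^bsub>T\<^esub> \<one>\<^bsub>T\<^esub> = X" if "X \<in> carrier T" for X
    by (rule T_ext[OF mult_additive_left[OF oc] additive_map_id(2) _ that]) (simp add: one_T mult_tens)
  show "ring T"
  proof (rule ringI)
    show "monoid T" by (rule monoidI) (use oc mult_closed assoc l1 r1 in auto)
  qed (use additive_map_add[OF mult_additive_left] additive_map_add[OF mult_additive_right] in \<open>auto intro: abelian_T\<close>)
next
  fix c X Y assume X: "X \<in> carrier T" and Y: "Y \<in> carrier T"
  have pureX: "(c \<odot>\<^bsub>T\<^esub> (v \<otimes>\<otimes> w)) \<otimes>\<^bsub>T\<^esub> Y = c \<odot>\<^bsub>T\<^esub> (v \<otimes>\<otimes> w \<otimes>\<^bsub>T\<^esub> Y)"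
    "(v \<otimes>\<otimes> w) \<otimes>\<^bsub>T\<^esub> (c \<odot>\<^bsub>T\<^esub> Y) = c \<odot>\<^bsub>T\<^esub> (v \<otimes>\<otimes> w \<otimes>\<^bsub>T\<^esub> Y)"
    if vw: "v \<in> carrier V" "w \<in> carrier W" for v w
  proof -
    show "(c \<odot>\<^bsub>T\<^esub> (v \<otimes>\<otimes> w)) \<otimes>\<^bsub>T\<^esub> Y = c \<odot>\<^bsub>T\<^esub> (v \<otimes>\<otimes> w \<otimes>\<^bsub>T\<^esub> Y)"
      by (rule T_ext[OF mult_additive_right[OF smult_closed[OF tens_closed[OF vw]]]
            additive_map_comp[OF mult_additive_right[OF tens_closed[OF vw]] smult_additive] _ Y])
         (use vw in \<open>simp add: smult_tens mult_tens cmodule_simps(1)[OF V] unital_algebraD(3)[OF V_alg]\<close>)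
    show "(v \<otimes>\<otimes> w) \<otimes>\<^bsub>T\<^esub> (c \<odot>\<^bsub>T\<^esub> Y) = c \<odot>\<^bsub>T\<^esub> (v \<otimes>\<otimes> w \<otimes>\<^bsub>T\<^esub> Y)"
      by (rule T_ext[OF additive_map_comp[OF smult_additive mult_additive_right[OF tens_closed[OF vw]]]
            additive_map_comp[OF mult_additive_right[OF tens_closed[OF vw]] smult_additive] _ Y])
         (use vw in \<open>simp add: smult_tens mult_tens cmodule_simps(1)[OF V] unital_algebraD(4)[OF V_alg]\<close>)
  qed
  show "c \<odot>\<^bsub>T\<^esub> X \<otimes>\<^bsub>T\<^esub> Y = c \<odot>\<^bsub>T\<^esub> (X \<otimes>\<^bsub>T\<^esub> Y)"
    by (rule T_ext[OF additive_map_comp[OF smult_additive mult_additive_left[OF Y]]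
          additive_map_comp[OF mult_additive_left[OF Y] smult_additive] pureX(1) X])
  show "X \<otimes>\<^bsub>T\<^esub> (c \<odot>\<^bsub>T\<^esub> Y) = c \<odot>\<^bsub>T\<^esub> (X \<otimes>\<^bsub>T\<^esub> Y)"
    by (rule T_ext[OF mult_additive_left[OF smult_closed[OF Y]]
          additive_map_comp[OF mult_additive_left[OF Y] smult_additive] pureX(2) X])
qed

lemma one_T: "\<one>\<^bsub>T\<^esub> = \<one>\<^bsub>V\<^esub> \<otimes>\<otimes> \<one>\<^bsub>W\<^esub>"
  by (simp add: ctensor_def Let_def)

text \<open>Multiplicativity is additive in both arguments, so pure tensors suffice. Tensor products
  of algebra maps, the associativity isomorphism and the contractions with a counit are all obtained
  as algebra maps from this lemma.\<close>

lemma lift_ring_hom: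
  assumes R: "ring R" and f: "cbalanced V W R f"
    and mult: "\<And>v w v' w'. v \<in> carrier V \<Longrightarrow> w \<in> carrier W \<Longrightarrow> v' \<in> carrier V \<Longrightarrow> w' \<in> carrier W \<Longrightarrow>
      f (v \<otimes>\<^bsub>V\<^esub> v') (w \<otimes>\<^bsub>W\<^esub> w') = f v w \<otimes>\<^bsub>R\<^esub> f v' w'"
    and one: "f \<one>\<^bsub>V\<^esub> \<one>\<^bsub>W\<^esub> = \<one>\<^bsub>R\<^esub>"
  shows "tensor_lift R f \<in> ring_hom T R"
proof -
  interpret R: ring R by fact
  note a = lift_additive[OF R.is_abelian_group f] and p = lift_tens[OF R.is_abelian_group f]
  have c: "f v w \<in> carrier R" if "v \<in> carrier V" "w \<in> carrier W" for v w
    using additive_map_closed[OF a tens_closed[OF that]] p[OF that] by simp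
  show ?thesis
  proof (rule ring_hom_memI)
    fix X Y assume X: "X \<in> carrier T" and Y: "Y \<in> carrier T"
    have m: "additive_map R R (\<lambda>x. x \<otimes>\<^bsub>R\<^esub> z)" "additive_map R R ((\<otimes>\<^bsub>R\<^esub>) z)" if "z \<in> carrier R" for z
      using that by (auto intro!: additive_mapI simp: R.l_distr R.r_distr)
    show "tensor_lift R f (X \<otimes>\<^bsub>T\<^esub> Y) = tensor_lift R f X \<otimes>\<^bsub>R\<^esub> tensor_lift R f Y"
    proof (rule T_ext[OF _ _ _ X])
      show "additive_map T R (\<lambda>X. tensor_lift R f (X \<otimes>\<^bsub>T\<^esub> Y))"
        by (rule additive_map_comp[OF mult_additive_left[OF Y] a])
      show "additive_map T R (\<lambda>X. tensor_lift R f X \<otimes>\<^bsub>R\<^esub> tensor_lift R f Y)"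
        by (rule additive_map_comp[OF a m(1)[OF additive_map_closed[OF a Y]]])
      fix v w assume vw: "v \<in> carrier V" "w \<in> carrier W"
      show "tensor_lift R f (v \<otimes>\<otimes> w \<otimes>\<^bsub>T\<^esub> Y) = tensor_lift R f (v \<otimes>\<otimes> w) \<otimes>\<^bsub>R\<^esub> tensor_lift R f Y"
      proof (rule T_ext[OF _ _ _ Y])
        show "additive_map T R (\<lambda>Y. tensor_lift R f (v \<otimes>\<otimes> w \<otimes>\<^bsub>T\<^esub> Y))"
          by (rule additive_map_comp[OF mult_additive_right[OF tens_closed[OF vw]] a])
        show "additive_map T R (\<lambda>Y. tensor_lift R f (v \<otimes>\<otimes> w) \<otimes>\<^bsub>R\<^esub> tensor_lift R f Y)"
          by (rule additive_map_comp[OF a m(2)[OF additive_map_closed[OF a tens_closed[OF vw]]]])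
      qed (use vw in \<open>simp add: mult_tens p mult\<close>)
    qed
  qed (use additive_map_closed[OF a] additive_map_add[OF a] in \<open>auto simp: one_T p one\<close>)
qed

end

section \<open>Tensor products of linear maps\<close>

lemma ctensor_map_clinear:
  assumes "cmodule V" "cmodule W" "cmodule V'" "cmodule W'" "clinear V V' f" "clinear W W' g"
  shows "clinear (ctensor V W) (ctensor V' W') (ctensor_map V' W' f g)"
proof -
  interpret P: cmodule_pair V W by (rule cmodule_pairI[OF assms(1,2)])
  interpret P': cmodule_pair V' W' by (rule cmodule_pairI[OF assms(3,4)])
  show ?thesis
    unfolding ctensor_map_def by (rule P.lift_clinear[OF P'.cmodule_T ctensor_map_bilinear[OF assms(3-6)]])
qed

lemma ctensor_map_tens:
  assumes "cmodule V" "cmodule W" "cmodule V'" "cmodule W'" "clinear V V' f" "clinear W W' g"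
    and "v \<in> carrier V" "w \<in> carrier W"
  shows "ctensor_map V' W' f g (ctens V W v w) = ctens V' W' (f v) (g w)"
proof -
  interpret P: cmodule_pair V W by (rule cmodule_pairI[OF assms(1,2)])
  interpret P': cmodule_pair V' W' by (rule cmodule_pairI[OF assms(3,4)])
  show ?thesis
    unfolding ctensor_map_def
    by (rule P.lift_tens[OF P'.abelian_T cbilinear_balanced[OF ctensor_map_bilinear[OF assms(3-6)]] assms(7,8)])
qed

lemma ctensor_map_ring_hom:
  assumes alg: "unital_algebra V" "unital_algebra W" "unital_algebra V'" "unital_algebra W'"
    and lin: "clinear V V' f" "clinear W W' g" and hom: "f \<in> ring_hom V V'" "g \<in> ring_hom W W'"
  shows "ctensor_map V' W' f g \<in> ring_hom (ctensor V W) (ctensor V' W')"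
proof -
  interpret P: algebra_pair V W by (rule algebra_pair.intro[OF alg(1,2)])
  interpret P': algebra_pair V' W' by (rule algebra_pair.intro[OF alg(3,4)])
  show ?thesis
    unfolding ctensor_map_def
    by (rule P.lift_ring_hom[OF unital_algebraD(2)[OF P'.unital_algebra_T]
          cbilinear_balanced[OF ctensor_map_bilinear[OF P'.V P'.W lin]]])
       (simp_all add: ring_hom_mult[OF hom(1)] ring_hom_mult[OF hom(2)] ring_hom_one[OF hom(1)] ring_hom_one[OF hom(2)]
          P'.one_T P'.mult_tens ring_hom_closed[OF hom(1)] ring_hom_closed[OF hom(2)])
qed

section \<open>Associativity of the tensor product\<close>

locale cmodule_triple =
  fixes U :: "(complex, 'u, 'x) module_scheme" and V :: "(complex, 'v, 'y) module_scheme"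
    and W :: "(complex, 'w, 'z) module_scheme"
  assumes U: "cmodule U" and V: "cmodule V" and W: "cmodule W"
begin

sublocale UV: cmodule_pair U V by (rule cmodule_pairI[OF U V])
sublocale VW: cmodule_pair V W by (rule cmodule_pairI[OF V W])
sublocale L: cmodule_pair "ctensor U V" W by (rule cmodule_pairI[OF UV.cmodule_T W])
sublocale R: cmodule_pair U "ctensor V W" by (rule cmodule_pairI[OF U VW.cmodule_T])

lemma assoc_inner_bilinear: "w \<in> carrier W \<Longrightarrow> cbilinear U V R.T (\<lambda>u v. R.tens u (VW.tens v w))"
  by (intro cbilinearI clinear_comp[OF cbilinearD(2)[OF VW.tens_cbilinear] cbilinearD(1)[OF R.tens_cbilinear]]
      cbilinearD(2)[OF R.tens_cbilinear] VW.tens_closed)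

text \<open>The inner one of the two nested lifts in \<open>ctensor_assoc\<close>, with the third
  factor as a parameter. The outer lift becomes meaningful once this is known to be bilinear in
  \<open>t\<close> and \<open>w\<close>.\<close>

definition assoc_inner where
  "assoc_inner t w = tensor_lift R.T (\<lambda>u v. R.tens u (VW.tens v w)) t"

lemma assoc_inner_clinear: "w \<in> carrier W \<Longrightarrow> clinear UV.T R.T (\<lambda>t. assoc_inner t w)"
  unfolding assoc_inner_def by (rule UV.lift_clinear[OF R.cmodule_T assoc_inner_bilinear])

lemma assoc_inner_tens: "u \<in> carrier U \<Longrightarrow> v \<in> carrier V \<Longrightarrow> w \<in> carrier W \<Longrightarrow>
    assoc_inner (UV.tens u v) w = R.tens u (VW.tens v w)"
  unfolding assoc_inner_def
  by (rule UV.lift_tens[OF R.abelian_T cbilinear_balanced[OF assoc_inner_bilinear]])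

lemma assoc_bilinear: "cbilinear UV.T W R.T assoc_inner"
proof (rule cbilinearI[OF clinearI assoc_inner_clinear])
  fix t assume t: "t \<in> carrier UV.T"
  note ad = clinear_additive[OF assoc_inner_clinear]
  show "additive_map W R.T (assoc_inner t)"
  proof (rule additive_mapI)
    fix w w' assume *: "w \<in> carrier W" "w' \<in> carrier W"
    have ww: "w \<oplus>\<^bsub>W\<^esub> w' \<in> carrier W" using cmodule_abelian[OF W] * by (simp add: abelian_groupE(1))
    show "assoc_inner t (w \<oplus>\<^bsub>W\<^esub> w') = assoc_inner t w \<oplus>\<^bsub>R.T\<^esub> assoc_inner t w'"
      by (rule UV.T_ext[OF ad[OF ww] additive_map_plus[OF R.abelian_T ad[OF *(1)] ad[OF *(2)]] _ t])
         (use * ww in \<open>simp add: assoc_inner_tens VW.tens_add_right R.tens_add_right VW.tens_closed\<close>)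
  qed (use additive_map_closed[OF ad t] in auto)
  fix c w assume w: "w \<in> carrier W"
  have s: "additive_map R.T R.T ((\<odot>\<^bsub>R.T\<^esub>) c)" by (rule R.smult_additive)
  show "assoc_inner t (c \<odot>\<^bsub>W\<^esub> w) = c \<odot>\<^bsub>R.T\<^esub> assoc_inner t w"
    by (rule UV.T_ext[OF ad additive_map_comp[OF ad s] _ t])
       (use w in \<open>simp_all add: assoc_inner_tens cmodule_simps(1)[OF W] R.smult_tens_right VW.tens_closed VW.smult_tens_right\<close>)
qed

lemma ctensor_assoc_eq: "ctensor_assoc U V W = tensor_lift R.T assoc_inner"
  unfolding ctensor_assoc_def Let_def assoc_inner_def[abs_def] by (rule refl)

lemma ctensor_assoc_clinear: "clinear L.T R.T (ctensor_assoc U V W)"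
  unfolding ctensor_assoc_eq by (rule L.lift_clinear[OF R.cmodule_T assoc_bilinear])

lemma ctensor_assoc_tens': "t \<in> carrier UV.T \<Longrightarrow> w \<in> carrier W \<Longrightarrow>
    ctensor_assoc U V W (L.tens t w) = assoc_inner t w"
  unfolding ctensor_assoc_eq by (rule L.lift_tens[OF R.abelian_T cbilinear_balanced[OF assoc_bilinear]])

lemma ctensor_assoc_tens: "u \<in> carrier U \<Longrightarrow> v \<in> carrier V \<Longrightarrow> w \<in> carrier W \<Longrightarrow>
    ctensor_assoc U V W (L.tens (UV.tens u v) w) = R.tens u (VW.tens v w)"
  by (simp add: ctensor_assoc_tens' UV.tens_closed assoc_inner_tens)

end

lemma ctensor_assoc_ring_hom:
  assumes alg: "unital_algebra U" "unital_algebra V" "unital_algebra W"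
  shows "ctensor_assoc U V W \<in> ring_hom (ctensor (ctensor U V) W) (ctensor U (ctensor V W))"
proof -
  interpret UV: algebra_pair U V by (rule algebra_pair.intro[OF alg(1,2)])
  interpret VW: algebra_pair V W by (rule algebra_pair.intro[OF alg(2,3)])
  interpret L: algebra_pair "ctensor U V" W by (rule algebra_pair.intro[OF UV.unital_algebra_T alg(3)])
  interpret R: algebra_pair U "ctensor V W" by (rule algebra_pair.intro[OF alg(1) VW.unital_algebra_T])
  interpret T: cmodule_triple U V W by (intro cmodule_triple.intro unital_algebraD alg)
  note ad = clinear_additive[OF T.assoc_inner_clinear]
  show ?thesis
    unfolding T.ctensor_assoc_eq
  proof (rule L.lift_ring_hom[OF unital_algebraD(2)[OF R.unital_algebra_T] cbilinear_balanced[OF T.assoc_bilinear]])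
    fix t w t' w' assume t: "t \<in> carrier UV.T" and w: "w \<in> carrier W" and t': "t' \<in> carrier UV.T" and w': "w' \<in> carrier W"
    have ww: "w \<otimes>\<^bsub>W\<^esub> w' \<in> carrier W" using w w' by simp
    show "T.assoc_inner (t \<otimes>\<^bsub>UV.T\<^esub> t') (w \<otimes>\<^bsub>W\<^esub> w') = T.assoc_inner t w \<otimes>\<^bsub>R.T\<^esub> T.assoc_inner t' w'"
    proof (rule UV.T_ext[OF _ _ _ t])
      show "additive_map UV.T R.T (\<lambda>t. T.assoc_inner (t \<otimes>\<^bsub>UV.T\<^esub> t') (w \<otimes>\<^bsub>W\<^esub> w'))"
        by (rule additive_map_comp[OF UV.mult_additive_left[OF t'] ad[OF ww]])
      show "additive_map UV.T R.T (\<lambda>t. T.assoc_inner t w \<otimes>\<^bsub>R.T\<^esub> T.assoc_inner t' w')"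
        by (rule additive_map_comp[OF ad[OF w] R.mult_additive_left[OF additive_map_closed[OF ad[OF w'] t']]])
      fix u v assume uv: "u \<in> carrier U" "v \<in> carrier V"
      show "T.assoc_inner (UV.tens u v \<otimes>\<^bsub>UV.T\<^esub> t') (w \<otimes>\<^bsub>W\<^esub> w') = T.assoc_inner (UV.tens u v) w \<otimes>\<^bsub>R.T\<^esub> T.assoc_inner t' w'"
      proof (rule UV.T_ext[OF _ _ _ t'])
        show "additive_map UV.T R.T (\<lambda>t'. T.assoc_inner (UV.tens u v \<otimes>\<^bsub>UV.T\<^esub> t') (w \<otimes>\<^bsub>W\<^esub> w'))"
          by (rule additive_map_comp[OF UV.mult_additive_right[OF UV.tens_closed[OF uv]] ad[OF ww]])
        show "additive_map UV.T R.T (\<lambda>t'. T.assoc_inner (UV.tens u v) w \<otimes>\<^bsub>R.T\<^esub> T.assoc_inner t' w')"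
          by (rule additive_map_comp[OF ad[OF w'] R.mult_additive_right[OF additive_map_closed[OF ad[OF w] UV.tens_closed[OF uv]]]])
      qed (use uv w w' in \<open>simp add: UV.mult_tens T.assoc_inner_tens R.mult_tens VW.tens_closed VW.mult_tens\<close>)
    qed
  qed (simp add: UV.one_T R.one_T VW.one_T T.assoc_inner_tens)
qed


section \<open>Free modules of rank two\<close>

text \<open>\<open>Module.module\<close> presupposes commutative scalars and so serves here for the
  complex numbers only; the scalars meant now are \<open>H\<close> and its tensor powers.\<close>

definition lmodule :: "('r, 'x) ring_scheme \<Rightarrow> ('r, 'm, 'y) module_scheme \<Rightarrow> bool"
  where "lmodule R M \<longleftrightarrow> ring R \<and> abelian_group M \<and>
    (\<forall>r\<in>carrier R. \<forall>m\<in>carrier M. r \<odot>\<^bsub>M\<^esub> m \<in> carrier M) \<and>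
    (\<forall>r\<in>carrier R. \<forall>s\<in>carrier R. \<forall>m\<in>carrier M. (r \<oplus>\<^bsub>R\<^esub> s) \<odot>\<^bsub>M\<^esub> m = r \<odot>\<^bsub>M\<^esub> m \<oplus>\<^bsub>M\<^esub> s \<odot>\<^bsub>M\<^esub> m) \<and>
    (\<forall>r\<in>carrier R. \<forall>m\<in>carrier M. \<forall>n\<in>carrier M. r \<odot>\<^bsub>M\<^esub> (m \<oplus>\<^bsub>M\<^esub> n) = r \<odot>\<^bsub>M\<^esub> m \<oplus>\<^bsub>M\<^esub> r \<odot>\<^bsub>M\<^esub> n) \<and>
    (\<forall>r\<in>carrier R. \<forall>s\<in>carrier R. \<forall>m\<in>carrier M. (r \<otimes>\<^bsub>R\<^esub> s) \<odot>\<^bsub>M\<^esub> m = r \<odot>\<^bsub>M\<^esub> (s \<odot>\<^bsub>M\<^esub> m)) \<and>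
    (\<forall>m\<in>carrier M. \<one>\<^bsub>R\<^esub> \<odot>\<^bsub>M\<^esub> m = m)"

lemma lmoduleD:
  assumes "lmodule R M"
  shows "ring R" "abelian_group M"
    "\<And>r m. r \<in> carrier R \<Longrightarrow> m \<in> carrier M \<Longrightarrow> r \<odot>\<^bsub>M\<^esub> m \<in> carrier M"
    "\<And>r s m. r \<in> carrier R \<Longrightarrow> s \<in> carrier R \<Longrightarrow> m \<in> carrier M \<Longrightarrow>
      (r \<oplus>\<^bsub>R\<^esub> s) \<odot>\<^bsub>M\<^esub> m = r \<odot>\<^bsub>M\<^esub> m \<oplus>\<^bsub>M\<^esub> s \<odot>\<^bsub>M\<^esub> m"
    "\<And>r m n. r \<in> carrier R \<Longrightarrow> m \<in> carrier M \<Longrightarrow> n \<in> carrier M \<Longrightarrow>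
      r \<odot>\<^bsub>M\<^esub> (m \<oplus>\<^bsub>M\<^esub> n) = r \<odot>\<^bsub>M\<^esub> m \<oplus>\<^bsub>M\<^esub> r \<odot>\<^bsub>M\<^esub> n"
    "\<And>r s m. r \<in> carrier R \<Longrightarrow> s \<in> carrier R \<Longrightarrow> m \<in> carrier M \<Longrightarrow> (r \<otimes>\<^bsub>R\<^esub> s) \<odot>\<^bsub>M\<^esub> m = r \<odot>\<^bsub>M\<^esub> (s \<odot>\<^bsub>M\<^esub> m)"
    "\<And>m. m \<in> carrier M \<Longrightarrow> \<one>\<^bsub>R\<^esub> \<odot>\<^bsub>M\<^esub> m = m"
  using assms unfolding lmodule_def by blast+

lemma lmodule_zero:
  assumes M: "lmodule R M"
  shows "m \<in> carrier M \<Longrightarrow> \<zero>\<^bsub>R\<^esub> \<odot>\<^bsub>M\<^esub> m = \<zero>\<^bsub>M\<^esub>" "r \<in> carrier R \<Longrightarrow> r \<odot>\<^bsub>M\<^esub> \<zero>\<^bsub>M\<^esub> = \<zero>\<^bsub>M\<^esub>"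
proof -
  interpret R: ring R by (rule lmoduleD(1)[OF M])
  interpret M: abelian_group M by (rule lmoduleD(2)[OF M])
  show "\<zero>\<^bsub>R\<^esub> \<odot>\<^bsub>M\<^esub> m = \<zero>\<^bsub>M\<^esub>" if "m \<in> carrier M"
    by (rule additive_map_zero[OF R.is_abelian_group M.abelian_group_axioms, of "\<lambda>r. r \<odot>\<^bsub>M\<^esub> m"])
       (use that in \<open>auto intro!: additive_mapI simp: lmoduleD[OF M]\<close>)
  show "r \<odot>\<^bsub>M\<^esub> \<zero>\<^bsub>M\<^esub> = \<zero>\<^bsub>M\<^esub>" if "r \<in> carrier R"
    by (rule additive_map_zero[OF M.abelian_group_axioms M.abelian_group_axioms, of "(\<odot>\<^bsub>M\<^esub>) r"])
       (use that in \<open>auto intro!: additive_mapI simp: lmoduleD[OF M]\<close>)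
qed

definition comb2 :: "('r, 'm, 'y) module_scheme \<Rightarrow> 'm \<Rightarrow> 'm \<Rightarrow> 'r \<Rightarrow> 'r \<Rightarrow> 'm"
  where "comb2 M x y r s = r \<odot>\<^bsub>M\<^esub> x \<oplus>\<^bsub>M\<^esub> s \<odot>\<^bsub>M\<^esub> y"

text \<open>The basis is part of the predicate because the natural maps into extensions of scalars
  carry bases to bases. Every map in the two conditions then has a definite matrix.\<close>

definition free2 :: "('r, 'x) ring_scheme \<Rightarrow> ('r, 'm, 'y) module_scheme \<Rightarrow> 'm \<Rightarrow> 'm \<Rightarrow> bool"
  where "free2 R M x y \<longleftrightarrow> lmodule R M \<and> x \<in> carrier M \<and> y \<in> carrier M \<and>
    (\<forall>m\<in>carrier M. \<exists>r\<in>carrier R. \<exists>s\<in>carrier R. m = comb2 M x y r s) \<and>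
    (\<forall>r\<in>carrier R. \<forall>s\<in>carrier R. \<forall>r'\<in>carrier R. \<forall>s'\<in>carrier R.
       comb2 M x y r s = comb2 M x y r' s' \<longrightarrow> r = r' \<and> s = s')"

lemma comb2_closed: "lmodule R M \<Longrightarrow> x \<in> carrier M \<Longrightarrow> y \<in> carrier M \<Longrightarrow> r \<in> carrier R \<Longrightarrow> s \<in> carrier R \<Longrightarrow>
    comb2 M x y r s \<in> carrier M"
  unfolding comb2_def by (simp add: lmoduleD(3) abelian_groupE(1)[OF lmoduleD(2)])

lemma comb2_add:
  assumes M: "lmodule R M" and "x \<in> carrier M" "y \<in> carrier M"
    "r \<in> carrier R" "s \<in> carrier R" "r' \<in> carrier R" "s' \<in> carrier R"
  shows "comb2 M x y r s \<oplus>\<^bsub>M\<^esub> comb2 M x y r' s' = comb2 M x y (r \<oplus>\<^bsub>R\<^esub> r') (s \<oplus>\<^bsub>R\<^esub> s')"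
proof -
  interpret M: abelian_group M by (rule lmoduleD(2)[OF M])
  show ?thesis using assms by (simp add: comb2_def lmoduleD[OF M] M.a_ac)
qed

lemma comb2_smult:
  assumes M: "lmodule R M" and "x \<in> carrier M" "y \<in> carrier M"
    "r \<in> carrier R" "s \<in> carrier R" "t \<in> carrier R"
  shows "t \<odot>\<^bsub>M\<^esub> comb2 M x y r s = comb2 M x y (t \<otimes>\<^bsub>R\<^esub> r) (t \<otimes>\<^bsub>R\<^esub> s)"
  using assms by (simp add: comb2_def lmoduleD[OF M])

lemma comb2_basis:
  assumes M: "lmodule R M" and "x \<in> carrier M" "y \<in> carrier M"
  shows "comb2 M x y \<one>\<^bsub>R\<^esub> \<zero>\<^bsub>R\<^esub> = x" "comb2 M x y \<zero>\<^bsub>R\<^esub> \<one>\<^bsub>R\<^esub> = y"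
proof -
  interpret M: abelian_group M by (rule lmoduleD(2)[OF M])
  show "comb2 M x y \<one>\<^bsub>R\<^esub> \<zero>\<^bsub>R\<^esub> = x" "comb2 M x y \<zero>\<^bsub>R\<^esub> \<one>\<^bsub>R\<^esub> = y"
    using assms by (simp_all add: comb2_def lmoduleD[OF M] lmodule_zero[OF M])
qed

lemma free2D:
  assumes "free2 R M x y"
  shows "lmodule R M" "x \<in> carrier M" "y \<in> carrier M"
    "m \<in> carrier M \<Longrightarrow> \<exists>r\<in>carrier R. \<exists>s\<in>carrier R. m = comb2 M x y r s"
    "r \<in> carrier R \<Longrightarrow> s \<in> carrier R \<Longrightarrow> r' \<in> carrier R \<Longrightarrow> s' \<in> carrier R \<Longrightarrow>
      comb2 M x y r s = comb2 M x y r' s' \<Longrightarrow> r = r' \<and> s = s'"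
  using assms unfolding free2_def by blast+

text \<open>Independence is witnessed by two coordinate functions. They are only asked to be
  additive and correct on multiples of the basis vectors, which is what a map obtained by
  \<open>tensor_lift\<close> provides at once.\<close>

lemma free2I:
  assumes M: "lmodule R M" and xy: "x \<in> carrier M" "y \<in> carrier M"
    and span: "\<And>m. m \<in> carrier M \<Longrightarrow> \<exists>r\<in>carrier R. \<exists>s\<in>carrier R. m = comb2 M x y r s"
    and c: "additive_map M R c" "additive_map M R d"
      "\<And>r. r \<in> carrier R \<Longrightarrow> c (r \<odot>\<^bsub>M\<^esub> x) = r" "\<And>r. r \<in> carrier R \<Longrightarrow> c (r \<odot>\<^bsub>M\<^esub> y) = \<zero>\<^bsub>R\<^esub>"
      "\<And>r. r \<in> carrier R \<Longrightarrow> d (r \<odot>\<^bsub>M\<^esub> x) = \<zero>\<^bsub>R\<^esub>" "\<And>r. r \<in> carrier R \<Longrightarrow> d (r \<odot>\<^bsub>M\<^esub> y) = r"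
  shows "free2 R M x y"
proof -
  interpret R: ring R by (rule lmoduleD(1)[OF M])
  have "c (comb2 M x y r s) = r \<and> d (comb2 M x y r s) = s" if "r \<in> carrier R" "s \<in> carrier R" for r s
    using that xy lmoduleD(3)[OF M] c(3-6) by (simp add: comb2_def additive_map_add[OF c(1)] additive_map_add[OF c(2)])
  then show ?thesis using M xy span unfolding free2_def by metis
qed

lemma lmod_hom_comb2:
  assumes f: "f \<in> lmod_hom R M N" and M: "lmodule R M" and "x \<in> carrier M" "y \<in> carrier M"
    "r \<in> carrier R" "s \<in> carrier R"
  shows "f (comb2 M x y r s) = comb2 N (f x) (f y) r s"
  using assms lmoduleD(3)[OF M] by (auto simp: lmod_hom_def comb2_def)

lemma lmod_hom_ext:
  assumes "f \<in> lmod_hom R M N" "g \<in> lmod_hom R M N" "free2 R M x y" "f x = g x" "f y = g y" "m \<in> carrier M"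
  shows "f m = g m"
  using free2D(4)[OF assms(3,6)] lmod_hom_comb2[OF _ free2D(1-3)[OF assms(3)]] assms by metis

lemma lmod_hom_closed: "f \<in> lmod_hom R M N \<Longrightarrow> m \<in> carrier M \<Longrightarrow> f m \<in> carrier N"
  by (auto simp: lmod_hom_def)

lemma free2_coordinates:
  assumes F: "free2 R M x y"
  obtains c d where "additive_map M R c" "additive_map M R d"
    "\<And>r m. r \<in> carrier R \<Longrightarrow> m \<in> carrier M \<Longrightarrow> c (r \<odot>\<^bsub>M\<^esub> m) = r \<otimes>\<^bsub>R\<^esub> c m"
    "\<And>r m. r \<in> carrier R \<Longrightarrow> m \<in> carrier M \<Longrightarrow> d (r \<odot>\<^bsub>M\<^esub> m) = r \<otimes>\<^bsub>R\<^esub> d m"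
    "\<And>m. m \<in> carrier M \<Longrightarrow> m = comb2 M x y (c m) (d m)"
    "c x = \<one>\<^bsub>R\<^esub>" "d x = \<zero>\<^bsub>R\<^esub>" "c y = \<zero>\<^bsub>R\<^esub>" "d y = \<one>\<^bsub>R\<^esub>"
proof -
  note M = free2D(1)[OF F] and xy = free2D(2,3)[OF F]
  interpret R: ring R by (rule lmoduleD(1)[OF M])
  have "\<forall>m\<in>carrier M. \<exists>p. fst p \<in> carrier R \<and> snd p \<in> carrier R \<and> m = comb2 M x y (fst p) (snd p)"
    using free2D(4)[OF F] by fastforce
  then obtain q where q: "\<And>m. m \<in> carrier M \<Longrightarrow> fst (q m) \<in> carrier R \<and> snd (q m) \<in> carrier R \<and> m = comb2 M x y (fst (q m)) (snd (q m))"
    by metis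
  have qI: "fst (q m) = r \<and> snd (q m) = s" if "r \<in> carrier R" "s \<in> carrier R" "m = comb2 M x y r s" for m r s
    using q[of m] that free2D(5)[OF F, of "fst (q m)" "snd (q m)" r s] comb2_closed[OF M xy that(1,2)] by auto
  have add: "fst (q (m \<oplus>\<^bsub>M\<^esub> n)) = fst (q m) \<oplus>\<^bsub>R\<^esub> fst (q n) \<and> snd (q (m \<oplus>\<^bsub>M\<^esub> n)) = snd (q m) \<oplus>\<^bsub>R\<^esub> snd (q n)"
    if "m \<in> carrier M" "n \<in> carrier M" for m n
    by (rule qI) (use q[OF that(1)] q[OF that(2)] comb2_add[OF M xy, of "fst (q m)" "snd (q m)" "fst (q n)" "snd (q n)"] in auto)
  have smult: "fst (q (r \<odot>\<^bsub>M\<^esub> m)) = r \<otimes>\<^bsub>R\<^esub> fst (q m) \<and> snd (q (r \<odot>\<^bsub>M\<^esub> m)) = r \<otimes>\<^bsub>R\<^esub> snd (q m)"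
    if "r \<in> carrier R" "m \<in> carrier M" for r m
    by (rule qI) (use q[OF that(2)] that(1) comb2_smult[OF M xy, of "fst (q m)" "snd (q m)" r] in auto)
  have bx: "fst (q x) = \<one>\<^bsub>R\<^esub> \<and> snd (q x) = \<zero>\<^bsub>R\<^esub>" by (rule qI) (simp_all add: comb2_basis[OF M xy])
  have b_y: "fst (q y) = \<zero>\<^bsub>R\<^esub> \<and> snd (q y) = \<one>\<^bsub>R\<^esub>" by (rule qI) (simp_all add: comb2_basis[OF M xy])
  show thesis
    by (rule that[of "\<lambda>m. fst (q m)" "\<lambda>m. snd (q m)"]) (use q add smult bx b_y in \<open>auto intro!: additive_mapI\<close>)
qed

lemma free2_hom_exists:
  assumes F: "free2 R M x y" and N: "lmodule R N" and uv: "u \<in> carrier N" "v \<in> carrier N"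
  obtains f where "f \<in> lmod_hom R M N" "f \<in> extensional (carrier M)" "f x = u" "f y = v"
proof -
  note M = free2D(1)[OF F] and xy = free2D(2,3)[OF F]
  obtain c d where c: "additive_map M R c" "additive_map M R d"
    "\<And>r m. r \<in> carrier R \<Longrightarrow> m \<in> carrier M \<Longrightarrow> c (r \<odot>\<^bsub>M\<^esub> m) = r \<otimes>\<^bsub>R\<^esub> c m"
    "\<And>r m. r \<in> carrier R \<Longrightarrow> m \<in> carrier M \<Longrightarrow> d (r \<odot>\<^bsub>M\<^esub> m) = r \<otimes>\<^bsub>R\<^esub> d m"
    "\<And>m. m \<in> carrier M \<Longrightarrow> m = comb2 M x y (c m) (d m)"
    "c x = \<one>\<^bsub>R\<^esub>" "d x = \<zero>\<^bsub>R\<^esub>" "c y = \<zero>\<^bsub>R\<^esub>" "d y = \<one>\<^bsub>R\<^esub>"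
    by (rule free2_coordinates[OF F]) (rule that)
  note cc = additive_map_closed[OF c(1)] additive_map_closed[OF c(2)]
  have ac: "m \<oplus>\<^bsub>M\<^esub> n \<in> carrier M" if "m \<in> carrier M" "n \<in> carrier M" for m n
    using abelian_groupE(1)[OF lmoduleD(2)[OF M]] that .
  show thesis
  proof (rule that[of "\<lambda>m\<in>carrier M. comb2 N u v (c m) (d m)"])
    show "(\<lambda>m\<in>carrier M. comb2 N u v (c m) (d m)) \<in> lmod_hom R M N"
      unfolding lmod_hom_def
      by (auto simp: comb2_closed[OF N uv] cc ac lmoduleD(3)[OF M] additive_map_add[OF c(1)] additive_map_add[OF c(2)]
          comb2_add[OF N uv] comb2_smult[OF N uv] c(3,4))
  qed (use xy in \<open>auto simp: c comb2_basis[OF N uv]\<close>)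
qed

section \<open>Semilinear maps and the canonical identifications\<close>

definition semilinear ::
  "('a \<Rightarrow> 'b) \<Rightarrow> ('a, 'x) ring_scheme \<Rightarrow> ('a, 'm, 'y) module_scheme \<Rightarrow> ('b, 'n, 'z) module_scheme \<Rightarrow> ('m \<Rightarrow> 'n) \<Rightarrow> bool"
  where "semilinear \<phi> A M N i \<longleftrightarrow> additive_map M N i \<and>
    (\<forall>a\<in>carrier A. \<forall>m\<in>carrier M. i (a \<odot>\<^bsub>M\<^esub> m) = \<phi> a \<odot>\<^bsub>N\<^esub> i m)"

lemma semilinear_comb2:
  assumes "semilinear \<phi> A M N i" "lmodule A M" "x \<in> carrier M" "y \<in> carrier M" "r \<in> carrier A" "s \<in> carrier A"
  shows "i (comb2 M x y r s) = comb2 N (i x) (i y) (\<phi> r) (\<phi> s)"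
  using assms lmoduleD(3)[OF assms(2)] by (auto simp: semilinear_def comb2_def additive_map_def)

text \<open>The description in \<open>canonical_iso\<close> denotes a map here because
  \<open>i\<close> and \<open>j\<close> take one basis of \<open>M\<close> to bases of
  \<open>X\<close> and \<open>Y\<close>. The linear map matching these bases is bijective,
  semilinearity makes it compatible on all of \<open>M\<close>, and two values determine it. The
  maps \<phi> and \<psi> are the two composite algebra maps, which must agree for this.\<close>

lemma canonical_iso:
  assumes M: "free2 A M x y"
    and X: "free2 B X (i x) (i y)" and i: "semilinear \<phi> A M X i"
    and Y: "free2 B Y (j x) (j y)" and j: "semilinear \<psi> A M Y j"
    and \<phi>: "\<And>a. a \<in> carrier A \<Longrightarrow> \<phi> a \<in> carrier B" "\<And>a. a \<in> carrier A \<Longrightarrow> \<phi> a = \<psi> a"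
  shows "canonical_iso B (carrier M) X i Y j \<in> lmod_hom B X Y"
    and "m \<in> carrier M \<Longrightarrow> canonical_iso B (carrier M) X i Y j (i m) = j m"
proof -
  note lM = free2D(1)[OF M] and xy = free2D(2,3)[OF M]
  obtain f where f: "f \<in> lmod_hom B X Y" "f \<in> extensional (carrier X)" "f (i x) = j x" "f (i y) = j y"
    by (rule free2_hom_exists[OF X free2D(1-3)[OF Y]]) (rule that)
  obtain g where g: "g \<in> lmod_hom B Y X" "g \<in> extensional (carrier Y)" "g (j x) = i x" "g (j y) = i y"
    by (rule free2_hom_exists[OF Y free2D(1-3)[OF X]]) (rule that)
  have gf: "(\<lambda>z. g (f z)) \<in> lmod_hom B X X" "(\<lambda>z. f (g z)) \<in> lmod_hom B Y Y"
    "(\<lambda>z. z) \<in> lmod_hom B X X" "(\<lambda>z. z) \<in> lmod_hom B Y Y"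
    using f(1) g(1) by (auto simp: lmod_hom_def Pi_def)
  have "g (f z) = z" if "z \<in> carrier X" for z
    using lmod_hom_ext[OF gf(1,3) X _ _ that] f g by simp
  moreover have "f (g z) = z" if "z \<in> carrier Y" for z
    using lmod_hom_ext[OF gf(2,4) Y _ _ that] f g by simp
  ultimately have bij: "bij_betw f (carrier X) (carrier Y)"
    using lmod_hom_closed[OF f(1)] lmod_hom_closed[OF g(1)] by (intro bij_betwI[where g = g]) auto
  have fi: "f (i m) = j m" if m: "m \<in> carrier M" for m
  proof -
    obtain r s where rs: "r \<in> carrier A" "s \<in> carrier A" "m = comb2 M x y r s"
      using free2D(4)[OF M m] by blast
    then show ?thesis
      using semilinear_comb2[OF i lM xy rs(1,2)] semilinear_comb2[OF j lM xy rs(1,2)]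
        lmod_hom_comb2[OF f(1) free2D(1-3)[OF X]] \<phi> f(3,4) by simp
  qed
  have "canonical_iso B (carrier M) X i Y j = f"
    unfolding canonical_iso_def
  proof (rule the_equality)
    show "f \<in> lmod_iso B X Y \<inter> extensional (carrier X) \<and> (\<forall>m\<in>carrier M. f (i m) = j m)"
      using f bij fi by (auto simp: lmod_iso_def)
    fix h assume h: "h \<in> lmod_iso B X Y \<inter> extensional (carrier X) \<and> (\<forall>m\<in>carrier M. h (i m) = j m)"
    then have hh: "h \<in> lmod_hom B X Y" by (auto simp: lmod_iso_def)
    have "h z = f z" if "z \<in> carrier X" for z
      by (rule lmod_hom_ext[OF hh f(1) X _ _ that]) (use h f xy in auto)
    then show "h = f" using h f(2) by (intro extensionalityI[where A = "carrier X"]) auto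
  qed
  then show "canonical_iso B (carrier M) X i Y j \<in> lmod_hom B X Y"
    and "m \<in> carrier M \<Longrightarrow> canonical_iso B (carrier M) X i Y j (i m) = j m"
    using f(1) fi by auto
qed

section \<open>Extension of scalars\<close>

locale scalar_extension =
  fixes A :: "('a, 'x) ring_scheme" and B :: "('b, 'y) ring_scheme" and \<phi> :: "'a \<Rightarrow> 'b"
    and M :: "('a, 'm, 'z) module_scheme"
  assumes B: "ring B" and \<phi>: "\<phi> \<in> ring_hom A B" and M: "lmodule A M"
begin

sublocale AR: ring A by (rule lmoduleD(1)[OF M])
sublocale BR: ring B by (rule B)
sublocale MG: abelian_group M by (rule lmoduleD(2)[OF M])

abbreviation "E \<equiv> ext_scalars B \<phi> A M"
abbreviation "et \<equiv> ext_tens B \<phi> A M"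
abbreviation "unit_map \<equiv> ext_nat B \<phi> A M"

lemma \<phi>_closed: "a \<in> carrier A \<Longrightarrow> \<phi> a \<in> carrier B"
  by (rule ring_hom_closed[OF \<phi>])

lemma tensor_data: "tensor_data A B (\<lambda>b a. b \<otimes>\<^bsub>B\<^esub> \<phi> a) M"
  by (intro tensor_data.intro tensor_data_axioms.intro BR.is_abelian_group MG.abelian_group_axioms)
     (simp_all add: \<phi>_closed lmoduleD(3)[OF M])

sublocale td?: tensor_product A B "\<lambda>b a. b \<otimes>\<^bsub>B\<^esub> \<phi> a" M E et
  by (intro tensor_product.intro tensor_data tensor_product_axioms.intro)
     (simp_all add: same_group_def ext_scalars_def ext_tens_def Let_def fun_eq_iff)

lemma smult_E: "(\<odot>\<^bsub>E\<^esub>) b = tensor_lift TT (\<lambda>b' m. et (b \<otimes>\<^bsub>B\<^esub> b') m)"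
  by (simp add: ext_scalars_def Let_def)

lemma smult_balanced: "b \<in> carrier B \<Longrightarrow> balanced A B (\<lambda>b a. b \<otimes>\<^bsub>B\<^esub> \<phi> a) M E (\<lambda>b' m. et (b \<otimes>\<^bsub>B\<^esub> b') m)"
  by (intro balancedI additive_mapI)
     (simp_all add: tens_closed tens_add_left tens_add_right BR.r_distr tens_swap \<phi>_closed flip: BR.m_assoc)

lemma smult_additive: "b \<in> carrier B \<Longrightarrow> additive_map E E ((\<odot>\<^bsub>E\<^esub>) b)"
  and smult_et: "b \<in> carrier B \<Longrightarrow> b' \<in> carrier B \<Longrightarrow> m \<in> carrier M \<Longrightarrow> b \<odot>\<^bsub>E\<^esub> et b' m = et (b \<otimes>\<^bsub>B\<^esub> b') m"
  unfolding smult_E by (rule lift_TT(1)[OF smult_balanced], assumption, rule lift_TT(2)[OF smult_balanced])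

lemma lmodule_E: "lmodule B E"
  unfolding lmodule_def
proof (intro conjI ballI B abelian_T)
  fix b X assume b: "b \<in> carrier B" and X: "X \<in> carrier E"
  show "b \<odot>\<^bsub>E\<^esub> X \<in> carrier E" by (rule additive_map_closed[OF smult_additive[OF b] X])
  show "b \<odot>\<^bsub>E\<^esub> (X \<oplus>\<^bsub>E\<^esub> Y) = b \<odot>\<^bsub>E\<^esub> X \<oplus>\<^bsub>E\<^esub> b \<odot>\<^bsub>E\<^esub> Y" if "Y \<in> carrier E" for Y
    by (rule additive_map_add[OF smult_additive[OF b] X that])
  fix b' assume b': "b' \<in> carrier B"
  show "(b \<oplus>\<^bsub>B\<^esub> b') \<odot>\<^bsub>E\<^esub> X = b \<odot>\<^bsub>E\<^esub> X \<oplus>\<^bsub>E\<^esub> b' \<odot>\<^bsub>E\<^esub> X"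
    by (rule T_ext[OF smult_additive additive_map_plus[OF abelian_T smult_additive smult_additive] _ X])
       (use b b' in \<open>simp_all add: smult_et BR.l_distr tens_add_left\<close>)
  show "(b \<otimes>\<^bsub>B\<^esub> b') \<odot>\<^bsub>E\<^esub> X = b \<odot>\<^bsub>E\<^esub> (b' \<odot>\<^bsub>E\<^esub> X)"
    by (rule T_ext[OF smult_additive additive_map_comp[OF smult_additive smult_additive] _ X])
       (use b b' in \<open>simp_all add: smult_et BR.m_assoc\<close>)
next
  fix X assume X: "X \<in> carrier E"
  show "\<one>\<^bsub>B\<^esub> \<odot>\<^bsub>E\<^esub> X = X"
    by (rule T_ext[OF smult_additive additive_map_id(2) _ X]) (simp_all add: smult_et)
qed

lemma unit_map_closed: "m \<in> carrier M \<Longrightarrow> unit_map m \<in> carrier E"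
  by (simp add: ext_nat_def tens_closed)

lemma et_eq_smult_unit_map: "b \<in> carrier B \<Longrightarrow> m \<in> carrier M \<Longrightarrow> et b m = b \<odot>\<^bsub>E\<^esub> unit_map m"
  by (simp add: ext_nat_def smult_et)

lemma unit_map_semilinear: "semilinear \<phi> A M E unit_map"
  unfolding semilinear_def ext_nat_def
proof (intro conjI ballI additive_mapI)
  fix a m assume *: "a \<in> carrier A" "m \<in> carrier M"
  show "et \<one>\<^bsub>B\<^esub> (a \<odot>\<^bsub>M\<^esub> m) = \<phi> a \<odot>\<^bsub>E\<^esub> et \<one>\<^bsub>B\<^esub> m"
    using * by (simp add: smult_et \<phi>_closed flip: tens_swap)
qed (simp_all add: tens_closed tens_add_right)

lemma unit_map_semilinear_comp:
  assumes i: "semilinear \<psi> C L M i" and \<psi>: "\<And>c. c \<in> carrier C \<Longrightarrow> \<psi> c \<in> carrier A"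
  shows "semilinear (\<lambda>c. \<phi> (\<psi> c)) C L E (unit_map \<circ> i)"
  using i unit_map_semilinear \<psi> by (auto simp: semilinear_def additive_map_def Pi_def)

text \<open>If \<open>k\<close> is a coordinate function of \<open>M\<close>, then b \<otimes> m
  \<mapsto> b \<phi>(k m) is one of the extension; it is balanced because \<open>k\<close> is
  \<open>A\<close>-linear and \<phi> multiplicative.\<close>

lemma ext_free2:
  assumes F: "free2 A M x y"
  shows "free2 B E (unit_map x) (unit_map y)"
proof -
  note xy = free2D(2,3)[OF F]
  note nxy = unit_map_closed[OF xy(1)] unit_map_closed[OF xy(2)]
  obtain c d where c: "additive_map M A c" "additive_map M A d"
    "\<And>r m. r \<in> carrier A \<Longrightarrow> m \<in> carrier M \<Longrightarrow> c (r \<odot>\<^bsub>M\<^esub> m) = r \<otimes>\<^bsub>A\<^esub> c m"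
    "\<And>r m. r \<in> carrier A \<Longrightarrow> m \<in> carrier M \<Longrightarrow> d (r \<odot>\<^bsub>M\<^esub> m) = r \<otimes>\<^bsub>A\<^esub> d m"
    "\<And>m. m \<in> carrier M \<Longrightarrow> m = comb2 M x y (c m) (d m)"
    "c x = \<one>\<^bsub>A\<^esub>" "d x = \<zero>\<^bsub>A\<^esub>" "c y = \<zero>\<^bsub>A\<^esub>" "d y = \<one>\<^bsub>A\<^esub>"
    by (rule free2_coordinates[OF F]) (rule that)
  note cc = additive_map_closed[OF c(1)] additive_map_closed[OF c(2)]
  let ?K = "\<lambda>k. tensor_lift B (\<lambda>b m. b \<otimes>\<^bsub>B\<^esub> \<phi> (k m))"
  have bal: "balanced A B (\<lambda>b a. b \<otimes>\<^bsub>B\<^esub> \<phi> a) M B (\<lambda>b m. b \<otimes>\<^bsub>B\<^esub> \<phi> (k m))"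
    if k: "additive_map M A k" "\<And>r m. r \<in> carrier A \<Longrightarrow> m \<in> carrier M \<Longrightarrow> k (r \<odot>\<^bsub>M\<^esub> m) = r \<otimes>\<^bsub>A\<^esub> k m" for k
    by (intro balancedI additive_mapI)
       (simp_all add: additive_map_closed[OF k(1)] additive_map_add[OF k(1)] k(2) \<phi>_closed ring_hom_add[OF \<phi>]
         ring_hom_mult[OF \<phi>] BR.l_distr BR.r_distr BR.m_assoc)
  note ag = BR.is_abelian_group
  have z: "\<phi> \<zero>\<^bsub>A\<^esub> = \<zero>\<^bsub>B\<^esub>"
    using additive_map_zero[OF AR.is_abelian_group ag, of \<phi>] \<phi> by (auto simp: additive_map_def ring_hom_def)
  show ?thesis
  proof (rule free2I[OF lmodule_E nxy _ lift_additive[OF ag bal[OF c(1,3)]] lift_additive[OF ag bal[OF c(2,4)]]])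
    show "\<exists>r\<in>carrier B. \<exists>s\<in>carrier B. X = comb2 E (unit_map x) (unit_map y) r s" if "X \<in> carrier E" for X
      using that
    proof (induction rule: T_induct)
      case (pure b m)
      have "et b m = et b (c m \<odot>\<^bsub>M\<^esub> x) \<oplus>\<^bsub>E\<^esub> et b (d m \<odot>\<^bsub>M\<^esub> y)"
        by (subst c(5)[OF pure(2)], unfold comb2_def, rule tens_add_right) (use pure cc xy lmoduleD(3)[OF M] in auto)
      also have "\<dots> = comb2 E (unit_map x) (unit_map y) (b \<otimes>\<^bsub>B\<^esub> \<phi> (c m)) (b \<otimes>\<^bsub>B\<^esub> \<phi> (d m))"
        using pure cc xy by (simp add: comb2_def \<phi>_closed flip: tens_swap et_eq_smult_unit_map)
      finally show ?case using pure cc \<phi>_closed by blast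
    next
      case (add X Y)
      then show ?case using comb2_add[OF lmodule_E nxy] by (metis BR.a_closed)
    qed
  qed (use xy in \<open>simp_all add: c z ring_hom_one[OF \<phi>] lift_tens[OF ag bal[OF c(1,3)]] lift_tens[OF ag bal[OF c(2,4)]]
         flip: et_eq_smult_unit_map\<close>)
qed

end

lemma ext_map_hom:
  assumes B: "ring B" and \<phi>: "\<phi> \<in> ring_hom A B" and M: "lmodule A M" and N: "lmodule A N" and g: "g \<in> lmod_hom A M N"
  shows "ext_map B \<phi> A N g \<in> lmod_hom B (ext_scalars B \<phi> A M) (ext_scalars B \<phi> A N)"
    and "m \<in> carrier M \<Longrightarrow> ext_map B \<phi> A N g (ext_nat B \<phi> A M m) = ext_nat B \<phi> A N (g m)"
proof -
  interpret EM: scalar_extension A B \<phi> M by (rule scalar_extension.intro[OF B \<phi> M])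
  interpret EN: scalar_extension A B \<phi> N by (rule scalar_extension.intro[OF B \<phi> N])
  note gc = lmod_hom_closed[OF g]
  have bal: "balanced A B (\<lambda>b a. b \<otimes>\<^bsub>B\<^esub> \<phi> a) M EN.E (\<lambda>b m. EN.et b (g m))"
    using g by (intro balancedI additive_mapI)
      (auto simp: EN.tens_closed gc EN.tens_add_left EN.tens_add_right EN.tens_swap lmod_hom_def)
  note ad = EM.lift_additive[OF EN.abelian_T bal] and pu = EM.lift_tens[OF EN.abelian_T bal]
  show "ext_map B \<phi> A N g (EM.unit_map m) = EN.unit_map (g m)" if "m \<in> carrier M" for m
    using that by (simp add: ext_map_def ext_nat_def pu)
  have "tensor_lift EN.E (\<lambda>b m. EN.et b (g m)) (b \<odot>\<^bsub>EM.E\<^esub> X) = b \<odot>\<^bsub>EN.E\<^esub> tensor_lift EN.E (\<lambda>b m. EN.et b (g m)) X"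
    if b: "b \<in> carrier B" and X: "X \<in> carrier EM.E" for b X
    by (rule EM.T_ext[OF additive_map_comp[OF EM.smult_additive[OF b] ad] additive_map_comp[OF ad EN.smult_additive[OF b]] _ X])
       (use b in \<open>simp add: EM.smult_et EN.smult_et pu gc\<close>)
  then show "ext_map B \<phi> A N g \<in> lmod_hom B EM.E EN.E"
    using ad unfolding ext_map_def lmod_hom_def additive_map_def by auto
qed


section \<open>The module \<open>H \<otimes> M\<close>\<close>

locale outer_tensor_data =
  fixes H :: "(complex, 'h, 'x) module_scheme" and A :: "(complex, 'a, 'y) module_scheme"
    and M :: "('a, 'm, 'z) module_scheme"
  assumes H_alg: "unital_algebra H" and A_alg: "unital_algebra A" and M: "lmodule A M"
begin

sublocale HA: algebra_pair H A by (rule algebra_pair.intro[OF H_alg A_alg])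
sublocale MG: abelian_group M by (rule lmoduleD(2)[OF M])

abbreviation "UM \<equiv> underlying_space A M"
abbreviation "HM \<equiv> outer_tensor H A M"
abbreviation "ot \<equiv> outer_tens H A M"

lemma UM_simps: "carrier UM = carrier M" "add UM = add M" "\<zero>\<^bsub>UM\<^esub> = \<zero>\<^bsub>M\<^esub>"
  "c \<odot>\<^bsub>UM\<^esub> m = (c \<odot>\<^bsub>A\<^esub> \<one>\<^bsub>A\<^esub>) \<odot>\<^bsub>M\<^esub> m"
  by (simp_all add: underlying_space_def)

lemma scalar_closed: "c \<odot>\<^bsub>A\<^esub> \<one>\<^bsub>A\<^esub> \<in> carrier A"
  by (rule cmodule_simps(1)[OF HA.W HA.WR.one_closed])

lemma UM_cmodule: "cmodule UM"
proof (rule cmoduleI)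
  have "same_group UM M" by (simp add: same_group_def UM_simps)
  then show "abelian_group UM" by (rule same_group_abelian[OF _ MG.abelian_group_axioms])
  fix c d m assume m: "m \<in> carrier UM"
  have "(c * d) \<odot>\<^bsub>A\<^esub> \<one>\<^bsub>A\<^esub> = (c \<odot>\<^bsub>A\<^esub> \<one>\<^bsub>A\<^esub>) \<otimes>\<^bsub>A\<^esub> (d \<odot>\<^bsub>A\<^esub> \<one>\<^bsub>A\<^esub>)"
    using scalar_closed by (simp add: unital_algebraD(3)[OF A_alg] cmodule_simps(4)[OF HA.W])
  then show "(c * d) \<odot>\<^bsub>UM\<^esub> m = c \<odot>\<^bsub>UM\<^esub> (d \<odot>\<^bsub>UM\<^esub> m)"
    using m scalar_closed by (simp add: UM_simps lmoduleD(6)[OF M])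
qed (use scalar_closed in \<open>simp_all add: UM_simps lmoduleD[OF M] cmodule_simps(2,5)[OF HA.W]\<close>)

sublocale P: cmodule_pair H UM by (rule cmodule_pairI[OF HA.V UM_cmodule])

lemma HM_simps: "carrier HM = carrier P.T" "add HM = add P.T" "\<zero>\<^bsub>HM\<^esub> = \<zero>\<^bsub>P.T\<^esub>"
  by (simp_all add: outer_tensor_def Let_def)

lemma HM_same_group: "same_group HM P.T"
  by (simp add: same_group_def HM_simps)

lemma ot_eq: "ot = P.tens" by (simp add: outer_tens_def)

text \<open>The complex structure of \<open>M\<close> comes from the elements c 1 of
  \<open>A\<close>. That they are central makes the action of each element of \<open>A\<close> on
  \<open>M\<close> complex linear.\<close>

lemma smult_comm: "c \<odot>\<^bsub>A\<^esub> a = (c \<odot>\<^bsub>A\<^esub> \<one>\<^bsub>A\<^esub>) \<otimes>\<^bsub>A\<^esub> a" "c \<odot>\<^bsub>A\<^esub> a = a \<otimes>\<^bsub>A\<^esub> (c \<odot>\<^bsub>A\<^esub> \<one>\<^bsub>A\<^esub>)"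
  if "a \<in> carrier A"
  using that by (simp_all add: unital_algebraD(3,4)[OF A_alg])

lemma smult_bilinear: "cbilinear A UM UM (\<odot>\<^bsub>M\<^esub>)"
proof (intro cbilinearI clinearI additive_mapI)
  fix a m c assume *: "a \<in> carrier A" "m \<in> carrier UM"
  show "(c \<odot>\<^bsub>A\<^esub> a) \<odot>\<^bsub>M\<^esub> m = c \<odot>\<^bsub>UM\<^esub> (a \<odot>\<^bsub>M\<^esub> m)" "a \<odot>\<^bsub>M\<^esub> (c \<odot>\<^bsub>UM\<^esub> m) = c \<odot>\<^bsub>UM\<^esub> (a \<odot>\<^bsub>M\<^esub> m)"
    using * scalar_closed smult_comm[OF *(1), of c] by (simp_all add: UM_simps flip: lmoduleD(6)[OF M])
qed (simp_all add: UM_simps lmoduleD[OF M])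

sublocale act: tensor_action H A H UM P.T "(\<otimes>\<^bsub>H\<^esub>)" "(\<odot>\<^bsub>M\<^esub>)"
  by unfold_locales (simp_all add: same_group_def HA.mult_bilinear(1) smult_bilinear)

lemma smult_HM: "(\<odot>\<^bsub>HM\<^esub>) = act.act"
  by (simp add: outer_tensor_def Let_def act.act_def act.inner_def outer_tens_def fun_eq_iff)

lemma smult_additive_left: "X \<in> carrier HM \<Longrightarrow> additive_map HA.T HM (\<lambda>t. t \<odot>\<^bsub>HM\<^esub> X)"
  and smult_additive_right: "t \<in> carrier HA.T \<Longrightarrow> additive_map HM HM ((\<odot>\<^bsub>HM\<^esub>) t)"
  unfolding smult_HM same_group_additive_map[OF HM_same_group] HM_simps
  by (fact act.act_additive_left act.act_additive_right)+

lemma ot_closed: "h \<in> carrier H \<Longrightarrow> m \<in> carrier M \<Longrightarrow> ot h m \<in> carrier HM"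
  using P.tens_closed[of h m] by (simp add: ot_eq HM_simps UM_simps)

lemma smult_ot: "h \<in> carrier H \<Longrightarrow> a \<in> carrier A \<Longrightarrow> h' \<in> carrier H \<Longrightarrow> m \<in> carrier M \<Longrightarrow>
    HA.tens h a \<odot>\<^bsub>HM\<^esub> ot h' m = ot (h \<otimes>\<^bsub>H\<^esub> h') (a \<odot>\<^bsub>M\<^esub> m)"
  unfolding smult_HM ot_eq by (rule act.act_tens) (simp_all add: UM_simps)

lemma abelian_HM: "abelian_group HM"
  by (rule same_group_abelian[OF HM_same_group P.abelian_T])

lemma ot_add_right: "h \<in> carrier H \<Longrightarrow> m \<in> carrier M \<Longrightarrow> m' \<in> carrier M \<Longrightarrow>
    ot h (m \<oplus>\<^bsub>M\<^esub> m') = ot h m \<oplus>\<^bsub>HM\<^esub> ot h m'"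
  using P.tens_add_right by (auto simp: ot_eq HM_simps UM_simps)

lemma HM_induct [consumes 1, case_names pure add]:
  assumes "X \<in> carrier HM"
    and "\<And>h m. h \<in> carrier H \<Longrightarrow> m \<in> carrier M \<Longrightarrow> P (ot h m)"
    and "\<And>X Y. X \<in> carrier HM \<Longrightarrow> Y \<in> carrier HM \<Longrightarrow> P X \<Longrightarrow> P Y \<Longrightarrow> P (X \<oplus>\<^bsub>HM\<^esub> Y)"
  shows "P X"
  using P.T_induct[of X P] assms unfolding HM_simps ot_eq UM_simps by blast

lemma HM_ext:
  assumes "additive_map HM G f" "additive_map HM G g"
    and "\<And>h m. h \<in> carrier H \<Longrightarrow> m \<in> carrier M \<Longrightarrow> f (ot h m) = g (ot h m)"
    and "X \<in> carrier HM"
  shows "f X = g X"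
  using assms(4) by (induction rule: HM_induct) (auto simp: assms additive_map_add[OF assms(1)] additive_map_add[OF assms(2)])

lemma lmodule_HM: "lmodule HA.T HM"
  unfolding lmodule_def
proof (intro conjI ballI abelian_HM unital_algebraD(2)[OF HA.unital_algebra_T])
  fix t X assume t: "t \<in> carrier HA.T" and X: "X \<in> carrier HM"
  note cl = additive_map_closed[OF smult_additive_right]
  show "t \<odot>\<^bsub>HM\<^esub> X \<in> carrier HM" by (rule cl[OF t X])
  show "t \<odot>\<^bsub>HM\<^esub> (X \<oplus>\<^bsub>HM\<^esub> Y) = t \<odot>\<^bsub>HM\<^esub> X \<oplus>\<^bsub>HM\<^esub> t \<odot>\<^bsub>HM\<^esub> Y" if "Y \<in> carrier HM" for Y
    by (rule additive_map_add[OF smult_additive_right[OF t] X that])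
  fix s assume s: "s \<in> carrier HA.T"
  show "(t \<oplus>\<^bsub>HA.T\<^esub> s) \<odot>\<^bsub>HM\<^esub> X = t \<odot>\<^bsub>HM\<^esub> X \<oplus>\<^bsub>HM\<^esub> s \<odot>\<^bsub>HM\<^esub> X"
    by (rule additive_map_add[OF smult_additive_left[OF X] t s])
  show "(t \<otimes>\<^bsub>HA.T\<^esub> s) \<odot>\<^bsub>HM\<^esub> X = t \<odot>\<^bsub>HM\<^esub> (s \<odot>\<^bsub>HM\<^esub> X)"
  proof (rule HA.T_ext[OF additive_map_comp[OF HA.mult_additive_left[OF s] smult_additive_left[OF X]]
        smult_additive_left[OF cl[OF s X]] _ t])
    fix h a assume ha: "h \<in> carrier H" "a \<in> carrier A"
    note th = HA.tens_closed[OF ha]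
    show "(HA.tens h a \<otimes>\<^bsub>HA.T\<^esub> s) \<odot>\<^bsub>HM\<^esub> X = HA.tens h a \<odot>\<^bsub>HM\<^esub> (s \<odot>\<^bsub>HM\<^esub> X)"
    proof (rule HA.T_ext[OF additive_map_comp[OF HA.mult_additive_right[OF th] smult_additive_left[OF X]]
          additive_map_comp[OF smult_additive_left[OF X] smult_additive_right[OF th]] _ s])
      fix h' a' assume ha': "h' \<in> carrier H" "a' \<in> carrier A"
      note th' = HA.tens_closed[OF ha']
      show "(HA.tens h a \<otimes>\<^bsub>HA.T\<^esub> HA.tens h' a') \<odot>\<^bsub>HM\<^esub> X = HA.tens h a \<odot>\<^bsub>HM\<^esub> (HA.tens h' a' \<odot>\<^bsub>HM\<^esub> X)"
        by (rule HM_ext[OF smult_additive_right[OF HA.mult_closed[OF th th']]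
              additive_map_comp[OF smult_additive_right[OF th'] smult_additive_right[OF th]] _ X])
           (use ha ha' in \<open>simp add: HA.mult_tens smult_ot HA.VR.m_assoc lmoduleD(3,6)[OF M]\<close>)
    qed
  qed
next
  fix X assume X: "X \<in> carrier HM"
  have o: "\<one>\<^bsub>HA.T\<^esub> \<in> carrier HA.T" by (simp add: HA.one_T HA.tens_closed)
  show "\<one>\<^bsub>HA.T\<^esub> \<odot>\<^bsub>HM\<^esub> X = X"
    by (rule HM_ext[OF smult_additive_right[OF o] additive_map_id(2) _ X]) (simp add: HA.one_T smult_ot lmoduleD(7)[OF M])
qed

abbreviation "unit_map \<equiv> ot \<one>\<^bsub>H\<^esub>"

lemma unit_map_closed: "m \<in> carrier M \<Longrightarrow> unit_map m \<in> carrier HM"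
  by (simp add: ot_closed)

lemma unit_map_semilinear: "semilinear (HA.tens \<one>\<^bsub>H\<^esub>) A M HM unit_map"
  unfolding semilinear_def
  by (intro conjI ballI additive_mapI) (simp_all add: ot_closed ot_add_right smult_ot lmoduleD(3)[OF M])

text \<open>Proved directly in H \<otimes> M, without passing through its identification with an
  extension of scalars: a coordinate function \<open>k\<close> of \<open>M\<close> yields the
  coordinate function h \<otimes> m \<mapsto> h \<otimes> k m.\<close>

lemma outer_free2:
  assumes F: "free2 A M x y"
  shows "free2 HA.T HM (unit_map x) (unit_map y)"
proof -
  interpret T: ring HA.T by (rule unital_algebraD(2)[OF HA.unital_algebra_T])
  note xy = free2D(2,3)[OF F]
  note nxy = unit_map_closed[OF xy(1)] unit_map_closed[OF xy(2)]
  obtain c d where c: "additive_map M A c" "additive_map M A d"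
    "\<And>r m. r \<in> carrier A \<Longrightarrow> m \<in> carrier M \<Longrightarrow> c (r \<odot>\<^bsub>M\<^esub> m) = r \<otimes>\<^bsub>A\<^esub> c m"
    "\<And>r m. r \<in> carrier A \<Longrightarrow> m \<in> carrier M \<Longrightarrow> d (r \<odot>\<^bsub>M\<^esub> m) = r \<otimes>\<^bsub>A\<^esub> d m"
    "\<And>m. m \<in> carrier M \<Longrightarrow> m = comb2 M x y (c m) (d m)"
    "c x = \<one>\<^bsub>A\<^esub>" "d x = \<zero>\<^bsub>A\<^esub>" "c y = \<zero>\<^bsub>A\<^esub>" "d y = \<one>\<^bsub>A\<^esub>"
    by (rule free2_coordinates[OF F]) (rule that)
  note cc = additive_map_closed[OF c(1)] additive_map_closed[OF c(2)]
  let ?K = "\<lambda>k. tensor_lift HA.T (\<lambda>h m. HA.tens h (k m))"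
  have K: "additive_map HM HA.T (?K k)"
    "t \<in> carrier HA.T \<Longrightarrow> m \<in> carrier M \<Longrightarrow> ?K k (t \<odot>\<^bsub>HM\<^esub> unit_map m) = t \<otimes>\<^bsub>HA.T\<^esub> HA.tens \<one>\<^bsub>H\<^esub> (k m)"
    if k: "additive_map M A k" "\<And>r m. r \<in> carrier A \<Longrightarrow> m \<in> carrier M \<Longrightarrow> k (r \<odot>\<^bsub>M\<^esub> m) = r \<otimes>\<^bsub>A\<^esub> k m" for k t m
  proof -
    note kc = additive_map_closed[OF k(1)]
    have bal: "cbalanced H UM HA.T (\<lambda>h m. HA.tens h (k m))"
      by (intro balancedI additive_mapI)
         (simp_all add: UM_simps kc additive_map_add[OF k(1)] k(2) HA.tens_closed HA.tens_add_left HA.tens_add_right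
           HA.tens_smult_swap scalar_closed flip: smult_comm(1))
    show ad: "additive_map HM HA.T (?K k)"
      unfolding same_group_additive_map(1)[OF HM_same_group] by (rule P.lift_additive[OF HA.abelian_T bal])
    have pure: "?K k (ot h m) = HA.tens h (k m)" if "h \<in> carrier H" "m \<in> carrier M" for h m
      unfolding ot_eq by (rule P.lift_tens[OF HA.abelian_T bal]) (simp_all add: that UM_simps)
    show "?K k (t \<odot>\<^bsub>HM\<^esub> unit_map m) = t \<otimes>\<^bsub>HA.T\<^esub> HA.tens \<one>\<^bsub>H\<^esub> (k m)" if t: "t \<in> carrier HA.T" and m: "m \<in> carrier M"
      by (rule HA.T_ext[OF additive_map_comp[OF smult_additive_left[OF unit_map_closed[OF m]] ad]
            HA.mult_additive_left[OF HA.tens_closed[OF HA.VR.one_closed kc[OF m]]] _ t])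
         (use m in \<open>simp add: smult_ot pure k(2) HA.mult_tens kc lmoduleD(3)[OF M]\<close>)
  qed
  have z: "HA.tens \<one>\<^bsub>H\<^esub> \<zero>\<^bsub>A\<^esub> = \<zero>\<^bsub>HA.T\<^esub>"
    by (rule additive_map_zero[OF HA.WR.is_abelian_group HA.abelian_T])
       (auto intro!: additive_mapI simp: HA.tens_closed HA.tens_add_right)
  show ?thesis
  proof (rule free2I[OF lmodule_HM nxy _ K(1)[OF c(1,3)] K(1)[OF c(2,4)]])
    show "\<exists>r\<in>carrier HA.T. \<exists>s\<in>carrier HA.T. X = comb2 HM (unit_map x) (unit_map y) r s" if "X \<in> carrier HM" for X
      using that
    proof (induction rule: HM_induct)
      case (pure h m)
      have "ot h m = ot h (c m \<odot>\<^bsub>M\<^esub> x) \<oplus>\<^bsub>HM\<^esub> ot h (d m \<odot>\<^bsub>M\<^esub> y)"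
        by (subst c(5)[OF pure(2)], unfold comb2_def, rule ot_add_right) (use pure cc xy lmoduleD(3)[OF M] in auto)
      also have "\<dots> = comb2 HM (unit_map x) (unit_map y) (HA.tens h (c m)) (HA.tens h (d m))"
        using pure cc xy by (simp add: comb2_def smult_ot)
      finally show ?case using pure cc HA.tens_closed by blast
    next
      case (add X Y)
      then show ?case using comb2_add[OF lmodule_HM nxy] by (metis T.a_closed)
    qed
  qed (use xy in \<open>simp_all add: K(2)[OF c(1,3)] K(2)[OF c(2,4)] c z flip: HA.one_T\<close>)
qed

end

section \<open>The morphism attached to a two-dimensional comodule\<close>

text \<open>Maps of left modules act on coordinate rows by matrices from the right, so the entries
  of the map applied first stand on the left in the products.\<close>

lemma comb2_comb2:
  assumes M: "lmodule R M" and xy: "x \<in> carrier M" "y \<in> carrier M"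
    and c: "r \<in> carrier R" "s \<in> carrier R" "r' \<in> carrier R" "s' \<in> carrier R" "t \<in> carrier R" "u \<in> carrier R"
  shows "comb2 M (comb2 M x y r s) (comb2 M x y r' s') t u =
    comb2 M x y (t \<otimes>\<^bsub>R\<^esub> r \<oplus>\<^bsub>R\<^esub> u \<otimes>\<^bsub>R\<^esub> r') (t \<otimes>\<^bsub>R\<^esub> s \<oplus>\<^bsub>R\<^esub> u \<otimes>\<^bsub>R\<^esub> s')"
proof -
  interpret R: ring R by (rule lmoduleD(1)[OF M])
  show ?thesis
    using c unfolding comb2_def[of M "comb2 M x y r s"]
    by (simp add: comb2_smult[OF M xy] comb2_add[OF M xy])
qed

text \<open>In the type \<open>2\<close> the numeral 2 equals 0, so the indices of the theorem are
  those of \<open>exhaust_2\<close> under another name.\<close>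

lemma exhaust_01: "(p::2) = 0 \<or> p = 1"
proof -
  have "(2::2) = 0" by simp
  then show ?thesis using exhaust_2[of p] by auto
qed

lemma all_01: "(\<forall>p::2. P p) \<longleftrightarrow> P 0 \<and> P 1"
  using exhaust_01 by metis

lemma ring_hom_id: "id \<in> ring_hom R R"
  by (auto simp: ring_hom_def)

section \<open>Contractions of a tensor square with a counit\<close>

text \<open>Separated from bialgebras because it is needed twice: for \<open>H\<close> with its
  counit, and for the algebra \<open>K\<close> below before that is known to be a coalgebra.\<close>

locale augmented_algebra =
  fixes A :: "(complex, 'a, 'x) module_scheme" and \<epsilon> :: "'a \<Rightarrow> complex"
  assumes A_alg: "unital_algebra A" and \<epsilon>_hom: "\<epsilon> \<in> ring_hom A complex_alg" and \<epsilon>_clinear: "clinear A complex_alg \<epsilon>"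
begin

sublocale HA: algebra_pair A A by (rule algebra_pair.intro[OF A_alg A_alg])

text \<open>The map \<epsilon> \<otimes> id of the counit condition. Its mirror image id \<otimes>
  \<epsilon>, defined next, is the one that turns surjectivity of \<Theta> into a statement about
  matrices over \<open>H\<close>.\<close>

definition "E_map = tensor_lift A (\<lambda>h a. \<epsilon> h \<odot>\<^bsub>A\<^esub> a)"
definition "E'_map = tensor_lift A (\<lambda>h a. \<epsilon> a \<odot>\<^bsub>A\<^esub> h)"

lemma counit_one: "\<epsilon> \<one>\<^bsub>A\<^esub> = 1"
  using ring_hom_one[OF \<epsilon>_hom] by simp

lemma counit_add: "x \<in> carrier A \<Longrightarrow> y \<in> carrier A \<Longrightarrow> \<epsilon> (x \<oplus>\<^bsub>A\<^esub> y) = \<epsilon> x + \<epsilon> y"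
  and counit_mult: "x \<in> carrier A \<Longrightarrow> y \<in> carrier A \<Longrightarrow> \<epsilon> (x \<otimes>\<^bsub>A\<^esub> y) = \<epsilon> x * \<epsilon> y"
  and counit_smult: "x \<in> carrier A \<Longrightarrow> \<epsilon> (c \<odot>\<^bsub>A\<^esub> x) = c * \<epsilon> x"
  using ring_hom_add[OF \<epsilon>_hom] ring_hom_mult[OF \<epsilon>_hom] clinear_smult[OF \<epsilon>_clinear] by auto

lemma smult_A: "x \<in> carrier A \<Longrightarrow> c \<odot>\<^bsub>A\<^esub> x \<in> carrier A"
  by (rule cmodule_simps(1)[OF HA.V])

lemma E_map_bilinear: "cbilinear A A A (\<lambda>h a. \<epsilon> h \<odot>\<^bsub>A\<^esub> a)"
  by (intro cbilinearI clinearI additive_mapI)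
     (simp_all add: smult_A counit_add counit_smult cmodule_simps(2,3)[OF HA.V] mult.commute flip: cmodule_simps(4)[OF HA.V])

lemma E'_map_bilinear: "cbilinear A A A (\<lambda>h a. \<epsilon> a \<odot>\<^bsub>A\<^esub> h)"
  by (intro cbilinearI clinearI additive_mapI)
     (simp_all add: smult_A counit_add counit_smult cmodule_simps(2,3)[OF HA.V] mult.commute flip: cmodule_simps(4)[OF HA.V])

lemma E_map_tens: "h \<in> carrier A \<Longrightarrow> a \<in> carrier A \<Longrightarrow> E_map (ctens A A h a) = \<epsilon> h \<odot>\<^bsub>A\<^esub> a"
  unfolding E_map_def by (rule HA.lift_tens[OF HA.td.B.abelian_group_axioms cbilinear_balanced[OF E_map_bilinear]])

lemma E'_map_tens: "h \<in> carrier A \<Longrightarrow> a \<in> carrier A \<Longrightarrow> E'_map (ctens A A h a) = \<epsilon> a \<odot>\<^bsub>A\<^esub> h"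
  unfolding E'_map_def by (rule HA.lift_tens[OF HA.td.B.abelian_group_axioms cbilinear_balanced[OF E'_map_bilinear]])

lemma E_map_hom: "E_map \<in> ring_hom HA.T A"
  unfolding E_map_def
  by (rule HA.lift_ring_hom[OF HA.VR.ring_axioms cbilinear_balanced[OF E_map_bilinear]])
     (simp_all add: counit_mult counit_one cmodule_simps(5)[OF HA.V] smult_A unital_algebraD(3,4)[OF A_alg]
       mult.commute flip: cmodule_simps(4)[OF HA.V])

lemma E'_map_hom: "E'_map \<in> ring_hom HA.T A"
  unfolding E'_map_def
  by (rule HA.lift_ring_hom[OF HA.VR.ring_axioms cbilinear_balanced[OF E'_map_bilinear]])
     (simp_all add: counit_mult counit_one cmodule_simps(5)[OF HA.V] smult_A unital_algebraD(3,4)[OF A_alg]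
       mult.commute flip: cmodule_simps(4)[OF HA.V])

lemma E_map_clinear: "clinear HA.T A E_map" and E'_map_clinear: "clinear HA.T A E'_map"
  unfolding E_map_def E'_map_def
  by (rule HA.lift_clinear[OF HA.V E_map_bilinear], rule HA.lift_clinear[OF HA.V E'_map_bilinear])

lemma E_one: "a \<in> carrier A \<Longrightarrow> E_map (ctens A A \<one>\<^bsub>A\<^esub> a) = a"
  by (simp add: E_map_tens counit_one cmodule_simps(5)[OF HA.V])

end

section \<open>Bialgebras and the algebra maps of the two conditions\<close>

locale bialgebra_data =
  fixes H :: "('h, 'x) coalg_scheme"
  assumes bialg: "bialgebra H"
begin

lemma H_alg: "unital_algebra H" and H_coalg: "coalgebra H"
  and comult_hom: "comult H \<in> ring_hom H (ctensor H H)"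
  and counit_hom: "counit H \<in> ring_hom H complex_alg"
  using bialg by (auto simp: bialgebra_def)

lemma comult_clinear: "clinear H (ctensor H H) (comult H)"
  and counit_clinear: "clinear H complex_alg (counit H)"
  and coassoc: "h \<in> carrier H \<Longrightarrow> ctensor_assoc H H H (ctensor_map (ctensor H H) H (comult H) id (comult H h)) =
         ctensor_map H (ctensor H H) id (comult H) (comult H h)"
  and counit_left: "h \<in> carrier H \<Longrightarrow> tensor_lift H (\<lambda>x y. counit H x \<odot>\<^bsub>H\<^esub> y) (comult H h) = h"
  using H_coalg by (auto simp: coalgebra_def)

sublocale augmented_algebra H "counit H"
  by (rule augmented_algebra.intro[OF H_alg counit_hom counit_clinear])

abbreviation "HA \<equiv> ctensor H H"
abbreviation "B \<equiv> ctensor H HA"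

lemma HA_alg: "unital_algebra HA" by (rule HA.unital_algebra_T)

sublocale B: algebra_pair H HA by (rule algebra_pair.intro[OF H_alg HA_alg])

lemma B_alg: "unital_algebra B" by (rule B.unital_algebra_T)

sublocale BR: ring B by (rule unital_algebraD(2)[OF B_alg])
sublocale tri: cmodule_triple H H H by (rule cmodule_triple.intro[OF HA.V HA.V HA.V])

definition "e_map = ctens H HA \<one>\<^bsub>H\<^esub>"
definition "d_map = ctensor_map H HA id (comult H)"
definition "D_map = ctensor_assoc H H H \<circ> ctensor_map HA H (comult H) id"
lemma e_map_hom: "e_map \<in> ring_hom HA B"
  unfolding e_map_def
  by (rule ring_hom_memI) (simp_all add: B.tens_closed B.tens_add_right B.mult_tens B.one_T)

lemma d_map_hom: "d_map \<in> ring_hom HA B"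
  unfolding d_map_def
  by (rule ctensor_map_ring_hom[OF H_alg H_alg H_alg HA_alg clinear_id(1) comult_clinear ring_hom_id comult_hom])

lemma D_map_hom: "D_map \<in> ring_hom HA B"
  unfolding D_map_def comp_def
  using ring_hom_trans[OF ctensor_map_ring_hom[OF H_alg H_alg HA_alg H_alg comult_clinear clinear_id(1) comult_hom ring_hom_id]
      ctensor_assoc_ring_hom[OF H_alg H_alg H_alg]]
  by (simp add: comp_def)

lemma d_map_tens: "h \<in> carrier H \<Longrightarrow> a \<in> carrier H \<Longrightarrow> d_map (ctens H H h a) = ctens H HA h (comult H a)"
  unfolding d_map_def
  by (subst ctensor_map_tens[OF HA.V HA.V HA.V HA.cmodule_T clinear_id(1) comult_clinear]) simp_all

lemma D_map_tens: "h \<in> carrier H \<Longrightarrow> a \<in> carrier H \<Longrightarrow>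
    D_map (ctens H H h a) = ctensor_assoc H H H (ctens HA H (comult H h) a)"
  unfolding D_map_def comp_def
  by (subst ctensor_map_tens[OF HA.V HA.V HA.cmodule_T HA.V comult_clinear clinear_id(1)]) simp_all

lemma comult_closed: "h \<in> carrier H \<Longrightarrow> comult H h \<in> carrier HA"
  by (rule ring_hom_closed[OF comult_hom])

lemma comult_one: "comult H \<one>\<^bsub>H\<^esub> = ctens H H \<one>\<^bsub>H\<^esub> \<one>\<^bsub>H\<^esub>"
  using ring_hom_one[OF comult_hom] by (simp add: HA.one_T)

text \<open>With \<open>d_comult\<close>, \<open>e_one\<close>, \<open>E_comult\<close> and
  \<open>E_one\<close>, these are the equal composites behind the identifications in the two
  conditions. They enter as the last hypothesis of \<open>canonical_iso\<close>;
  \<open>d_comult\<close> is coassociativity and \<open>E_comult\<close> the counit law.\<close>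

lemma e_comult: "a \<in> carrier H \<Longrightarrow> e_map (comult H a) = d_map (ctens H H \<one>\<^bsub>H\<^esub> a)"
  by (simp add: d_map_tens e_map_def)

lemma d_comult: "a \<in> carrier H \<Longrightarrow> d_map (comult H a) = D_map (comult H a)"
  by (simp add: d_map_def D_map_def coassoc)

lemma e_one: "a \<in> carrier H \<Longrightarrow> e_map (ctens H H \<one>\<^bsub>H\<^esub> a) = D_map (ctens H H \<one>\<^bsub>H\<^esub> a)"
  by (simp add: D_map_tens e_map_def comult_one tri.ctensor_assoc_tens)

lemma E_comult: "a \<in> carrier H \<Longrightarrow> E_map (comult H a) = a"
  unfolding E_map_def by (rule counit_left)

abbreviation "M \<equiv> dsum_module (regular_module H) (regular_module H)"

lemma M_simps: "carrier M = carrier H \<times> carrier H" "(x, y) \<oplus>\<^bsub>M\<^esub> (x', y') = (x \<oplus>\<^bsub>H\<^esub> x', y \<oplus>\<^bsub>H\<^esub> y')"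
  "\<zero>\<^bsub>M\<^esub> = (\<zero>\<^bsub>H\<^esub>, \<zero>\<^bsub>H\<^esub>)" "r \<odot>\<^bsub>M\<^esub> (x, y) = (r \<otimes>\<^bsub>H\<^esub> x, r \<otimes>\<^bsub>H\<^esub> y)"
  by (simp_all add: dsum_module_def regular_module_def)

lemma lmodule_M: "lmodule H M"
  unfolding lmodule_def
proof (intro conjI)
  show "abelian_group M"
    by (rule abelian_groupI)
       (auto simp: M_simps HA.td.B.a_ac intro!: bexI[of _ "\<ominus>\<^bsub>H\<^esub> _"] HA.td.B.l_neg)
qed (auto simp: M_simps HA.VR.l_distr HA.VR.r_distr HA.VR.m_assoc HA.VR.ring_axioms)

definition "basis p = (if p = (0::2) then (\<one>\<^bsub>H\<^esub>, \<zero>\<^bsub>H\<^esub>) else (\<zero>\<^bsub>H\<^esub>, \<one>\<^bsub>H\<^esub>))"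

lemma free_M: "free2 H M (basis 0) (basis 1)"
  unfolding free2_def by (auto simp: lmodule_M M_simps comb2_def basis_def)

lemma comb_M: "k0 \<in> carrier H \<Longrightarrow> k1 \<in> carrier H \<Longrightarrow> comb2 M (basis 0) (basis 1) k0 k1 = (k0, k1)"
  by (auto simp: comb2_def M_simps basis_def)

lemma basis_closed: "basis p \<in> carrier M"
  by (simp add: basis_def M_simps)

sublocale N: scalar_extension H HA "comult H" M
  by (rule scalar_extension.intro[OF B.WR.ring_axioms comult_hom lmodule_M])

sublocale O: outer_tensor_data H H M
  by (rule outer_tensor_data.intro[OF H_alg H_alg lmodule_M])

abbreviation "N \<equiv> ext_scalars HA (comult H) H M"
abbreviation "HM \<equiv> outer_tensor H H M"
abbreviation "j p \<equiv> ext_nat HA (comult H) H M (basis p)"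
abbreviation "i p \<equiv> outer_tens H H M \<one>\<^bsub>H\<^esub> (basis p)"

lemma free_N: "free2 HA N (j 0) (j 1)"
  by (rule N.ext_free2[OF free_M])

lemma free_HM: "free2 HA HM (i 0) (i 1)"
  by (rule O.outer_free2[OF free_M])

lemma j_closed: "j p \<in> carrier N" and i_closed: "i p \<in> carrier HM"
  by (rule N.unit_map_closed[OF basis_closed], rule O.unit_map_closed[OF basis_closed])

end

section \<open>The map \<Theta>, the two conditions, and what surjectivity implies\<close>

text \<open>Any bialgebra with a two by two matrix of coefficients. Existence of \<Theta>, both
  conditions and the left inverse deduced from surjectivity hold at this generality; the freeness of
  \<open>H\<close> is first exploited in \<open>free_hopf_no_left_inverse\<close>.\<close>

locale comodule2 = bialgebra_data H for H :: "('h, 'x) coalg_scheme" +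
  fixes a :: "2 \<Rightarrow> 2 \<Rightarrow> 'h"
  assumes a_closed: "a p q \<in> carrier H"
    and comult_a: "comult H (a p q) = ctens H H (a p 0) (a 0 q) \<oplus>\<^bsub>HA\<^esub> ctens H H (a p 1) (a 1 q)"
    and counit_a: "counit H (a p q) = (if p = q then 1 else 0)"
begin

abbreviation "a1 p q \<equiv> ctens H H (a p q) \<one>\<^bsub>H\<^esub>"

lemma a1_closed: "a1 p q \<in> carrier HA"
  by (simp add: HA.tens_closed a_closed)

text \<open>The image under \<theta> of the basis vector \<open>p\<close>: its coordinates form
  column \<open>p\<close> of a \<otimes> 1. This is why the matrix acting on coordinate rows is the
  transpose of \<open>a\<close>.\<close>

definition "image_vec p = comb2 N (j 0) (j 1) (a1 0 p) (a1 1 p)"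

lemma image_vec_closed: "image_vec p \<in> carrier N"
  unfolding image_vec_def by (rule comb2_closed[OF N.lmodule_E j_closed j_closed a1_closed a1_closed])

lemma zero_tens: "h \<in> carrier H \<Longrightarrow> ctens H H h \<zero>\<^bsub>H\<^esub> = \<zero>\<^bsub>HA\<^esub>"
  by (rule additive_map_zero[OF HA.td.B.abelian_group_axioms HA.abelian_T])
     (auto intro!: additive_mapI simp: HA.tens_closed HA.tens_add_right)

definition "theta k0 k1 = comb2 N (j 0) (j 1)
    (ctens H H (a 0 0) k0 \<oplus>\<^bsub>HA\<^esub> ctens H H (a 0 1) k1) (ctens H H (a 1 0) k0 \<oplus>\<^bsub>HA\<^esub> ctens H H (a 1 1) k1)"

lemma theta_basis: "theta \<one>\<^bsub>H\<^esub> \<zero>\<^bsub>H\<^esub> = image_vec 0" "theta \<zero>\<^bsub>H\<^esub> \<one>\<^bsub>H\<^esub> = image_vec 1"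
  by (simp_all add: theta_def image_vec_def zero_tens a_closed a1_closed)

definition "is_Theta \<Theta> \<longleftrightarrow> \<Theta> \<in> lmod_hom HA HM N \<and> \<Theta> \<in> extensional (carrier HM) \<and>
   (\<forall>k0\<in>carrier H. \<forall>k1\<in>carrier H. \<Theta> (outer_tens H H M \<one>\<^bsub>H\<^esub> (k0, k1)) = theta k0 k1)"

text \<open>Because (1 \<otimes> k)(a \<otimes> 1) = a \<otimes> k, the formula for \<theta> is
  already linear over the elements 1 \<otimes> k, and prescribing \<Theta> on all 1 \<otimes> m
  amounts to prescribing it on two basis vectors. Existence and uniqueness follow from
  freeness.\<close>

lemma is_Theta_iff: "is_Theta \<Theta> \<longleftrightarrow> \<Theta> \<in> lmod_hom HA HM N \<and> \<Theta> \<in> extensional (carrier HM) \<and>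
    \<Theta> (i 0) = image_vec 0 \<and> \<Theta> (i 1) = image_vec 1"
proof
  assume "is_Theta \<Theta>"
  then show "\<Theta> \<in> lmod_hom HA HM N \<and> \<Theta> \<in> extensional (carrier HM) \<and> \<Theta> (i 0) = image_vec 0 \<and> \<Theta> (i 1) = image_vec 1"
    using theta_basis by (simp add: is_Theta_def basis_def)
next
  assume \<Theta>: "\<Theta> \<in> lmod_hom HA HM N \<and> \<Theta> \<in> extensional (carrier HM) \<and> \<Theta> (i 0) = image_vec 0 \<and> \<Theta> (i 1) = image_vec 1"
  have "\<Theta> (outer_tens H H M \<one>\<^bsub>H\<^esub> (k0, k1)) = theta k0 k1" if k: "k0 \<in> carrier H" "k1 \<in> carrier H" for k0 k1
  proof -
    have hom: "\<Theta> \<in> lmod_hom HA HM N" using \<Theta> by simp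
    have t: "ctens H H \<one>\<^bsub>H\<^esub> k \<in> carrier HA" if "k \<in> carrier H" for k using that by (simp add: HA.tens_closed)
    have "outer_tens H H M \<one>\<^bsub>H\<^esub> (k0, k1) = comb2 HM (i 0) (i 1) (ctens H H \<one>\<^bsub>H\<^esub> k0) (ctens H H \<one>\<^bsub>H\<^esub> k1)"
      using semilinear_comb2[OF O.unit_map_semilinear lmodule_M basis_closed basis_closed k, of 0 1]
      by (simp add: comb_M k)
    then have "\<Theta> (outer_tens H H M \<one>\<^bsub>H\<^esub> (k0, k1)) =
        comb2 N (image_vec 0) (image_vec 1) (ctens H H \<one>\<^bsub>H\<^esub> k0) (ctens H H \<one>\<^bsub>H\<^esub> k1)"
      using lmod_hom_comb2[OF hom O.lmodule_HM i_closed i_closed t[OF k(1)] t[OF k(2)], of 0 1] \<Theta> by simp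
    also have "\<dots> = theta k0 k1"
      unfolding image_vec_def theta_def
      by (subst comb2_comb2[OF N.lmodule_E j_closed j_closed a1_closed a1_closed a1_closed a1_closed t t])
         (simp_all add: k HA.mult_tens a_closed)
    finally show ?thesis .
  qed
  then show "is_Theta \<Theta>" using \<Theta> by (simp add: is_Theta_def)
qed

lemma ex1_Theta: "\<exists>!\<Theta>. is_Theta \<Theta>"
proof -
  obtain \<Theta> where \<Theta>: "\<Theta> \<in> lmod_hom HA HM N" "\<Theta> \<in> extensional (carrier HM)" "\<Theta> (i 0) = image_vec 0" "\<Theta> (i 1) = image_vec 1"
    by (rule free2_hom_exists[OF free_HM N.lmodule_E image_vec_closed image_vec_closed]) (rule that)
  show ?thesis
  proof (rule ex1I[of _ \<Theta>])
    show "is_Theta \<Theta>" using \<Theta> by (simp add: is_Theta_iff)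
    fix \<Psi> assume "is_Theta \<Psi>"
    then have \<Psi>: "\<Psi> \<in> lmod_hom HA HM N" "\<Psi> \<in> extensional (carrier HM)" "\<Psi> (i 0) = image_vec 0" "\<Psi> (i 1) = image_vec 1"
      by (simp_all add: is_Theta_iff)
    have "\<Psi> z = \<Theta> z" if "z \<in> carrier HM" for z
      by (rule lmod_hom_ext[OF \<Psi>(1) \<Theta>(1) free_HM _ _ that]) (use \<Psi> \<Theta> in auto)
    then show "\<Psi> = \<Theta>" using \<Psi>(2) \<Theta>(2) by (intro extensionalityI[where A = "carrier HM"]) auto
  qed
qed

context
  fixes \<Theta> assumes \<Theta>: "is_Theta \<Theta>"
begin

lemma Theta_hom: "\<Theta> \<in> lmod_hom HA HM N"
  and Theta_i: "\<Theta> (i p) = image_vec p"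
  using \<Theta> exhaust_01[of p] by (auto simp: is_Theta_iff)

lemma ext_N_free: "ring R \<Longrightarrow> \<phi> \<in> ring_hom HA R \<Longrightarrow> free2 R (ext_scalars R \<phi> HA N) (ext_nat R \<phi> HA N (j 0)) (ext_nat R \<phi> HA N (j 1))"
  by (rule scalar_extension.ext_free2[OF scalar_extension.intro[OF _ _ N.lmodule_E] free_N])

lemma ext_HM_free: "ring R \<Longrightarrow> \<phi> \<in> ring_hom HA R \<Longrightarrow> free2 R (ext_scalars R \<phi> HA HM) (ext_nat R \<phi> HA HM (i 0)) (ext_nat R \<phi> HA HM (i 1))"
  by (rule scalar_extension.ext_free2[OF scalar_extension.intro[OF _ _ O.lmodule_HM] free_HM])

lemma ext_N_semilinear: "ring R \<Longrightarrow> \<phi> \<in> ring_hom HA R \<Longrightarrow>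
    semilinear (\<lambda>c. \<phi> (comult H c)) H M (ext_scalars R \<phi> HA N) (ext_nat R \<phi> HA N \<circ> ext_nat HA (comult H) H M)"
  by (rule scalar_extension.unit_map_semilinear_comp[OF scalar_extension.intro[OF _ _ N.lmodule_E] N.unit_map_semilinear comult_closed])

lemma ext_HM_semilinear: "ring R \<Longrightarrow> \<phi> \<in> ring_hom HA R \<Longrightarrow>
    semilinear (\<lambda>c. \<phi> (ctens H H \<one>\<^bsub>H\<^esub> c)) H M (ext_scalars R \<phi> HA HM) (ext_nat R \<phi> HA HM \<circ> outer_tens H H M \<one>\<^bsub>H\<^esub>)"
  by (rule scalar_extension.unit_map_semilinear_comp[OF scalar_extension.intro[OF _ _ O.lmodule_HM] O.unit_map_semilinear])
     (simp_all add: HA.tens_closed)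

lemma ext_Theta:
  assumes R: "ring R" and \<phi>: "\<phi> \<in> ring_hom HA R"
  shows "ext_map R \<phi> HA N \<Theta> \<in> lmod_hom R (ext_scalars R \<phi> HA HM) (ext_scalars R \<phi> HA N)"
    and "ext_map R \<phi> HA N \<Theta> (ext_nat R \<phi> HA HM (i p)) =
      comb2 (ext_scalars R \<phi> HA N) (ext_nat R \<phi> HA N (j 0)) (ext_nat R \<phi> HA N (j 1)) (\<phi> (a1 0 p)) (\<phi> (a1 1 p))"
proof -
  note * = ext_map_hom[OF R \<phi> O.lmodule_HM N.lmodule_E Theta_hom]
  show "ext_map R \<phi> HA N \<Theta> \<in> lmod_hom R (ext_scalars R \<phi> HA HM) (ext_scalars R \<phi> HA N)" by (rule *(1))
  show "ext_map R \<phi> HA N \<Theta> (ext_nat R \<phi> HA HM (i p)) =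
      comb2 (ext_scalars R \<phi> HA N) (ext_nat R \<phi> HA N (j 0)) (ext_nat R \<phi> HA N (j 1)) (\<phi> (a1 0 p)) (\<phi> (a1 1 p))"
    unfolding *(2)[OF i_closed] Theta_i image_vec_def
    by (rule semilinear_comb2[OF scalar_extension.unit_map_semilinear[OF scalar_extension.intro[OF R \<phi> N.lmodule_E]]
          N.lmodule_E j_closed j_closed a1_closed a1_closed])
qed

text \<open>The comultiplication condition in coordinates. Both sides are the sum over l of a_rl
  \<otimes> (a_lp \<otimes> 1). The factors coming from \<open>e_map\<close> and
  \<open>d_map\<close> sit in different tensor factors and commute, so the reversed order imposed by
  \<open>comb2_comb2\<close> agrees with the order of the indices in the comultiplication.\<close>

lemma D_map_a1: "D_map (a1 r p) = e_map (a1 0 p) \<otimes>\<^bsub>B\<^esub> d_map (a1 r 0) \<oplus>\<^bsub>B\<^esub> e_map (a1 1 p) \<otimes>\<^bsub>B\<^esub> d_map (a1 r 1)"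
proof -
  note ad = additive_map_add[OF clinear_additive[OF tri.ctensor_assoc_clinear]]
  have "D_map (a1 r p) = ctensor_assoc H H H (ctens HA H (ctens H H (a r 0) (a 0 p) \<oplus>\<^bsub>HA\<^esub> ctens H H (a r 1) (a 1 p)) \<one>\<^bsub>H\<^esub>)"
    by (simp add: D_map_tens a_closed comult_a)
  also have "\<dots> = ctens H HA (a r 0) (a1 0 p) \<oplus>\<^bsub>B\<^esub> ctens H HA (a r 1) (a1 1 p)"
    by (simp add: tri.L.tens_add_left HA.tens_closed a_closed ad tri.L.tens_closed tri.ctensor_assoc_tens)
  also have "\<dots> = e_map (a1 0 p) \<otimes>\<^bsub>B\<^esub> d_map (a1 r 0) \<oplus>\<^bsub>B\<^esub> e_map (a1 1 p) \<otimes>\<^bsub>B\<^esub> d_map (a1 r 1)"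
    by (simp add: d_map_tens e_map_def a_closed comult_one B.mult_tens HA.tens_closed HA.mult_tens)
  finally show ?thesis .
qed

lemma comult_condition: "comult_condition H H (comult H) M \<Theta>"
proof -
  note iN = ext_N_free[OF BR.ring_axioms] and iHM = ext_HM_free[OF BR.ring_axioms]
  note sN = ext_N_semilinear[OF BR.ring_axioms] and sHM = ext_HM_semilinear[OF BR.ring_axioms]
  note hc = ring_hom_closed[OF e_map_hom] ring_hom_closed[OF d_map_hom] ring_hom_closed[OF D_map_hom]
  define \<sigma>1 where "\<sigma>1 = canonical_iso B (carrier M)
      (ext_scalars B e_map HA N) (ext_nat B e_map HA N \<circ> ext_nat HA (comult H) H M)
      (ext_scalars B d_map HA HM) (ext_nat B d_map HA HM \<circ> outer_tens H H M \<one>\<^bsub>H\<^esub>)"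
  define \<sigma>2 where "\<sigma>2 = canonical_iso B (carrier M)
      (ext_scalars B d_map HA N) (ext_nat B d_map HA N \<circ> ext_nat HA (comult H) H M)
      (ext_scalars B D_map HA N) (ext_nat B D_map HA N \<circ> ext_nat HA (comult H) H M)"
  define \<sigma>3 where "\<sigma>3 = canonical_iso B (carrier M)
      (ext_scalars B e_map HA HM) (ext_nat B e_map HA HM \<circ> outer_tens H H M \<one>\<^bsub>H\<^esub>)
      (ext_scalars B D_map HA HM) (ext_nat B D_map HA HM \<circ> outer_tens H H M \<one>\<^bsub>H\<^esub>)"
  have \<sigma>1: "\<sigma>1 \<in> lmod_hom B (ext_scalars B e_map HA N) (ext_scalars B d_map HA HM)"
    "\<And>p. \<sigma>1 (ext_nat B e_map HA N (j p)) = ext_nat B d_map HA HM (i p)"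
    unfolding \<sigma>1_def
    using canonical_iso[OF free_M _ sN[OF e_map_hom] _ sHM[OF d_map_hom], unfolded comp_def, OF iN[OF e_map_hom] iHM[OF d_map_hom]]
      basis_closed
    by (simp_all add: hc comult_closed HA.tens_closed e_comult comp_def)
  have \<sigma>2: "\<sigma>2 \<in> lmod_hom B (ext_scalars B d_map HA N) (ext_scalars B D_map HA N)"
    "\<And>p. \<sigma>2 (ext_nat B d_map HA N (j p)) = ext_nat B D_map HA N (j p)"
    unfolding \<sigma>2_def
    using canonical_iso[OF free_M _ sN[OF d_map_hom] _ sN[OF D_map_hom], unfolded comp_def, OF iN[OF d_map_hom] iN[OF D_map_hom]]
      basis_closed
    by (simp_all add: hc comult_closed d_comult comp_def)
  have \<sigma>3: "\<sigma>3 \<in> lmod_hom B (ext_scalars B e_map HA HM) (ext_scalars B D_map HA HM)"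
    "\<And>p. \<sigma>3 (ext_nat B e_map HA HM (i p)) = ext_nat B D_map HA HM (i p)"
    unfolding \<sigma>3_def
    using canonical_iso[OF free_M _ sHM[OF e_map_hom] _ sHM[OF D_map_hom], unfolded comp_def, OF iHM[OF e_map_hom] iHM[OF D_map_hom]]
      basis_closed
    by (simp_all add: hc HA.tens_closed e_one comp_def)
  note T = ext_Theta[OF BR.ring_axioms]
  let ?L = "\<lambda>x. \<sigma>2 (ext_map B d_map HA N \<Theta> (\<sigma>1 (ext_map B e_map HA N \<Theta> x)))"
  let ?R = "\<lambda>x. ext_map B D_map HA N \<Theta> (\<sigma>3 x)"
  have L: "?L \<in> lmod_hom B (ext_scalars B e_map HA HM) (ext_scalars B D_map HA N)"
    using T(1)[OF e_map_hom] T(1)[OF d_map_hom] \<sigma>1(1) \<sigma>2(1) by (auto simp: lmod_hom_def Pi_def)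
  have R: "?R \<in> lmod_hom B (ext_scalars B e_map HA HM) (ext_scalars B D_map HA N)"
    using T(1)[OF D_map_hom] \<sigma>3(1) by (auto simp: lmod_hom_def Pi_def)
  have eq: "?L (ext_nat B e_map HA HM (i p)) = ?R (ext_nat B e_map HA HM (i p))" for p
  proof -
    note c = hc(1)[OF a1_closed] hc(2)[OF a1_closed]
    note Xe = free2D(1-3)[OF iN[OF e_map_hom]] and Xd = free2D(1-3)[OF iN[OF d_map_hom]]
      and XD = free2D(1-3)[OF iN[OF D_map_hom]] and Yd = free2D(1-3)[OF iHM[OF d_map_hom]]
    \<comment> \<open>The first \<Theta> produces column p with entries under \<open>e_map\<close>;
      after \<sigma>1, the second one replaces each basis vector by a column with entries under
      \<open>d_map\<close>. The maps \<sigma> only rename the basis.\<close>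
    have "?L (ext_nat B e_map HA HM (i p)) = comb2 (ext_scalars B D_map HA N)
       (comb2 (ext_scalars B D_map HA N) (ext_nat B D_map HA N (j 0)) (ext_nat B D_map HA N (j 1)) (d_map (a1 0 0)) (d_map (a1 1 0)))
       (comb2 (ext_scalars B D_map HA N) (ext_nat B D_map HA N (j 0)) (ext_nat B D_map HA N (j 1)) (d_map (a1 0 1)) (d_map (a1 1 1)))
       (e_map (a1 0 p)) (e_map (a1 1 p))"
      using c by (simp add: T(2)[OF e_map_hom] T(2)[OF d_map_hom] lmod_hom_comb2[OF \<sigma>1(1) Xe] \<sigma>1(2)
          lmod_hom_comb2[OF T(1)[OF d_map_hom] Yd] lmod_hom_comb2[OF \<sigma>2(1) Xd(1)] comb2_closed[OF Xd] Xd(2,3) \<sigma>2(2))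
    also have "\<dots> = comb2 (ext_scalars B D_map HA N) (ext_nat B D_map HA N (j 0)) (ext_nat B D_map HA N (j 1))
        (D_map (a1 0 p)) (D_map (a1 1 p))"
      unfolding D_map_a1 using c by (intro comb2_comb2[OF XD])
    also have "\<dots> = ?R (ext_nat B e_map HA HM (i p))"
      by (simp add: \<sigma>3(2) T(2)[OF D_map_hom])
    finally show ?thesis .
  qed
  have "?L x = ?R x" if "x \<in> carrier (ext_scalars B e_map HA HM)" for x
    by (rule lmod_hom_ext[OF L R iHM[OF e_map_hom] eq eq that])
  then show ?thesis
    unfolding comult_condition_def Let_def \<sigma>1_def \<sigma>2_def \<sigma>3_def
    by (simp add: e_map_def d_map_def D_map_def)
qed

text \<open>Under \<epsilon> \<otimes> id the matrix a \<otimes> 1 becomes \<epsilon>(a), the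
  identity matrix, and the two identifications match the basis of \<open>M\<close> with
  itself.\<close>

lemma counit_condition: "counit_condition H H (comult H) M \<Theta>"
proof -
  define \<tau>1 where "\<tau>1 = canonical_iso H (carrier M) M id
      (ext_scalars H E_map HA HM) (ext_nat H E_map HA HM \<circ> outer_tens H H M \<one>\<^bsub>H\<^esub>)"
  define \<tau>2 where "\<tau>2 = canonical_iso H (carrier M)
      (ext_scalars H E_map HA N) (ext_nat H E_map HA N \<circ> ext_nat HA (comult H) H M) M id"
  have idM: "semilinear (\<lambda>c. c) H M M id" by (simp add: semilinear_def additive_map_id)
  have freeM: "free2 H M (id (basis 0)) (id (basis 1))" using free_M by simp
  note R = HA.VR.ring_axioms
  have \<tau>1: "\<tau>1 \<in> lmod_hom H M (ext_scalars H E_map HA HM)" "\<And>p. \<tau>1 (basis p) = ext_nat H E_map HA HM (i p)"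
    unfolding \<tau>1_def
    using canonical_iso[OF free_M freeM idM _ ext_HM_semilinear[OF R E_map_hom], unfolded comp_def, OF ext_HM_free[OF R E_map_hom]]
      basis_closed by (simp_all add: E_one comp_def)
  have \<tau>2: "\<tau>2 \<in> lmod_hom H (ext_scalars H E_map HA N) M" "\<And>p. \<tau>2 (ext_nat H E_map HA N (j p)) = basis p"
    unfolding \<tau>2_def
    using canonical_iso[OF free_M _ ext_N_semilinear[OF R E_map_hom] freeM idM, unfolded comp_def, OF ext_N_free[OF R E_map_hom]]
      basis_closed by (simp_all add: E_comult comp_def)
  note T = ext_Theta[OF R E_map_hom]
  let ?L = "\<lambda>m. \<tau>2 (ext_map H E_map HA N \<Theta> (\<tau>1 m))"
  have L: "?L \<in> lmod_hom H M M" "(\<lambda>m. m) \<in> lmod_hom H M M"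
    using T(1) \<tau>1(1) \<tau>2(1) by (auto simp: lmod_hom_def Pi_def)
  have E_a1: "E_map (a1 q p) = (if q = p then \<one>\<^bsub>H\<^esub> else \<zero>\<^bsub>H\<^esub>)" for p q
  proof -
    have "0 \<odot>\<^bsub>H\<^esub> \<one>\<^bsub>H\<^esub> = \<zero>\<^bsub>H\<^esub>"
      using additive_map_zero[OF cmodule_abelian[OF cmodule_complex] HA.td.B.abelian_group_axioms, of "\<lambda>c. c \<odot>\<^bsub>H\<^esub> \<one>\<^bsub>H\<^esub>"]
      by (simp add: additive_map_def smult_A cmodule_simps(2)[OF HA.V])
    then show ?thesis by (simp add: E_map_tens a_closed counit_a cmodule_simps(5)[OF HA.V])
  qed
  have eq: "?L (basis p) = basis p" for p
    using exhaust_01[of p]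
    by (auto simp: \<tau>1(2) T(2) E_a1 lmod_hom_comb2[OF \<tau>2(1) free2D(1-3)[OF ext_N_free[OF R E_map_hom]]] \<tau>2(2)
        comb2_basis[OF lmodule_M basis_closed basis_closed])
  have "?L m = m" if "m \<in> carrier M" for m
    by (rule lmod_hom_ext[OF L free_M eq eq that])
  then show ?thesis
    unfolding counit_condition_def Let_def \<tau>1_def \<tau>2_def by (simp add: E_map_def)
qed

text \<open>A preimage of the single vector \<open>j 0\<close> is enough. Its coordinates are a row
  t over H \<otimes> H with t (a \<otimes> 1)^t = (1, 0). As id \<otimes> \<epsilon> is an algebra
  map with a \<otimes> 1 \<mapsto> a, it yields the first row of a left inverse of a^t over
  \<open>H\<close>, the only row used later.\<close>

lemma surj_imp_left_inverse:
  assumes "\<Theta> ` carrier HM = carrier N"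
  obtains y0 y1 where "y0 \<in> carrier H" "y1 \<in> carrier H"
    "y0 \<otimes>\<^bsub>H\<^esub> a 0 0 \<oplus>\<^bsub>H\<^esub> y1 \<otimes>\<^bsub>H\<^esub> a 0 1 = \<one>\<^bsub>H\<^esub>" "y0 \<otimes>\<^bsub>H\<^esub> a 1 0 \<oplus>\<^bsub>H\<^esub> y1 \<otimes>\<^bsub>H\<^esub> a 1 1 = \<zero>\<^bsub>H\<^esub>"
proof -
  have "j 0 \<in> \<Theta> ` carrier HM" unfolding assms by (rule j_closed)
  then obtain X where X: "X \<in> carrier HM" "\<Theta> X = j 0" by fastforce
  obtain t0 t1 where t: "t0 \<in> carrier HA" "t1 \<in> carrier HA" "X = comb2 HM (i 0) (i 1) t0 t1"
    using free2D(4)[OF free_HM X(1)] by blast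
  have "comb2 N (j 0) (j 1) \<one>\<^bsub>HA\<^esub> \<zero>\<^bsub>HA\<^esub> = comb2 N (image_vec 0) (image_vec 1) t0 t1"
    using X(2) t lmod_hom_comb2[OF Theta_hom O.lmodule_HM i_closed i_closed t(1,2), of 0 1]
    by (simp add: comb2_basis[OF N.lmodule_E j_closed j_closed] Theta_i)
  also have "\<dots> = comb2 N (j 0) (j 1) (t0 \<otimes>\<^bsub>HA\<^esub> a1 0 0 \<oplus>\<^bsub>HA\<^esub> t1 \<otimes>\<^bsub>HA\<^esub> a1 0 1) (t0 \<otimes>\<^bsub>HA\<^esub> a1 1 0 \<oplus>\<^bsub>HA\<^esub> t1 \<otimes>\<^bsub>HA\<^esub> a1 1 1)"
    unfolding image_vec_def
    by (rule comb2_comb2[OF N.lmodule_E j_closed j_closed a1_closed a1_closed a1_closed a1_closed t(1,2)])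
  finally have eqs: "\<one>\<^bsub>HA\<^esub> = t0 \<otimes>\<^bsub>HA\<^esub> a1 0 0 \<oplus>\<^bsub>HA\<^esub> t1 \<otimes>\<^bsub>HA\<^esub> a1 0 1 \<and>
      \<zero>\<^bsub>HA\<^esub> = t0 \<otimes>\<^bsub>HA\<^esub> a1 1 0 \<oplus>\<^bsub>HA\<^esub> t1 \<otimes>\<^bsub>HA\<^esub> a1 1 1"
    by (intro free2D(5)[OF free_N]) (use t a1_closed in simp_all)
  have E'_a1: "E'_map (a1 p q) = a p q" for p q
    by (simp add: E'_map_tens a_closed counit_one cmodule_simps(5)[OF HA.V])
  note hom = ring_hom_add[OF E'_map_hom] ring_hom_mult[OF E'_map_hom] ring_hom_closed[OF E'_map_hom]
  have z: "E'_map \<zero>\<^bsub>HA\<^esub> = \<zero>\<^bsub>H\<^esub>"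
    by (rule additive_map_zero[OF B.td.M.abelian_group_axioms HA.td.B.abelian_group_axioms])
       (simp add: additive_map_def hom Pi_def)
  have key: "E'_map (t0 \<otimes>\<^bsub>HA\<^esub> a1 q 0 \<oplus>\<^bsub>HA\<^esub> t1 \<otimes>\<^bsub>HA\<^esub> a1 q 1) =
      E'_map t0 \<otimes>\<^bsub>H\<^esub> a q 0 \<oplus>\<^bsub>H\<^esub> E'_map t1 \<otimes>\<^bsub>H\<^esub> a q 1" for q
    using t a1_closed by (simp add: hom E'_a1)
  show thesis
  proof (rule that)
    show "E'_map t0 \<in> carrier H" "E'_map t1 \<in> carrier H" by (rule hom(3)[OF t(1)], rule hom(3)[OF t(2)])
    show "E'_map t0 \<otimes>\<^bsub>H\<^esub> a 0 0 \<oplus>\<^bsub>H\<^esub> E'_map t1 \<otimes>\<^bsub>H\<^esub> a 0 1 = \<one>\<^bsub>H\<^esub>"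
      unfolding key[symmetric] conjunct1[OF eqs, symmetric] by (rule ring_hom_one[OF E'_map_hom])
    show "E'_map t0 \<otimes>\<^bsub>H\<^esub> a 1 0 \<oplus>\<^bsub>H\<^esub> E'_map t1 \<otimes>\<^bsub>H\<^esub> a 1 1 = \<zero>\<^bsub>H\<^esub>"
      unfolding key[symmetric] conjunct2[OF eqs, symmetric] by (rule z)
  qed
qed

end

end

section \<open>The Hopf algebra generated by iterated contragredients\<close>

definition kdelta :: "2 \<Rightarrow> 2 \<Rightarrow> complex"
  where "kdelta i j = (if i = j then 1 else 0)"

lemma kdelta_simps [simp]: "kdelta i i = 1" "kdelta 0 1 = 0" "kdelta 1 0 = 0"
  by (simp_all add: kdelta_def)

text \<open>
  \<open>g (Suc k)\<close> is the transposed inverse of the matrix \<open>g k\<close>.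
\<close>

definition contragredient_seq :: "(complex, 'b, 'y) module_scheme \<Rightarrow> (nat \<Rightarrow> 2 \<Rightarrow> 2 \<Rightarrow> 'b) \<Rightarrow> bool"
  where "contragredient_seq B g \<longleftrightarrow>
    (\<forall>k i j. g k i j \<in> carrier B) \<and>
    (\<forall>k i j. g k i 0 \<otimes>\<^bsub>B\<^esub> g (Suc k) j 0 \<oplus>\<^bsub>B\<^esub> g k i 1 \<otimes>\<^bsub>B\<^esub> g (Suc k) j 1 = kdelta i j \<odot>\<^bsub>B\<^esub> \<one>\<^bsub>B\<^esub>) \<and>
    (\<forall>k i j. g (Suc k) 0 i \<otimes>\<^bsub>B\<^esub> g k 0 j \<oplus>\<^bsub>B\<^esub> g (Suc k) 1 i \<otimes>\<^bsub>B\<^esub> g k 1 j = kdelta i j \<odot>\<^bsub>B\<^esub> \<one>\<^bsub>B\<^esub>)"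

section \<open>Terms, provable equality and evaluation\<close>

text \<open>Terms of the language of unital complex algebras on the entries of x_0, x_1, and so on.
  Zero and negation have no constructors: \<open>EScal 0\<close> and \<open>EScal (-1)\<close> stand
  in for them. The congruence \<open>eqv\<close> below combines the algebra axioms with the matrix
  relations, so K arises in one quotient, and a code for terms is all that is required to place it
  on the type of \<open>H\<close>.\<close>

datatype expr = EGen nat 2 2 | EOne | EAdd expr expr | EMul expr expr | EScal complex expr

inductive eqv :: "expr \<Rightarrow> expr \<Rightarrow> bool"  (infix \<open>\<doteq>\<close> 50)
  where
    eqv_refl: "t \<doteq> t"
  | eqv_sym: "s \<doteq> t \<Longrightarrow> t \<doteq> s"
  | eqv_trans: "s \<doteq> t \<Longrightarrow> t \<doteq> u \<Longrightarrow> s \<doteq> u"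
  | eqv_add: "s \<doteq> s' \<Longrightarrow> t \<doteq> t' \<Longrightarrow> EAdd s t \<doteq> EAdd s' t'"
  | eqv_mul: "s \<doteq> s' \<Longrightarrow> t \<doteq> t' \<Longrightarrow> EMul s t \<doteq> EMul s' t'"
  | eqv_scal: "t \<doteq> t' \<Longrightarrow> EScal c t \<doteq> EScal c t'"
  | add_comm: "EAdd s t \<doteq> EAdd t s"
  | add_assoc: "EAdd (EAdd s t) u \<doteq> EAdd s (EAdd t u)"
  | add_zero: "EAdd (EScal 0 s) t \<doteq> t"
  | scal_add: "EScal c (EAdd s t) \<doteq> EAdd (EScal c s) (EScal c t)"
  | plus_scal: "EScal (c + d) t \<doteq> EAdd (EScal c t) (EScal d t)"
  | scal_scal: "EScal (c * d) t \<doteq> EScal c (EScal d t)"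
  | scal_one: "EScal 1 t \<doteq> t"
  | mul_assoc: "EMul (EMul s t) u \<doteq> EMul s (EMul t u)"
  | one_mul: "EMul EOne t \<doteq> t"
  | mul_one: "EMul t EOne \<doteq> t"
  | add_mul: "EMul (EAdd s t) u \<doteq> EAdd (EMul s u) (EMul t u)"
  | mul_add: "EMul u (EAdd s t) \<doteq> EAdd (EMul u s) (EMul u t)"
  | scal_mul: "EMul (EScal c s) t \<doteq> EScal c (EMul s t)"
  | mul_scal: "EMul s (EScal c t) \<doteq> EScal c (EMul s t)"
  | rel_left: "EAdd (EMul (EGen k i 0) (EGen (Suc k) j 0)) (EMul (EGen k i 1) (EGen (Suc k) j 1)) \<doteq>
      EScal (kdelta i j) EOne"
  | rel_right: "EAdd (EMul (EGen (Suc k) 0 i) (EGen k 0 j)) (EMul (EGen (Suc k) 1 i) (EGen k 1 j)) \<doteq>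
      EScal (kdelta i j) EOne"

declare eqv_trans [trans]

fun ev :: "(complex, 'b, 'y) module_scheme \<Rightarrow> (nat \<Rightarrow> 2 \<Rightarrow> 2 \<Rightarrow> 'b) \<Rightarrow> expr \<Rightarrow> 'b"
  where
    "ev B g (EGen k i j) = g k i j"
  | "ev B g EOne = \<one>\<^bsub>B\<^esub>"
  | "ev B g (EAdd s t) = ev B g s \<oplus>\<^bsub>B\<^esub> ev B g t"
  | "ev B g (EMul s t) = ev B g s \<otimes>\<^bsub>B\<^esub> ev B g t"
  | "ev B g (EScal c t) = c \<odot>\<^bsub>B\<^esub> ev B g t"

lemma cmodule_zero_smult:
  assumes V: "cmodule V" and v: "v \<in> carrier V"
  shows "0 \<odot>\<^bsub>V\<^esub> v = \<zero>\<^bsub>V\<^esub>"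
  by (rule additive_map_zero[OF cmodule_abelian[OF cmodule_complex] cmodule_abelian[OF V], of "\<lambda>c. c \<odot>\<^bsub>V\<^esub> v", simplified])
     (simp add: additive_map_def cmodule_simps[OF V v])

lemma ev_closed:
  assumes B: "unital_algebra B" and g: "contragredient_seq B g"
  shows "ev B g t \<in> carrier B"
proof -
  interpret B: ring B by (rule unital_algebraD(2)[OF B])
  show ?thesis
    by (induction t) (use g in \<open>auto simp: contragredient_seq_def cmodule_simps(1)[OF unital_algebraD(1)[OF B]]\<close>)
qed

text \<open>Every rule of \<open>eqv\<close> is valid in an algebra with a contragredient sequence.
  Hence evaluation descends to the quotient, which is the universal property by which the
  comultiplication, counit, antipode and representation of K are all defined.\<close>

lemma ev_eqv:
  assumes B: "unital_algebra B" and g: "contragredient_seq B g" and "s \<doteq> t"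
  shows "ev B g s = ev B g t"
proof -
  interpret B: ring B by (rule unital_algebraD(2)[OF B])
  note c = ev_closed[OF B g] and m = cmodule_simps[OF unital_algebraD(1)[OF B]]
  show ?thesis
    using assms(3)
  proof (induction)
    case (add_comm s t)
    show ?case using c by (simp add: B.a_comm)
  next
    case (add_assoc s t u)
    show ?case using c by (simp add: B.a_assoc)
  next
    case (add_zero s t)
    show ?case using c by (simp add: cmodule_zero_smult[OF unital_algebraD(1)[OF B]])
  next
    case (rel_left k i j)
    show ?case using g by (simp add: contragredient_seq_def)
  next
    case (rel_right k i j)
    show ?case using g by (simp add: contragredient_seq_def)
  qed (use c in \<open>simp_all add: m B.m_assoc B.l_distr B.r_distr unital_algebraD(3,4)[OF B]\<close>)
qed

section \<open>The algebra K, its comultiplication and its counit\<close>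

locale encoded_exprs =
  fixes code :: "expr \<Rightarrow> 'h"
  assumes inj_code: "inj code"
begin

text \<open>
  The class of \<open>t\<close> is represented by the code of a chosen member, so that the quotient lives on \<open>'h\<close>.
\<close>

definition q :: "expr \<Rightarrow> 'h" where "q t = code (SOME s. s \<doteq> t)"

definition rep :: "'h \<Rightarrow> expr" where "rep x = (SOME t. q t = x)"

lemma q_eq_iff: "q s = q t \<longleftrightarrow> s \<doteq> t"
proof
  assume "q s = q t"
  then have "(SOME u. u \<doteq> s) = (SOME u. u \<doteq> t)" using inj_code by (simp add: q_def inj_eq)
  moreover have "(SOME u. u \<doteq> s) \<doteq> s" "(SOME u. u \<doteq> t) \<doteq> t" by (rule someI[of _ s] someI[of _ t], rule eqv_refl)+
  ultimately show "s \<doteq> t" by (metis eqv_sym eqv_trans)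
next
  assume "s \<doteq> t"
  then have "(\<lambda>u. u \<doteq> s) = (\<lambda>u. u \<doteq> t)" by (auto intro: eqv_trans eqv_sym)
  then show "q s = q t" by (simp add: q_def)
qed

lemma rep_q: "rep (q t) \<doteq> t"
proof -
  have "q (rep (q t)) = q t" unfolding rep_def by (rule someI[of _ t]) simp
  then show ?thesis by (simp add: q_eq_iff)
qed

definition quot :: "('h \<Rightarrow> ('h \<times> 'h \<Rightarrow>\<^sub>0 int) set) \<Rightarrow> ('h \<Rightarrow> complex) \<Rightarrow> 'h coalg"
  where "quot \<delta> \<epsilon> = \<lparr>carrier = range q, mult = (\<lambda>x y. q (EMul (rep x) (rep y))), one = q EOne,
    ring.zero = q (EScal 0 EOne), add = (\<lambda>x y. q (EAdd (rep x) (rep y))),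
    smult = (\<lambda>c x. q (EScal c (rep x))), comult = \<delta>, counit = \<epsilon>\<rparr>"

lemma quot_simps:
  "carrier (quot \<delta> \<epsilon>) = range q" "\<one>\<^bsub>quot \<delta> \<epsilon>\<^esub> = q EOne" "\<zero>\<^bsub>quot \<delta> \<epsilon>\<^esub> = q (EScal 0 EOne)"
  "q s \<otimes>\<^bsub>quot \<delta> \<epsilon>\<^esub> q t = q (EMul s t)" "q s \<oplus>\<^bsub>quot \<delta> \<epsilon>\<^esub> q t = q (EAdd s t)"
  "c \<odot>\<^bsub>quot \<delta> \<epsilon>\<^esub> q t = q (EScal c t)"
  "comult (quot \<delta> \<epsilon>) = \<delta>" "counit (quot \<delta> \<epsilon>) = \<epsilon>"
  by (simp_all add: quot_def q_eq_iff eqv_mul eqv_add eqv_scal rep_q)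

lemma quot_algebra: "unital_algebra (quot \<delta> \<epsilon>)"
proof -
  let ?K = "quot \<delta> \<epsilon>"
  \<comment> \<open>Any \<open>EScal 0 s\<close> is neutral for addition by \<open>add_zero\<close>,
    so two of them are equivalent, each absorbing the other.\<close>
  have z: "EScal 0 s \<doteq> EScal 0 EOne" for s
  proof -
    have "EScal 0 s \<doteq> EAdd (EScal 0 EOne) (EScal 0 s)" by (rule eqv_sym[OF add_zero])
    also have "EAdd (EScal 0 EOne) (EScal 0 s) \<doteq> EAdd (EScal 0 s) (EScal 0 EOne)" by (rule add_comm)
    also have "EAdd (EScal 0 s) (EScal 0 EOne) \<doteq> EScal 0 EOne" by (rule add_zero)
    finally show ?thesis .
  qed
  have ag: "abelian_group ?K"
  proof (rule abelian_groupI)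
    fix x assume "x \<in> carrier ?K"
    then obtain t where t: "x = q t" by (auto simp: quot_simps)
    have "EAdd (EScal (-1) t) t \<doteq> EAdd (EScal (-1) t) (EScal 1 t)" by (intro eqv_add eqv_refl eqv_sym[OF scal_one])
    also have "EAdd (EScal (-1) t) (EScal 1 t) \<doteq> EScal (-1 + 1) t" by (rule eqv_sym[OF plus_scal])
    also have "EScal (-1 + 1) t \<doteq> EScal 0 EOne" using z by simp
    finally show "\<exists>y\<in>carrier ?K. y \<oplus>\<^bsub>?K\<^esub> x = \<zero>\<^bsub>?K\<^esub>"
      by (intro bexI[of _ "q (EScal (-1) t)"]) (simp_all add: t quot_simps q_eq_iff rangeI)
  qed (auto simp: quot_simps q_eq_iff intro: rangeI add_comm add_assoc add_zero)
  show ?thesis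
    unfolding unital_algebra_def
  proof (intro conjI)
    show "cmodule ?K"
      by (rule cmoduleI[OF ag])
         (auto simp: quot_simps q_eq_iff intro: rangeI scal_add plus_scal scal_scal scal_one)
    show "ring ?K"
    proof (rule ringI[OF ag])
      show "monoid ?K"
        by (rule monoidI) (auto simp: quot_simps q_eq_iff intro: rangeI mul_assoc one_mul mul_one)
    qed (auto simp: quot_simps q_eq_iff intro: rangeI add_mul mul_add)
  qed (auto simp: quot_simps q_eq_iff intro: rangeI scal_mul mul_scal)
qed

definition "gen k i j = q (EGen k i j)"

definition hom_of :: "(complex, 'b, 'y) module_scheme \<Rightarrow> (nat \<Rightarrow> 2 \<Rightarrow> 2 \<Rightarrow> 'b) \<Rightarrow> 'h \<Rightarrow> 'b"
  where "hom_of B g x = ev B g (rep x)"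

lemma hom_of_q: "unital_algebra B \<Longrightarrow> contragredient_seq B g \<Longrightarrow> hom_of B g (q t) = ev B g t"
  unfolding hom_of_def by (rule ev_eqv[OF _ _ rep_q])

lemma hom_of_gen: "unital_algebra B \<Longrightarrow> contragredient_seq B g \<Longrightarrow> hom_of B g (gen k i j) = g k i j"
  by (simp add: gen_def hom_of_q)

text \<open>The record \<open>K\<close> has its comultiplication as a field, while the
  comultiplication is a map into the tensor square of \<open>K\<close>. The circle is broken by
  noting that the tensor square reads only the algebra fields: it is formed first from a record with
  dummy coalgebra fields, and \<open>ctensor_quot0\<close> shows the result to be the same.\<close>

definition "quot0 = quot undefined undefined"

definition "Comult_gen k i j = ctens quot0 quot0 (gen k i 0) (gen k 0 j) \<oplus>\<^bsub>ctensor quot0 quot0\<^esub>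
    ctens quot0 quot0 (gen k i 1) (gen k 1 j)"

definition "Comult = hom_of (ctensor quot0 quot0) Comult_gen"
definition "Counit = hom_of complex_alg (\<lambda>k. kdelta)"
definition "K = quot Comult Counit"

lemma K_alg: "unital_algebra K"
  unfolding K_def by (rule quot_algebra)

sublocale KK: algebra_pair K K
  by (rule algebra_pair.intro[OF K_alg K_alg])

lemma KK_alg: "unital_algebra KK.T" by (rule KK.unital_algebra_T)

sublocale K3: algebra_pair K KK.T
  by (rule algebra_pair.intro[OF K_alg KK_alg])

lemma ctensor_quot0: "ctensor quot0 quot0 = KK.T" "ctens quot0 quot0 = ctens K K"
  by (simp_all add: quot0_def K_def quot_def ctensor_def ctens_def pure_tensor_def[abs_def] tensor_group_def
      tensor_subgroup_def tensor_relators_def Let_def)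

lemma gen_closed: "gen k i j \<in> carrier K"
  by (simp add: K_def quot_simps gen_def rangeI)

lemma gen_rel:
  "gen k i 0 \<otimes>\<^bsub>K\<^esub> gen (Suc k) j 0 \<oplus>\<^bsub>K\<^esub> gen k i 1 \<otimes>\<^bsub>K\<^esub> gen (Suc k) j 1 = kdelta i j \<odot>\<^bsub>K\<^esub> \<one>\<^bsub>K\<^esub>"
  "gen (Suc k) 0 i \<otimes>\<^bsub>K\<^esub> gen k 0 j \<oplus>\<^bsub>K\<^esub> gen (Suc k) 1 i \<otimes>\<^bsub>K\<^esub> gen k 1 j = kdelta i j \<odot>\<^bsub>K\<^esub> \<one>\<^bsub>K\<^esub>"
  by (simp_all add: K_def gen_def quot_simps q_eq_iff rel_left rel_right)

lemma Comult_gen_eq: "Comult_gen k i j = KK.tens (gen k i 0) (gen k 0 j) \<oplus>\<^bsub>KK.T\<^esub> KK.tens (gen k i 1) (gen k 1 j)"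
  by (simp add: Comult_gen_def ctensor_quot0)

lemma tens_scalar: "KK.tens (c \<odot>\<^bsub>K\<^esub> \<one>\<^bsub>K\<^esub>) (d \<odot>\<^bsub>K\<^esub> \<one>\<^bsub>K\<^esub>) = (c * d) \<odot>\<^bsub>KK.T\<^esub> \<one>\<^bsub>KK.T\<^esub>"
  by (simp add: KK.one_T KK.smult_tens cmodule_simps[OF KK.V] flip: KK.tens_smult_swap)
     (simp add: mult.commute flip: cmodule_simps(4)[OF KK.V])

text \<open>Put X = x_k \<otimes> 1 and Y = 1 \<otimes> x_k, with transposed inverses X' and Y'. The
  matrix of comultiplications is X Y. Entries of X commute with those of Y, so transposition
  reverses products of such matrices and X Y has the transposed inverse X' Y', the matrix belonging
  to x_(k+1).\<close>

lemma Comult_gen_contragredient: "contragredient_seq KK.T Comult_gen"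
proof -
  have mc: "gen k i j \<otimes>\<^bsub>K\<^esub> gen k' i' j' \<in> carrier K" for k i j k' i' j'
    by (rule KK.VR.m_closed[OF gen_closed gen_closed])
  note tc = KK.tens_closed[OF mc mc]
  note cl = KK.tens_closed[OF gen_closed gen_closed]
  let ?D = "\<lambda>p. p \<odot>\<^bsub>K\<^esub> \<one>\<^bsub>K\<^esub>"
  have expand: "Comult_gen k i j \<otimes>\<^bsub>KK.T\<^esub> Comult_gen k' i' j' =
     KK.tens (gen k i 0 \<otimes>\<^bsub>K\<^esub> gen k' i' 0) (gen k 0 j \<otimes>\<^bsub>K\<^esub> gen k' 0 j') \<oplus>\<^bsub>KK.T\<^esub>
     KK.tens (gen k i 0 \<otimes>\<^bsub>K\<^esub> gen k' i' 1) (gen k 0 j \<otimes>\<^bsub>K\<^esub> gen k' 1 j') \<oplus>\<^bsub>KK.T\<^esub>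
     (KK.tens (gen k i 1 \<otimes>\<^bsub>K\<^esub> gen k' i' 0) (gen k 1 j \<otimes>\<^bsub>K\<^esub> gen k' 0 j') \<oplus>\<^bsub>KK.T\<^esub>
     KK.tens (gen k i 1 \<otimes>\<^bsub>K\<^esub> gen k' i' 1) (gen k 1 j \<otimes>\<^bsub>K\<^esub> gen k' 1 j'))" for k i j k' i' j'
    using cl by (simp add: Comult_gen_eq K3.WR.l_distr K3.WR.r_distr KK.mult_tens gen_closed K3.td.M.a_ac tc)
  \<comment> \<open>Brings together the terms of the two products that agree in one tensor factor.
    The other factor is then the left side of a relation of K: the second one in
    \<open>left\<close>, the first one in \<open>right\<close>.\<close>
  have regroup: "a \<oplus>\<^bsub>KK.T\<^esub> b \<oplus>\<^bsub>KK.T\<^esub> (c \<oplus>\<^bsub>KK.T\<^esub> d) \<oplus>\<^bsub>KK.T\<^esub> (a' \<oplus>\<^bsub>KK.T\<^esub> b' \<oplus>\<^bsub>KK.T\<^esub> (c' \<oplus>\<^bsub>KK.T\<^esub> d')) =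
      (a \<oplus>\<^bsub>KK.T\<^esub> a') \<oplus>\<^bsub>KK.T\<^esub> (b \<oplus>\<^bsub>KK.T\<^esub> b') \<oplus>\<^bsub>KK.T\<^esub> ((c \<oplus>\<^bsub>KK.T\<^esub> c') \<oplus>\<^bsub>KK.T\<^esub> (d \<oplus>\<^bsub>KK.T\<^esub> d'))"
    if "a \<in> carrier KK.T" "b \<in> carrier KK.T" "c \<in> carrier KK.T" "d \<in> carrier KK.T"
      "a' \<in> carrier KK.T" "b' \<in> carrier KK.T" "c' \<in> carrier KK.T" "d' \<in> carrier KK.T" for a b c d a' b' c' d'
    using that by (simp add: K3.td.M.a_ac)
  have sc: "?D c \<in> carrier K" for c by (rule cmodule_simps(1)[OF KK.V KK.VR.one_closed])
  have s0: "0 \<odot>\<^bsub>K\<^esub> \<one>\<^bsub>K\<^esub> = \<zero>\<^bsub>K\<^esub>" by (rule cmodule_zero_smult[OF KK.V KK.VR.one_closed])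
  have z: "KK.tens x \<zero>\<^bsub>K\<^esub> = \<zero>\<^bsub>KK.T\<^esub>" "KK.tens \<zero>\<^bsub>K\<^esub> x = \<zero>\<^bsub>KK.T\<^esub>" if "x \<in> carrier K" for x
    using additive_map_zero[OF KK.td.B.abelian_group_axioms KK.abelian_T, of "KK.tens x"]
      additive_map_zero[OF KK.td.B.abelian_group_axioms KK.abelian_T, of "\<lambda>y. KK.tens y x"]
      KK.tens_balanced that by (auto simp: balanced_def)
  have s1: "1 \<odot>\<^bsub>K\<^esub> \<one>\<^bsub>K\<^esub> = \<one>\<^bsub>K\<^esub>" by (rule cmodule_simps(5)[OF KK.V KK.VR.one_closed])
  have left: "Comult_gen k i 0 \<otimes>\<^bsub>KK.T\<^esub> Comult_gen (Suc k) j 0 \<oplus>\<^bsub>KK.T\<^esub> Comult_gen k i 1 \<otimes>\<^bsub>KK.T\<^esub> Comult_gen (Suc k) j 1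
      = kdelta i j \<odot>\<^bsub>KK.T\<^esub> \<one>\<^bsub>KK.T\<^esub>" for k i j
  proof -
    have "Comult_gen k i 0 \<otimes>\<^bsub>KK.T\<^esub> Comult_gen (Suc k) j 0 \<oplus>\<^bsub>KK.T\<^esub> Comult_gen k i 1 \<otimes>\<^bsub>KK.T\<^esub> Comult_gen (Suc k) j 1
     = KK.tens (gen k i 0 \<otimes>\<^bsub>K\<^esub> gen (Suc k) j 0) (?D (kdelta 0 0)) \<oplus>\<^bsub>KK.T\<^esub> KK.tens (gen k i 0 \<otimes>\<^bsub>K\<^esub> gen (Suc k) j 1) (?D (kdelta 0 1)) \<oplus>\<^bsub>KK.T\<^esub>
      (KK.tens (gen k i 1 \<otimes>\<^bsub>K\<^esub> gen (Suc k) j 0) (?D (kdelta 1 0)) \<oplus>\<^bsub>KK.T\<^esub> KK.tens (gen k i 1 \<otimes>\<^bsub>K\<^esub> gen (Suc k) j 1) (?D (kdelta 1 1)))"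
      unfolding expand by (subst regroup) (simp_all only: tc KK.tens_add_right[OF mc mc mc, symmetric] gen_rel)
    also have "\<dots> = KK.tens (gen k i 0 \<otimes>\<^bsub>K\<^esub> gen (Suc k) j 0 \<oplus>\<^bsub>K\<^esub> gen k i 1 \<otimes>\<^bsub>K\<^esub> gen (Suc k) j 1) \<one>\<^bsub>K\<^esub>"
      by (simp add: s0 s1 z mc KK.tens_add_left KK.tens_closed)
    also have "\<dots> = kdelta i j \<odot>\<^bsub>KK.T\<^esub> \<one>\<^bsub>KK.T\<^esub>"
      unfolding gen_rel using tens_scalar[of "kdelta i j" 1] by (simp add: s1)
    finally show ?thesis .
  qed
  have right: "Comult_gen (Suc k) 0 i \<otimes>\<^bsub>KK.T\<^esub> Comult_gen k 0 j \<oplus>\<^bsub>KK.T\<^esub> Comult_gen (Suc k) 1 i \<otimes>\<^bsub>KK.T\<^esub> Comult_gen k 1 j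
      = kdelta i j \<odot>\<^bsub>KK.T\<^esub> \<one>\<^bsub>KK.T\<^esub>" for k i j
  proof -
    have "Comult_gen (Suc k) 0 i \<otimes>\<^bsub>KK.T\<^esub> Comult_gen k 0 j \<oplus>\<^bsub>KK.T\<^esub> Comult_gen (Suc k) 1 i \<otimes>\<^bsub>KK.T\<^esub> Comult_gen k 1 j
     = KK.tens (?D (kdelta 0 0)) (gen (Suc k) 0 i \<otimes>\<^bsub>K\<^esub> gen k 0 j) \<oplus>\<^bsub>KK.T\<^esub> KK.tens (?D (kdelta 0 1)) (gen (Suc k) 0 i \<otimes>\<^bsub>K\<^esub> gen k 1 j) \<oplus>\<^bsub>KK.T\<^esub>
      (KK.tens (?D (kdelta 1 0)) (gen (Suc k) 1 i \<otimes>\<^bsub>K\<^esub> gen k 0 j) \<oplus>\<^bsub>KK.T\<^esub> KK.tens (?D (kdelta 1 1)) (gen (Suc k) 1 i \<otimes>\<^bsub>K\<^esub> gen k 1 j))"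
      unfolding expand by (subst regroup) (simp_all only: tc KK.tens_add_left[OF mc mc mc, symmetric] gen_rel)
    also have "\<dots> = KK.tens \<one>\<^bsub>K\<^esub> (gen (Suc k) 0 i \<otimes>\<^bsub>K\<^esub> gen k 0 j \<oplus>\<^bsub>K\<^esub> gen (Suc k) 1 i \<otimes>\<^bsub>K\<^esub> gen k 1 j)"
      by (simp add: s0 s1 z mc KK.tens_add_right KK.tens_closed)
    also have "\<dots> = kdelta i j \<odot>\<^bsub>KK.T\<^esub> \<one>\<^bsub>KK.T\<^esub>"
      unfolding gen_rel using tens_scalar[of 1 "kdelta i j"] by (simp add: s1)
    finally show ?thesis .
  qed
  have "Comult_gen k i j \<in> carrier KK.T" for k i j
    unfolding Comult_gen_eq by (intro K3.td.M.a_closed cl)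
  then show ?thesis using left right by (simp add: contragredient_seq_def)
qed

lemma complex_alg_algebra: "unital_algebra complex_alg"
  unfolding unital_algebra_def using cmodule_complex cring.axioms(1)[OF cring_complex_alg] by simp

lemma kdelta_contragredient: "contragredient_seq complex_alg (\<lambda>k. kdelta)"
proof -
  have "kdelta i 0 * kdelta j 0 + kdelta i 1 * kdelta j 1 = kdelta i j"
    "kdelta 0 i * kdelta 0 j + kdelta 1 i * kdelta 1 j = kdelta i j" for i j
    using exhaust_01[of i] exhaust_01[of j] by auto
  then show ?thesis by (simp add: contragredient_seq_def)
qed

lemma comult_K: "comult K = Comult" and counit_K: "counit K = Counit"
  by (simp_all add: K_def quot_simps)

lemma K_induct [consumes 1, case_names gen one add mult smult]:
  assumes "x \<in> carrier K"
    and "\<And>k i j. P (gen k i j)" and "P \<one>\<^bsub>K\<^esub>"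
    and "\<And>x y. x \<in> carrier K \<Longrightarrow> y \<in> carrier K \<Longrightarrow> P x \<Longrightarrow> P y \<Longrightarrow> P (x \<oplus>\<^bsub>K\<^esub> y)"
    and "\<And>x y. x \<in> carrier K \<Longrightarrow> y \<in> carrier K \<Longrightarrow> P x \<Longrightarrow> P y \<Longrightarrow> P (x \<otimes>\<^bsub>K\<^esub> y)"
    and "\<And>c x. x \<in> carrier K \<Longrightarrow> P x \<Longrightarrow> P (c \<odot>\<^bsub>K\<^esub> x)"
  shows "P x"
proof -
  note assms = assms[unfolded K_def quot_simps(1)]
  have "P (q t)" for t
  proof (induction t)
    case (EGen k i j) show ?case using assms(2)[of k i j] by (simp add: gen_def)
  next
    case EOne show ?case using assms(3) by (simp add: quot_simps)
  next
    case (EAdd s t) then show ?case using assms(4)[of "q s" "q t"] by (simp add: quot_simps)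
  next
    case (EMul s t) then show ?case using assms(5)[of "q s" "q t"] by (simp add: quot_simps)
  next
    case (EScal c t) then show ?case using assms(6)[of "q t" c] by (simp add: quot_simps)
  qed
  then show ?thesis using assms(1) by auto
qed

lemma hom_of_K:
  assumes "unital_algebra B" "contragredient_seq B g"
  shows "hom_of B g \<in> ring_hom K B" "clinear K B (hom_of B g)"
  unfolding K_def
  by (rule ring_hom_memI clinearI; (rule additive_mapI)?; (auto simp: quot_simps hom_of_q[OF assms] ev_closed[OF assms])[])+

text \<open>Both coassociativity and the counit laws compare algebra homomorphisms out of
  \<open>K\<close>, so they reduce to the matrix formulas on generators.\<close>

lemma hom_ext:
  assumes f: "f \<in> ring_hom K B" "clinear K B f" and g: "g \<in> ring_hom K B" "clinear K B g"
    and "\<And>k i j. f (gen k i j) = g (gen k i j)" and "x \<in> carrier K"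
  shows "f x = g x"
  using assms(6)
  by (induction rule: K_induct)
     (simp_all add: assms(5) ring_hom_one[OF f(1)] ring_hom_one[OF g(1)] ring_hom_add[OF f(1)] ring_hom_add[OF g(1)]
       ring_hom_mult[OF f(1)] ring_hom_mult[OF g(1)] clinear_smult[OF f(2)] clinear_smult[OF g(2)])

lemma Comult_eq: "Comult = hom_of KK.T Comult_gen"
  by (simp add: Comult_def ctensor_quot0)

lemma Comult_hom: "Comult \<in> ring_hom K KK.T" "clinear K KK.T Comult" "Comult (gen k i j) = Comult_gen k i j"
  unfolding Comult_eq
  by (rule hom_of_K[OF KK_alg Comult_gen_contragredient], rule hom_of_K[OF KK_alg Comult_gen_contragredient],
      rule hom_of_gen[OF KK_alg Comult_gen_contragredient])

lemma Counit_hom: "Counit \<in> ring_hom K complex_alg" "clinear K complex_alg Counit" "Counit (gen k i j) = kdelta i j"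
  unfolding Counit_def
  by (rule hom_of_K[OF complex_alg_algebra kdelta_contragredient], rule hom_of_K[OF complex_alg_algebra kdelta_contragredient],
      rule hom_of_gen[OF complex_alg_algebra kdelta_contragredient])

sublocale aug: augmented_algebra K Counit
  by (rule augmented_algebra.intro[OF K_alg Counit_hom(1,2)])

sublocale tri: cmodule_triple K K K by (rule cmodule_triple.intro[OF KK.V KK.V KK.V])

lemma coassociative:
  assumes x: "x \<in> carrier K"
  shows "ctensor_assoc K K K (ctensor_map KK.T K Comult id (Comult x)) = ctensor_map K KK.T id Comult (Comult x)"
proof -
  note L1 = ctensor_map_ring_hom[OF K_alg K_alg KK_alg K_alg Comult_hom(2) clinear_id(1) Comult_hom(1) ring_hom_id]
    and L2 = ctensor_map_clinear[OF KK.V KK.V KK.cmodule_T KK.V Comult_hom(2) clinear_id(1)]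
    and L3 = ctensor_map_tens[OF KK.V KK.V KK.cmodule_T KK.V Comult_hom(2) clinear_id(1)]
  note R1 = ctensor_map_ring_hom[OF K_alg K_alg K_alg KK_alg clinear_id(1) Comult_hom(2) ring_hom_id Comult_hom(1)]
    and R2 = ctensor_map_clinear[OF KK.V KK.V KK.V KK.cmodule_T clinear_id(1) Comult_hom(2)]
    and R3 = ctensor_map_tens[OF KK.V KK.V KK.V KK.cmodule_T clinear_id(1) Comult_hom(2)]
  note A1 = ctensor_assoc_ring_hom[OF K_alg K_alg K_alg] and A2 = tri.ctensor_assoc_clinear
  let ?f = "\<lambda>x. ctensor_assoc K K K (ctensor_map KK.T K Comult id (Comult x))"
  let ?g = "\<lambda>x. ctensor_map K KK.T id Comult (Comult x)"
  have f: "?f \<in> ring_hom K K3.T"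
    using ring_hom_trans[OF ring_hom_trans[OF Comult_hom(1) L1] A1] by (simp add: comp_def)
  have g: "?g \<in> ring_hom K K3.T"
    using ring_hom_trans[OF Comult_hom(1) R1] by (simp add: comp_def)
  have f': "clinear K K3.T ?f" by (rule clinear_comp[OF Comult_hom(2) clinear_comp[OF L2 A2]])
  have g': "clinear K K3.T ?g" by (rule clinear_comp[OF Comult_hom(2) R2])
  interpret T3: abelian_group K3.T by (rule K3.abelian_T)
  note add = additive_map_add[OF clinear_additive[OF L2]] additive_map_add[OF clinear_additive[OF R2]]
    additive_map_add[OF clinear_additive[OF A2]]
  have "?f (gen k i j) = ?g (gen k i j)" for k i j
    by (simp add: Comult_hom(3) Comult_gen_eq add KK.tens_closed gen_closed L3 R3 tri.L.tens_closed tri.L.tens_add_left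
        abelian_groupE(1)[OF tri.L.abelian_T]
        K3.tens_closed tri.ctensor_assoc_tens K3.tens_add_right T3.a_ac)
  then show ?thesis using hom_ext[OF f f' g g'] x
    by simp
qed

lemma counital:
  assumes x: "x \<in> carrier K"
  shows "aug.E_map (Comult x) = x" "aug.E'_map (Comult x) = x"
proof -
  have E: "(\<lambda>x. aug.E_map (Comult x)) \<in> ring_hom K K" "(\<lambda>x. aug.E'_map (Comult x)) \<in> ring_hom K K" "(\<lambda>x. x) \<in> ring_hom K K"
    using ring_hom_trans[OF Comult_hom(1) aug.E_map_hom] ring_hom_trans[OF Comult_hom(1) aug.E'_map_hom]
    by (simp_all add: comp_def ring_hom_def)
  have E': "clinear K K (\<lambda>x. aug.E_map (Comult x))" "clinear K K (\<lambda>x. aug.E'_map (Comult x))" "clinear K K (\<lambda>x. x)"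
    by (rule clinear_comp[OF Comult_hom(2) aug.E_map_clinear] clinear_comp[OF Comult_hom(2) aug.E'_map_clinear] clinear_id(2))+
  note add = additive_map_add[OF clinear_additive[OF aug.E_map_clinear]] additive_map_add[OF clinear_additive[OF aug.E'_map_clinear]]
  have z: "0 \<odot>\<^bsub>K\<^esub> gen k i j = \<zero>\<^bsub>K\<^esub>" "1 \<odot>\<^bsub>K\<^esub> gen k i j = gen k i j" for k i j
    by (rule cmodule_zero_smult[OF KK.V gen_closed] cmodule_simps(5)[OF KK.V gen_closed])+
  have "aug.E_map (Comult (gen k i j)) = gen k i j" "aug.E'_map (Comult (gen k i j)) = gen k i j" for k i j
    using exhaust_01[of i] exhaust_01[of j]
    by (auto simp: Comult_hom(3) Comult_gen_eq add KK.tens_closed gen_closed aug.E_map_tens aug.E'_map_tens Counit_hom(3) z)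
  then show "aug.E_map (Comult x) = x" "aug.E'_map (Comult x) = x"
    using hom_ext[OF E(1) E'(1) E(3) E'(3)]
      hom_ext[OF E(2) E'(2) E(3) E'(3)] x
    by simp_all
qed

lemma K_bialgebra: "bialgebra K"
  unfolding bialgebra_def coalgebra_def comult_K counit_K
  using K_alg KK.V Comult_hom(1,2) Counit_hom(1,2) coassociative counital
  by (simp add: aug.E_map_def aug.E'_map_def)

end

section \<open>The antipode of K\<close>

text \<open>An antipode reverses products; as an algebra homomorphism into the opposite algebra it
  comes from the same universal property of K as the other structure maps.\<close>

definition opposite_algebra :: "(complex, 'a, 'x) module_scheme \<Rightarrow> (complex, 'a) module"
  where "opposite_algebra A = \<lparr>carrier = carrier A, mult = (\<lambda>x y. y \<otimes>\<^bsub>A\<^esub> x), one = \<one>\<^bsub>A\<^esub>,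
    ring.zero = \<zero>\<^bsub>A\<^esub>, add = add A, smult = smult A\<rparr>"

lemma opposite_algebra_simps:
  "carrier (opposite_algebra A) = carrier A" "x \<otimes>\<^bsub>opposite_algebra A\<^esub> y = y \<otimes>\<^bsub>A\<^esub> x"
  "\<one>\<^bsub>opposite_algebra A\<^esub> = \<one>\<^bsub>A\<^esub>" "\<zero>\<^bsub>opposite_algebra A\<^esub> = \<zero>\<^bsub>A\<^esub>" "add (opposite_algebra A) = add A"
  "smult (opposite_algebra A) = smult A"
  by (simp_all add: opposite_algebra_def)

lemma unital_opposite:
  assumes A: "unital_algebra A" shows "unital_algebra (opposite_algebra A)"
proof -
  interpret A: ring A by (rule unital_algebraD(2)[OF A])
  have ag: "abelian_group (opposite_algebra A)"
    by (rule same_group_abelian[OF _ A.is_abelian_group]) (simp add: same_group_def opposite_algebra_simps)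
  show ?thesis
    unfolding unital_algebra_def
  proof (intro conjI)
    show "cmodule (opposite_algebra A)"
      by (rule cmoduleI[OF ag]) (simp_all add: opposite_algebra_simps cmodule_simps[OF unital_algebraD(1)[OF A]])
    show "ring (opposite_algebra A)"
    proof (rule ringI[OF ag])
      show "monoid (opposite_algebra A)"
        by (rule monoidI) (simp_all add: opposite_algebra_simps A.m_assoc)
    qed (simp_all add: opposite_algebra_simps A.l_distr A.r_distr)
  qed (simp_all add: opposite_algebra_simps unital_algebraD(3,4)[OF A])
qed

context encoded_exprs
begin

definition "S = hom_of (opposite_algebra K) (\<lambda>k i j. gen (Suc k) j i)"

text \<open>Transposing the matrices and reversing the factors interchanges the two families of
  relations: each relation required of x_(k+1)^t in the opposite algebra is the other one for
  x_(k+1) in K.\<close>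

lemma S_contragredient: "contragredient_seq (opposite_algebra K) (\<lambda>k i j. gen (Suc k) j i)"
  unfolding contragredient_seq_def opposite_algebra_simps
  by (simp add: gen_closed gen_rel kdelta_def eq_commute)

lemma S_hom: "S \<in> ring_hom K (opposite_algebra K)" "clinear K (opposite_algebra K) S" "S (gen k i j) = gen (Suc k) j i"
  unfolding S_def
  by (rule hom_of_K[OF unital_opposite[OF K_alg] S_contragredient], rule hom_of_K[OF unital_opposite[OF K_alg] S_contragredient],
      rule hom_of_gen[OF unital_opposite[OF K_alg] S_contragredient])

lemma S_clinear: "clinear K K S"
  using S_hom(2) by (simp add: lmod_hom_def opposite_algebra_simps)

lemma S_closed: "x \<in> carrier K \<Longrightarrow> S x \<in> carrier K"
  and S_mult: "x \<in> carrier K \<Longrightarrow> y \<in> carrier K \<Longrightarrow> S (x \<otimes>\<^bsub>K\<^esub> y) = S y \<otimes>\<^bsub>K\<^esub> S x"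
  and S_one: "S \<one>\<^bsub>K\<^esub> = \<one>\<^bsub>K\<^esub>"
  using ring_hom_closed[OF S_hom(1)] ring_hom_mult[OF S_hom(1)] ring_hom_one[OF S_hom(1)]
  by (simp_all add: opposite_algebra_simps)

definition "convL = tensor_lift K (\<lambda>x y. S x \<otimes>\<^bsub>K\<^esub> y)"
definition "convR = tensor_lift K (\<lambda>x y. x \<otimes>\<^bsub>K\<^esub> S y)"

lemma conv_bilinear: "cbilinear K K K (\<lambda>x y. S x \<otimes>\<^bsub>K\<^esub> y)" "cbilinear K K K (\<lambda>x y. x \<otimes>\<^bsub>K\<^esub> S y)"
  by (intro cbilinearI clinearI additive_mapI;
      simp add: S_closed KK.VR.l_distr KK.VR.r_distr additive_map_add[OF clinear_additive[OF S_clinear]]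
        clinear_smult[OF S_clinear] unital_algebraD(3,4)[OF K_alg])+

lemma conv_clinear: "clinear KK.T K convL" "clinear KK.T K convR"
  unfolding convL_def convR_def
  by (rule KK.lift_clinear[OF KK.V conv_bilinear(1)], rule KK.lift_clinear[OF KK.V conv_bilinear(2)])

lemma conv_tens:
  assumes "x \<in> carrier K" "y \<in> carrier K"
  shows "convL (KK.tens x y) = S x \<otimes>\<^bsub>K\<^esub> y" "convR (KK.tens x y) = x \<otimes>\<^bsub>K\<^esub> S y"
  unfolding convL_def convR_def
  by (rule KK.lift_tens[OF KK.td.B.abelian_group_axioms cbilinear_balanced[OF conv_bilinear(1)] assms],
      rule KK.lift_tens[OF KK.td.B.abelian_group_axioms cbilinear_balanced[OF conv_bilinear(2)] assms])

lemmas conv_additive = clinear_additive[OF conv_clinear(1)] clinear_additive[OF conv_clinear(2)]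

lemma mult_additive_K: "z \<in> carrier K \<Longrightarrow> additive_map K K (\<lambda>x. x \<otimes>\<^bsub>K\<^esub> z)" "z \<in> carrier K \<Longrightarrow> additive_map K K ((\<otimes>\<^bsub>K\<^esub>) z)"
  by (auto intro!: additive_mapI simp: KK.VR.l_distr KK.VR.r_distr)

lemma smult_additive_K: "additive_map K K ((\<odot>\<^bsub>K\<^esub>) c)"
  by (rule additive_mapI) (simp_all add: cmodule_simps[OF KK.V])

text \<open>Since \<open>S\<close> reverses products, S(x u) y v = S(u) (S(x) y) v, and the
  contribution of \<open>X\<close> ends up in the middle. If it is a scalar it can be moved out,
  which is how \<open>convL_mult\<close> passes the antipode law from two elements to their product.
  For \<open>convR\<close> the right factor ends up in the middle.\<close>

lemma convL_mult_tens:
  assumes X: "X \<in> carrier KK.T" and uv: "u \<in> carrier K" "v \<in> carrier K"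
  shows "convL (X \<otimes>\<^bsub>KK.T\<^esub> KK.tens u v) = S u \<otimes>\<^bsub>K\<^esub> (convL X \<otimes>\<^bsub>K\<^esub> v)"
  by (rule KK.T_ext[OF additive_map_comp[OF KK.mult_additive_left[OF KK.tens_closed[OF uv]] conv_additive(1)]
        additive_map_comp[OF additive_map_comp[OF conv_additive(1) mult_additive_K(1)[OF uv(2)]] mult_additive_K(2)[OF S_closed[OF uv(1)]]] _ X])
     (use uv in \<open>simp add: KK.mult_tens conv_tens S_mult S_closed KK.VR.m_assoc\<close>)

lemma convR_tens_mult:
  assumes Y: "Y \<in> carrier KK.T" and uv: "u \<in> carrier K" "v \<in> carrier K"
  shows "convR (KK.tens u v \<otimes>\<^bsub>KK.T\<^esub> Y) = u \<otimes>\<^bsub>K\<^esub> (convR Y \<otimes>\<^bsub>K\<^esub> S v)"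
  by (rule KK.T_ext[OF additive_map_comp[OF KK.mult_additive_right[OF KK.tens_closed[OF uv]] conv_additive(2)]
        additive_map_comp[OF additive_map_comp[OF conv_additive(2) mult_additive_K(1)[OF S_closed[OF uv(2)]]] mult_additive_K(2)[OF uv(1)]] _ Y])
     (use uv in \<open>simp add: KK.mult_tens conv_tens S_mult S_closed KK.VR.m_assoc\<close>)

lemma convL_mult:
  assumes X: "X \<in> carrier KK.T" and Y: "Y \<in> carrier KK.T" and c: "convL X = c \<odot>\<^bsub>K\<^esub> \<one>\<^bsub>K\<^esub>"
  shows "convL (X \<otimes>\<^bsub>KK.T\<^esub> Y) = c \<odot>\<^bsub>K\<^esub> convL Y"
  by (rule KK.T_ext[OF additive_map_comp[OF KK.mult_additive_right[OF X] conv_additive(1)]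
        additive_map_comp[OF conv_additive(1) smult_additive_K] _ Y])
     (simp add: convL_mult_tens[OF X] c conv_tens S_closed unital_algebraD(3,4)[OF K_alg])

lemma convR_mult:
  assumes X: "X \<in> carrier KK.T" and Y: "Y \<in> carrier KK.T" and c: "convR Y = c \<odot>\<^bsub>K\<^esub> \<one>\<^bsub>K\<^esub>"
  shows "convR (X \<otimes>\<^bsub>KK.T\<^esub> Y) = c \<odot>\<^bsub>K\<^esub> convR X"
  by (rule KK.T_ext[OF additive_map_comp[OF KK.mult_additive_left[OF Y] conv_additive(2)]
        additive_map_comp[OF conv_additive(2) smult_additive_K] _ X])
     (simp add: convR_tens_mult[OF Y] c conv_tens S_closed unital_algebraD(3,4)[OF K_alg])

lemma antipode:
  assumes "x \<in> carrier K"
  shows "convL (Comult x) = Counit x \<odot>\<^bsub>K\<^esub> \<one>\<^bsub>K\<^esub> \<and> convR (Comult x) = Counit x \<odot>\<^bsub>K\<^esub> \<one>\<^bsub>K\<^esub>"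
  using assms
proof (induction rule: K_induct)
  case (gen k i j)
  show ?case
    by (simp add: Comult_hom(3) Comult_gen_eq additive_map_add[OF conv_additive(1)] additive_map_add[OF conv_additive(2)]
        KK.tens_closed gen_closed conv_tens S_hom(3) gen_rel Counit_hom(3))
next
  case one
  show ?case
    by (simp add: ring_hom_one[OF Comult_hom(1)] KK.one_T conv_tens S_one aug.counit_one cmodule_simps(5)[OF KK.V])
next
  case (add x y)
  then show ?case
    by (simp add: ring_hom_add[OF Comult_hom(1)] additive_map_add[OF conv_additive(1)] additive_map_add[OF conv_additive(2)]
        ring_hom_closed[OF Comult_hom(1)] aug.counit_add cmodule_simps(2)[OF KK.V])
next
  case (mult x y)
  note c = ring_hom_closed[OF Comult_hom(1) mult(1)] ring_hom_closed[OF Comult_hom(1) mult(2)]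
  show ?case
    using mult convL_mult[OF c, of "Counit x"] convR_mult[OF c, of "Counit y"]
    by (simp add: ring_hom_mult[OF Comult_hom(1)] aug.counit_mult cmodule_simps(4)[OF KK.V KK.VR.one_closed, symmetric] mult.commute)
next
  case (smult c x)
  then show ?case
    by (simp add: clinear_smult[OF Comult_hom(2)] clinear_smult[OF conv_clinear(1)] clinear_smult[OF conv_clinear(2)]
        ring_hom_closed[OF Comult_hom(1)] aug.counit_smult cmodule_simps(4)[OF KK.V])
qed

lemma K_hopf: "hopf_algebra K"
  unfolding hopf_algebra_def is_antipode_def comult_K counit_K
  using K_bialgebra S_clinear antipode unfolding convL_def convR_def by blast

end


section \<open>A representation on two-sided sequences\<close>

type_synonym seq = "int \<Rightarrow> complex"

definition seq_linear :: "(seq \<Rightarrow> seq) \<Rightarrow> bool"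
  where "seq_linear f \<longleftrightarrow> (\<forall>u v. f (\<lambda>n. u n + v n) = (\<lambda>n. f u n + f v n)) \<and> (\<forall>c u. f (\<lambda>n. c * u n) = (\<lambda>n. c * f u n))"

definition seq_endo :: "(complex, seq \<Rightarrow> seq) module"
  where "seq_endo = \<lparr>carrier = Collect seq_linear, mult = (\<lambda>f g u. f (g u)), one = (\<lambda>u. u),
    ring.zero = (\<lambda>u n. 0), add = (\<lambda>f g u n. f u n + g u n), smult = (\<lambda>c f u n. c * f u n)\<rparr>"

lemma seq_endo_simps [simp]:
  "carrier seq_endo = Collect seq_linear" "mult seq_endo = (\<lambda>f g u. f (g u))" "\<one>\<^bsub>seq_endo\<^esub> = (\<lambda>u. u)"
  "\<zero>\<^bsub>seq_endo\<^esub> = (\<lambda>u n. 0)" "add seq_endo = (\<lambda>f g u n. f u n + g u n)" "smult seq_endo = (\<lambda>c f u n. c * f u n)"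
  by (simp_all add: seq_endo_def)

lemma unital_seq_endo: "unital_algebra seq_endo"
proof -
  have neg: "seq_linear (\<lambda>u n. - f u n)" if "seq_linear f" for f
    using that by (simp add: seq_linear_def)
  have ag: "abelian_group seq_endo"
  proof (rule abelian_groupI)
    show "\<exists>g\<in>carrier seq_endo. g \<oplus>\<^bsub>seq_endo\<^esub> f = \<zero>\<^bsub>seq_endo\<^esub>" if "f \<in> carrier seq_endo" for f
      using neg that by (intro bexI[of _ "\<lambda>u n. - f u n"]) simp_all
  qed (auto simp: seq_linear_def algebra_simps)
  show ?thesis
    unfolding unital_algebra_def
  proof (intro conjI)
    show "cmodule seq_endo"
      by (rule cmoduleI[OF ag]) (auto simp: seq_linear_def algebra_simps)
    show "ring seq_endo"
    proof (rule ringI[OF ag])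
      show "monoid seq_endo" by (rule monoidI) (auto simp: seq_linear_def)
    qed (auto simp: seq_linear_def)
  qed (auto simp: seq_linear_def)
qed

text \<open>
  The entries of the \<open>k\<close>-th matrix are monomials in multiplication by \<open>2\<^sup>n\<close> and the shift, with
  coefficients \<open>(A, B, C, D)\<close>. Inverting and transposing acts on the coefficients by the
  recursion below. The invariant \<open>A B = 2 \<cdot> 4\<^sup>k C D\<close> keeps the determinant \<open>A B - C D / 2\<close> away from 0
  for all \<open>k \<ge> 0\<close>, whereas it would vanish for \<open>k = -1\<close>.
\<close>

fun coeffs :: "nat \<Rightarrow> complex \<times> complex \<times> complex \<times> complex"
  where
    "coeffs 0 = (2, 1, 1, 1)"
  | "coeffs (Suc k) = (case coeffs k of (a, b, c, d) \<Rightarrow>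
      (let e = a * b - c * d / 2 in (b / e, a / e, - (d / (2 * e)), - (c / (2 * e)))))"

lemma coeffs_invariant:
  "coeffs k = (a, b, c, d) \<Longrightarrow> a * b = 2 * 4 ^ k * (c * d) \<and> c * d \<noteq> 0"
proof (induction k arbitrary: a b c d)
  case (Suc k)
  obtain a' b' c' d' where p: "coeffs k = (a', b', c', d')" by (metis prod.exhaust)
  note IH = Suc.IH[OF p]
  define e where "e = a' * b' - c' * d' / 2"
  have e0: "e \<noteq> 0"
  proof
    assume "e = 0"
    \<comment> \<open>By the invariant, \<open>e = 0\<close> would force 4^(k+1) = 1.\<close>
    then have "2 * (2 * 4 ^ k) * (c' * d') = c' * d'" using IH by (simp add: e_def field_simps)
    then have "(4 * 4 ^ k :: complex) = 1" using IH by simp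
    then have "(4::complex) ^ Suc k = of_nat 1" by simp
    then have "of_nat (4 ^ Suc k) = (of_nat 1 :: complex)" by simp
    then have "(4::nat) ^ Suc k = 1" using of_nat_eq_iff by blast
    then show False by simp
  qed
  have eqs: "a = b' / e" "b = a' / e" "c = - (d' / (2 * e))" "d = - (c' / (2 * e))"
    using Suc.prems p by (simp_all add: e_def Let_def)
  have ab: "a * b = (a' * b') / e ^ 2" and cd: "c * d = (c' * d') / (4 * e ^ 2)"
    by (simp_all add: eqs power2_eq_square)
  show ?case using IH e0 unfolding ab cd by (simp add: field_simps)
qed simp

definition "cA k = fst (coeffs k)"
definition "cB k = fst (snd (coeffs k))"
definition "cC k = fst (snd (snd (coeffs k)))"
definition "cD k = snd (snd (snd (coeffs k)))"
definition "cE k = cA k * cB k - cC k * cD k / 2"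

lemma cE_nonzero: "cE k \<noteq> 0"
proof
  assume *: "cE k = 0"
  obtain a b c d where p: "coeffs k = (a, b, c, d)" by (metis prod.exhaust)
  have "4 * 4 ^ k * (c * d) = c * d"
    using * coeffs_invariant[OF p] by (simp add: cE_def cA_def cB_def cC_def cD_def p field_simps)
  then have "(4 * 4 ^ k :: complex) = 1" using coeffs_invariant[OF p] by simp
  then have "of_nat (4 ^ Suc k) = (of_nat 1 :: complex)" by simp
  then have "(4::nat) ^ Suc k = 1" using of_nat_eq_iff by blast
  then show False by simp
qed

lemma coeffs_Suc: "cA (Suc k) = cB k / cE k" "cB (Suc k) = cA k / cE k"
  "cC (Suc k) = - (cD k / (2 * cE k))" "cD (Suc k) = - (cC k / (2 * cE k))"
  by (simp_all add: cA_def cB_def cC_def cD_def cE_def Let_def split: prod.split)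

text \<open>The transposed inverse of a matrix of the chosen shape has the same shape with weight
  and shift replaced by their inverses; this sign keeps track of the alternation.\<close>

definition sgn_k :: "nat \<Rightarrow> int" where "sgn_k k = (if even k then 1 else - 1)"

definition weight :: "nat \<Rightarrow> int \<Rightarrow> complex" where "weight k n = 2 powi (sgn_k k * n)"

lemma sgn_k_Suc: "sgn_k (Suc k) = - sgn_k k"
  by (simp add: sgn_k_def)

text \<open>The first two equations say that shift and weight commute up to a factor 2. This factor
  is the source of the 1/2 in the determinant and in the recursion for the coefficients.\<close>

lemma weight_simps: "weight k (n + sgn_k k) = 2 * weight k n" "weight k (n - sgn_k k) = weight k n / 2"
  "weight (Suc k) n = inverse (weight k n)" "weight k n \<noteq> 0"
proof -
  have s: "sgn_k k * sgn_k k = 1" by (simp add: sgn_k_def)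
  show "weight k (n + sgn_k k) = 2 * weight k n" "weight k (n - sgn_k k) = weight k n / 2"
    by (simp_all add: weight_def distrib_left right_diff_distrib s power_int_add power_int_diff)
  show "weight (Suc k) n = inverse (weight k n)" "weight k n \<noteq> 0"
    by (simp_all add: weight_def sgn_k_Suc power_int_minus)
qed

text \<open>With w the weight and T the shift, the rows are (A w^-1, C T) and (D T^-1, B w). In the
  relations, each entry of a matrix product adds two multiples of one monomial in w and T, and what
  remains are equations between the scalar coefficients.\<close>

definition rep_gen :: "nat \<Rightarrow> 2 \<Rightarrow> 2 \<Rightarrow> seq \<Rightarrow> seq"
  where "rep_gen k i j u = (\<lambda>n.
    if i = 0 then if j = 0 then cA k * inverse (weight k n) * u n else cC k * u (n + sgn_k k)
    else if j = 0 then cD k * u (n - sgn_k k) else cB k * weight k n * u n)"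

lemma rep_gen_contragredient: "contragredient_seq seq_endo rep_gen"
proof -
  \<comment> \<open>The definition of \<open>cE\<close> cleared of denominators and multiplied by a
    free factor, to match the equations that \<open>field_simps\<close> leaves on the
    diagonal.\<close>
  have e: "cA k * cB k * y * 2 = cC k * cD k * y + cE k * y * 2" for k y by (simp add: cE_def algebra_simps)
  have "seq_linear (rep_gen k i j)" for k i j
    by (auto simp: seq_linear_def rep_gen_def algebra_simps fun_eq_iff)
  moreover have "rep_gen k i 0 (rep_gen (Suc k) j 0 u) n + rep_gen k i 1 (rep_gen (Suc k) j 1 u) n = kdelta i j * u n" for k i j u n
    using exhaust_01[of i] exhaust_01[of j] cE_nonzero[of k] weight_simps(4)[of k n] e[of k "u n"] e[of k "u n * weight k n"]
    by (auto simp: rep_gen_def coeffs_Suc sgn_k_Suc weight_simps field_simps)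
  moreover have "rep_gen (Suc k) 0 i (rep_gen k 0 j u) n + rep_gen (Suc k) 1 i (rep_gen k 1 j u) n = kdelta i j * u n" for k i j u n
    using exhaust_01[of i] exhaust_01[of j] cE_nonzero[of k] weight_simps(4)[of k n] e[of k "u n"] e[of k "u n * weight k n"]
    by (auto simp: rep_gen_def coeffs_Suc sgn_k_Suc weight_simps field_simps)
  ultimately show ?thesis by (simp add: contragredient_seq_def fun_eq_iff)
qed

text \<open>The vector (v0, v1) is annihilated by x_0^t. With the initial coefficients (2, 1, 1, 1)
  both rows of x_0^t v = 0 say v0 (n + 1) = - 2^n v1 n, so v1 may be chosen at will. Unit mass at 0
  gives v0 = -1 at 1.\<close>

lemma rep_gen_kernel:
  defines "v0 \<equiv> (\<lambda>n. if n = 1 then - 1 else 0)" and "v1 \<equiv> (\<lambda>n. if n = 0 then 1 else 0)"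
  shows "rep_gen 0 0 0 v0 n + rep_gen 0 1 0 v1 n = 0" "rep_gen 0 0 1 v0 n + rep_gen 0 1 1 v1 n = 0"
  by (simp_all add: rep_gen_def v0_def v1_def cA_def cB_def cC_def cD_def weight_def sgn_k_def)

section \<open>The coalgebra dual to the matrix algebra\<close>

definition sum4 :: "('a, 'x) ring_scheme \<Rightarrow> (2 \<Rightarrow> 2 \<Rightarrow> 'a) \<Rightarrow> 'a"
  where "sum4 G f = (f 0 0 \<oplus>\<^bsub>G\<^esub> f 0 1) \<oplus>\<^bsub>G\<^esub> (f 1 0 \<oplus>\<^bsub>G\<^esub> f 1 1)"

lemma sum4_closed: "abelian_group G \<Longrightarrow> (\<And>i j. f i j \<in> carrier G) \<Longrightarrow> sum4 G f \<in> carrier G"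
  by (simp add: sum4_def abelian_groupE(1))

lemma additive_sum4:
  assumes "abelian_group G" "additive_map G L h" "\<And>i j. f i j \<in> carrier G"
  shows "h (sum4 G f) = sum4 L (\<lambda>i j. h (f i j))"
  using assms by (simp add: sum4_def additive_map_add[OF assms(2)] abelian_groupE(1))

lemma additive_map_sum4:
  "abelian_group L \<Longrightarrow> (\<And>i j. additive_map G L (f i j)) \<Longrightarrow> additive_map G L (\<lambda>x. sum4 L (\<lambda>i j. f i j x))"
  unfolding sum4_def by (intro additive_map_plus)

lemma sum4_smult:
  assumes "cmodule V" "\<And>i j. f i j \<in> carrier V"
  shows "c \<odot>\<^bsub>V\<^esub> sum4 V f = sum4 V (\<lambda>i j. c \<odot>\<^bsub>V\<^esub> f i j)"
  by (rule additive_sum4[OF cmodule_abelian[OF assms(1)]])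
     (auto intro!: additive_mapI simp: assms cmodule_simps[OF assms(1)])

abbreviation "MD \<equiv> matrix_dual"

definition matrix_linear :: "(complex^2^2 \<Rightarrow> complex) \<Rightarrow> bool"
  where "matrix_linear f \<longleftrightarrow> (\<forall>X Y. f (X + Y) = f X + f Y) \<and> (\<forall>c X. f (\<chi> i j. c * X $ i $ j) = c * f X)"

lemma matrix_dual_simps [simp]:
  "carrier MD = Collect matrix_linear" "\<zero>\<^bsub>MD\<^esub> = (\<lambda>X. 0)" "add MD = (\<lambda>f g X. f X + g X)"
  "smult MD = (\<lambda>c f X. c * f X)"
proof -
  have "Vector_Spaces.linear (\<lambda>c (X :: complex^2^2). \<chi> i j. c * X $ i $ j) (*) f \<longleftrightarrow> matrix_linear f" for f
  proof -
    have v: "vector_space (\<lambda>c (X :: complex^2^2). \<chi> i j. c * X $ i $ j)"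
      by unfold_locales (simp_all add: vec_eq_iff algebra_simps)
    have w: "vector_space ((*) :: complex \<Rightarrow> complex \<Rightarrow> complex)"
      by unfold_locales (simp_all add: algebra_simps)
    show ?thesis
      unfolding Vector_Spaces.linear_def module_hom_def module_hom_axioms_def matrix_linear_def
      using v w by (auto simp: module_iff_vector_space)
  qed
  then show "carrier MD = Collect matrix_linear" by (simp add: matrix_dual_def)
qed (simp_all add: matrix_dual_def)

lemma cmodule_MD: "cmodule MD"
proof (rule cmoduleI)
  show "abelian_group MD"
  proof (rule abelian_groupI)
    show "\<exists>g\<in>carrier MD. g \<oplus>\<^bsub>MD\<^esub> f = \<zero>\<^bsub>MD\<^esub>" if "f \<in> carrier MD" for f
      using that by (intro bexI[of _ "\<lambda>X. - f X"]) (auto simp: matrix_linear_def)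
  qed (auto simp: matrix_linear_def algebra_simps)
qed (auto simp: matrix_linear_def algebra_simps)

interpretation MM: cmodule_pair MD MD
  by (rule cmodule_pairI[OF cmodule_MD cmodule_MD])

definition matrix_unit :: "2 \<Rightarrow> 2 \<Rightarrow> complex^2^2"
  where "matrix_unit i j = (\<chi> p q. if p = i \<and> q = j then 1 else 0)"

lemma matrix_coord_closed: "matrix_coord i j \<in> carrier MD"
  by (simp add: matrix_linear_def matrix_coord_def)

lemma matrix_linear_expand:
  assumes "matrix_linear f"
  shows "f X = sum4 complex_alg (\<lambda>i j. f (matrix_unit i j) * X $ i $ j)"
proof -
  \<comment> \<open>Written with the scalar multiplication from the definition of
    \<open>matrix_dual\<close>, so that \<open>matrix_linear\<close> applies to it
    literally.\<close>
  have X: "X = ((\<chi> p q. X $ 0 $ 0 * matrix_unit 0 0 $ p $ q) + (\<chi> p q. X $ 0 $ 1 * matrix_unit 0 1 $ p $ q)) +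
      ((\<chi> p q. X $ 1 $ 0 * matrix_unit 1 0 $ p $ q) + (\<chi> p q. X $ 1 $ 1 * matrix_unit 1 1 $ p $ q))"
    by (simp add: vec_eq_iff all_01 matrix_unit_def)
  have "f X = (X $ 0 $ 0 * f (matrix_unit 0 0) + X $ 0 $ 1 * f (matrix_unit 0 1)) +
      (X $ 1 $ 0 * f (matrix_unit 1 0) + X $ 1 $ 1 * f (matrix_unit 1 1))"
    by (subst X) (use assms in \<open>simp add: matrix_linear_def\<close>)
  then show ?thesis by (simp add: sum4_def mult.commute)
qed

lemma matrix_dual_expand:
  assumes f: "f \<in> carrier MD"
  shows "f = sum4 MD (\<lambda>i j. f (matrix_unit i j) \<odot>\<^bsub>MD\<^esub> matrix_coord i j)"
proof
  fix X
  show "f X = sum4 MD (\<lambda>i j. f (matrix_unit i j) \<odot>\<^bsub>MD\<^esub> matrix_coord i j) X"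
    using matrix_linear_expand[of f X] f by (simp add: sum4_def matrix_coord_def)
qed

definition eval2 :: "complex^2^2 \<Rightarrow> complex^2^2 \<Rightarrow> (_ \<times> _ \<Rightarrow>\<^sub>0 int) set \<Rightarrow> complex"
  where "eval2 X Y = tensor_lift complex_alg (\<lambda>g h. g X * h Y)"

lemma eval2_bilinear: "cbilinear MD MD complex_alg (\<lambda>g h. g X * h Y)"
  by (intro cbilinearI clinearI additive_mapI) (auto simp: algebra_simps)

lemma eval2_clinear: "clinear MM.T complex_alg (eval2 X Y)"
  unfolding eval2_def by (rule MM.lift_clinear[OF cmodule_complex eval2_bilinear])

lemma eval2_tens: "g \<in> carrier MD \<Longrightarrow> h \<in> carrier MD \<Longrightarrow> eval2 X Y (MM.tens g h) = g X * h Y"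
  unfolding eval2_def
  by (rule MM.lift_tens[OF cmodule_abelian[OF cmodule_complex] cbilinear_balanced[OF eval2_bilinear]])

text \<open>Evaluation at pairs of matrix units gives the coordinates in the tensor square with
  respect to the products of coordinate functions. A tensor is thus determined by its values on
  pairs of matrices, as the description of the comultiplication in \<open>matrix_coalgebra\<close>
  presupposes.\<close>

lemma eval2_expand:
  assumes t: "t \<in> carrier MM.T"
  shows "t = sum4 MM.T (\<lambda>i j. sum4 MM.T (\<lambda>k l.
    eval2 (matrix_unit i j) (matrix_unit k l) t \<odot>\<^bsub>MM.T\<^esub> MM.tens (matrix_coord i j) (matrix_coord k l)))"
proof (rule MM.T_ext[OF additive_map_id(2) _ _ t])
  note cc = MM.tens_closed[OF matrix_coord_closed matrix_coord_closed]
  show "additive_map MM.T MM.T (\<lambda>t. sum4 MM.T (\<lambda>i j. sum4 MM.T (\<lambda>k l.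
      eval2 (matrix_unit i j) (matrix_unit k l) t \<odot>\<^bsub>MM.T\<^esub> MM.tens (matrix_coord i j) (matrix_coord k l))))"
  proof (intro additive_map_sum4 MM.abelian_T)
    fix i j k l
    show "additive_map MM.T MM.T (\<lambda>t. eval2 (matrix_unit i j) (matrix_unit k l) t \<odot>\<^bsub>MM.T\<^esub> MM.tens (matrix_coord i j) (matrix_coord k l))"
      by (rule additive_mapI)
         (simp_all add: cmodule_simps(1,2)[OF MM.cmodule_T] cc additive_map_add[OF clinear_additive[OF eval2_clinear]])
  qed
  fix g h assume gh: "g \<in> carrier MD" "h \<in> carrier MD"
  note sc = cmodule_simps(1)[OF cmodule_MD matrix_coord_closed]
  note MDa = cmodule_abelian[OF cmodule_MD]
  note tl = clinear_additive[OF cbilinearD(2)[OF MM.tens_cbilinear]] and tr = clinear_additive[OF cbilinearD(1)[OF MM.tens_cbilinear]]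
  have "MM.tens g h = MM.tens (sum4 MD (\<lambda>i j. g (matrix_unit i j) \<odot>\<^bsub>MD\<^esub> matrix_coord i j)) h"
    using matrix_dual_expand[OF gh(1)] by simp
  also have "\<dots> = sum4 MM.T (\<lambda>i j. MM.tens (g (matrix_unit i j) \<odot>\<^bsub>MD\<^esub> matrix_coord i j) h)"
    by (rule additive_sum4[OF MDa tl[OF gh(2)] sc])
  also have "\<dots> = sum4 MM.T (\<lambda>i j. sum4 MM.T (\<lambda>k l. MM.tens (g (matrix_unit i j) \<odot>\<^bsub>MD\<^esub> matrix_coord i j)
      (h (matrix_unit k l) \<odot>\<^bsub>MD\<^esub> matrix_coord k l)))"
  proof -
    have "MM.tens (g (matrix_unit i j) \<odot>\<^bsub>MD\<^esub> matrix_coord i j) h =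
      MM.tens (g (matrix_unit i j) \<odot>\<^bsub>MD\<^esub> matrix_coord i j) (sum4 MD (\<lambda>k l. h (matrix_unit k l) \<odot>\<^bsub>MD\<^esub> matrix_coord k l))" for i j
      using matrix_dual_expand[OF gh(2)] by simp
    then show ?thesis using additive_sum4[OF MDa tr[OF sc] sc] by simp
  qed
  also have "\<dots> = sum4 MM.T (\<lambda>i j. sum4 MM.T (\<lambda>k l.
    eval2 (matrix_unit i j) (matrix_unit k l) (MM.tens g h) \<odot>\<^bsub>MM.T\<^esub> MM.tens (matrix_coord i j) (matrix_coord k l)))"
  proof -
    have "MM.tens (c \<odot>\<^bsub>MD\<^esub> matrix_coord i j) (d \<odot>\<^bsub>MD\<^esub> matrix_coord k l) =
        (c * d) \<odot>\<^bsub>MM.T\<^esub> MM.tens (matrix_coord i j) (matrix_coord k l)" for c d i j k l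
      using MM.smult_tens[OF matrix_coord_closed sc, of c i j d k l] MM.smult_tens_right[OF matrix_coord_closed matrix_coord_closed, of d i j k l]
        cmodule_simps(4)[OF MM.cmodule_T cc, of c d i j k l]
      by simp
    then show ?thesis using gh by (simp only: eval2_tens)
  qed
  finally show "MM.tens g h = sum4 MM.T (\<lambda>i j. sum4 MM.T (\<lambda>k l.
    eval2 (matrix_unit i j) (matrix_unit k l) (MM.tens g h) \<odot>\<^bsub>MM.T\<^esub> MM.tens (matrix_coord i j) (matrix_coord k l)))" .
qed

lemma matrix_coalgebra_simps:
  "carrier matrix_coalgebra = carrier MD" "add matrix_coalgebra = add MD" "smult matrix_coalgebra = smult MD"
  "counit matrix_coalgebra f = f (mat 1)"
  by (simp_all add: matrix_coalgebra_def)

lemma comult_matrixI: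
  assumes t: "t \<in> carrier MM.T" "\<And>X Y. eval2 X Y t = f (X ** Y)"
  shows "comult matrix_coalgebra f = t"
proof -
  have "(THE t. t \<in> carrier (ctensor matrix_dual matrix_dual) \<and>
                 (\<forall>X Y. tensor_lift complex_alg (\<lambda>g h. g X * h Y) t = f (X ** Y))) = t"
  proof (rule the_equality)
    show "t \<in> carrier MM.T \<and> (\<forall>X Y. tensor_lift complex_alg (\<lambda>g h. g X * h Y) t = f (X ** Y))"
      using t by (simp add: eval2_def)
    fix s assume "s \<in> carrier MM.T \<and> (\<forall>X Y. tensor_lift complex_alg (\<lambda>g h. g X * h Y) s = f (X ** Y))"
    then have s: "s \<in> carrier MM.T" "\<And>X Y. eval2 X Y s = f (X ** Y)" by (simp_all add: eval2_def)
    show "s = t" by (subst eval2_expand[OF s(1)], subst eval2_expand[OF t(1)]) (simp only: s(2) t(2))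
  qed
  then show ?thesis by (simp add: matrix_coalgebra_def)
qed

definition coord_comult :: "2 \<Rightarrow> 2 \<Rightarrow> _"
  where "coord_comult i j = MM.tens (matrix_coord i 0) (matrix_coord 0 j) \<oplus>\<^bsub>MM.T\<^esub> MM.tens (matrix_coord i 1) (matrix_coord 1 j)"

lemma coord_comult_closed: "coord_comult i j \<in> carrier MM.T"
  unfolding coord_comult_def by (intro abelian_groupE(1)[OF MM.abelian_T] MM.tens_closed matrix_coord_closed)

lemma matrix_mult_01: "(X ** Y) $ i $ j = X $ i $ 0 * Y $ 0 $ j + X $ i $ 1 * Y $ 1 $ (j::2)" for X Y :: "complex^2^2"
proof -
  have U: "UNIV = {0, 1::2}" using exhaust_01 by auto
  have "(X ** Y) $ i $ j = (\<Sum>k\<in>UNIV. X $ i $ k * Y $ k $ j)" by (simp add: matrix_matrix_mult_def)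
  also have "\<dots> = X $ i $ 0 * Y $ 0 $ j + X $ i $ 1 * Y $ 1 $ j" unfolding U by simp
  finally show ?thesis .
qed

lemma eval2_coord_comult: "eval2 X Y (coord_comult i j) = (X ** Y) $ i $ j"
  unfolding coord_comult_def
  by (simp add: additive_map_add[OF clinear_additive[OF eval2_clinear]] MM.tens_closed matrix_coord_closed
      eval2_tens matrix_mult_01 del: matrix_dual_simps) (simp add: matrix_coord_def)

lemma comult_matrix_coord: "comult matrix_coalgebra (matrix_coord i j) = coord_comult i j"
  by (rule comult_matrixI[OF coord_comult_closed]) (simp add: eval2_coord_comult matrix_coord_def)

lemma comult_matrix:
  assumes f: "f \<in> carrier MD"
  shows "comult matrix_coalgebra f = sum4 MM.T (\<lambda>i j. f (matrix_unit i j) \<odot>\<^bsub>MM.T\<^esub> coord_comult i j)"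
proof (rule comult_matrixI)
  note sc = cmodule_simps(1)[OF MM.cmodule_T coord_comult_closed]
  show "sum4 MM.T (\<lambda>i j. f (matrix_unit i j) \<odot>\<^bsub>MM.T\<^esub> coord_comult i j) \<in> carrier MM.T"
    by (rule sum4_closed[OF MM.abelian_T sc])
  fix X Y
  show "eval2 X Y (sum4 MM.T (\<lambda>i j. f (matrix_unit i j) \<odot>\<^bsub>MM.T\<^esub> coord_comult i j)) = f (X ** Y)"
    using matrix_linear_expand[of f "X ** Y"] f
    by (simp add: additive_sum4[OF MM.abelian_T clinear_additive[OF eval2_clinear] sc]
        clinear_smult[OF eval2_clinear coord_comult_closed] eval2_coord_comult)
qed

text \<open>Supplies the hypotheses of \<open>comodule2\<close> for the images of the coordinate
  functions in \<open>H\<close>.\<close>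

lemma coalgebra_hom_matrix_coord:
  assumes f: "f \<in> coalgebra_hom matrix_coalgebra D" and D: "cmodule D"
  shows "f (matrix_coord i j) \<in> carrier D"
    and "comult D (f (matrix_coord i j)) = ctens D D (f (matrix_coord i 0)) (f (matrix_coord 0 j)) \<oplus>\<^bsub>ctensor D D\<^esub>
      ctens D D (f (matrix_coord i 1)) (f (matrix_coord 1 j))"
    and "counit D (f (matrix_coord i j)) = (if i = j then 1 else 0)"
proof -
  have lin: "clinear MD D f"
    using f by (auto simp: coalgebra_hom_def lmod_hom_def matrix_coalgebra_simps)
  show "f (matrix_coord i j) \<in> carrier D" by (rule lmod_hom_closed[OF lin matrix_coord_closed])
  have c: "matrix_coord i j \<in> carrier matrix_coalgebra" using matrix_coord_closed by (simp add: matrix_coalgebra_simps)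
  have "comult D (f (matrix_coord i j)) = ctensor_map D D f f (coord_comult i j)"
    using f c by (simp add: coalgebra_hom_def comult_matrix_coord)
  then show "comult D (f (matrix_coord i j)) = ctens D D (f (matrix_coord i 0)) (f (matrix_coord 0 j)) \<oplus>\<^bsub>ctensor D D\<^esub>
      ctens D D (f (matrix_coord i 1)) (f (matrix_coord 1 j))"
    unfolding coord_comult_def
      additive_map_add[OF clinear_additive[OF ctensor_map_clinear[OF cmodule_MD cmodule_MD D D lin lin]]
        MM.tens_closed[OF matrix_coord_closed matrix_coord_closed] MM.tens_closed[OF matrix_coord_closed matrix_coord_closed]]
      ctensor_map_tens[OF cmodule_MD cmodule_MD D D lin lin matrix_coord_closed matrix_coord_closed] .
  show "counit D (f (matrix_coord i j)) = (if i = j then 1 else 0)"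
    using f c by (simp add: coalgebra_hom_def matrix_coalgebra_simps) (simp add: matrix_coord_def mat_def)
qed

section \<open>The coalgebra map from the matrix coalgebra to K\<close>

context encoded_exprs
begin

text \<open>The coalgebra map to which the universal property of \<open>H\<close> will be applied.
  The values of \<open>f\<close> on matrix units are its coordinates, so this is the linear map
  taking the coordinate functions to the entries of x_0.\<close>

definition "gen_map f = sum4 K (\<lambda>i j. f (matrix_unit i j) \<odot>\<^bsub>K\<^esub> gen 0 i j)"

lemma gen_map_clinear: "clinear MD K gen_map"
proof (rule clinearI)
  note sc = cmodule_simps(1)[OF KK.V gen_closed]
  note Ka = cmodule_abelian[OF KK.V]
  show "additive_map MD K gen_map"
    unfolding gen_map_def
    by (intro additive_map_sum4 Ka additive_mapI) (simp_all add: sc cmodule_simps(2)[OF KK.V gen_closed])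
  show "gen_map (c \<odot>\<^bsub>MD\<^esub> f) = c \<odot>\<^bsub>K\<^esub> gen_map f" for c f
    unfolding gen_map_def by (simp add: sum4_smult[OF KK.V sc] cmodule_simps(4)[OF KK.V gen_closed])
qed

lemma gen_map_coord: "gen_map (matrix_coord i j) = gen 0 i j"
proof -
  have z: "0 \<odot>\<^bsub>K\<^esub> gen 0 i j = \<zero>\<^bsub>K\<^esub>" "1 \<odot>\<^bsub>K\<^esub> gen 0 i j = gen 0 i j" for i j
    by (rule cmodule_zero_smult[OF KK.V gen_closed] cmodule_simps(5)[OF KK.V gen_closed])+
  show ?thesis
    using exhaust_01[of i] exhaust_01[of j]
    by (auto simp: gen_map_def sum4_def matrix_coord_def matrix_unit_def z gen_closed)
qed

lemma gen_map_coalgebra_hom: "gen_map \<in> coalgebra_hom matrix_coalgebra K"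
  unfolding coalgebra_hom_def
proof (intro CollectI conjI ballI)
  show "clinear matrix_coalgebra K gen_map"
    using gen_map_clinear by (simp add: lmod_hom_def matrix_coalgebra_simps)
  fix f assume "f \<in> carrier matrix_coalgebra"
  then have f: "f \<in> carrier MD" by (simp add: matrix_coalgebra_simps)
  note sc = cmodule_simps(1)[OF KK.V gen_closed]
  note Ka = cmodule_abelian[OF KK.V]
  note cl = ctensor_map_clinear[OF cmodule_MD cmodule_MD KK.V KK.V gen_map_clinear gen_map_clinear]
  have coord: "ctensor_map K K gen_map gen_map (coord_comult i j) = Comult (gen 0 i j)" for i j
    unfolding coord_comult_def
      additive_map_add[OF clinear_additive[OF cl]
        MM.tens_closed[OF matrix_coord_closed matrix_coord_closed] MM.tens_closed[OF matrix_coord_closed matrix_coord_closed]]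
      ctensor_map_tens[OF cmodule_MD cmodule_MD KK.V KK.V gen_map_clinear gen_map_clinear matrix_coord_closed matrix_coord_closed]
    by (simp add: gen_map_coord Comult_hom(3) Comult_gen_eq)
  have "ctensor_map K K gen_map gen_map (comult matrix_coalgebra f) =
      sum4 KK.T (\<lambda>i j. f (matrix_unit i j) \<odot>\<^bsub>KK.T\<^esub> Comult (gen 0 i j))"
    unfolding comult_matrix[OF f]
    using additive_sum4[OF MM.abelian_T clinear_additive[OF cl] cmodule_simps(1)[OF MM.cmodule_T coord_comult_closed]]
    by (simp add: clinear_smult[OF cl coord_comult_closed] coord)
  also have "\<dots> = Comult (gen_map f)"
    unfolding gen_map_def
    using additive_sum4[OF Ka clinear_additive[OF Comult_hom(2)] sc]
    by (simp add: clinear_smult[OF Comult_hom(2) gen_closed])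
  finally show "comult K (gen_map f) = ctensor_map K K gen_map gen_map (comult matrix_coalgebra f)"
    by (simp add: comult_K)
  have "counit K (gen_map f) = sum4 complex_alg (\<lambda>i j. f (matrix_unit i j) * kdelta i j)"
    unfolding gen_map_def counit_K
    using additive_sum4[OF Ka clinear_additive[OF Counit_hom(2)] sc]
    by (simp add: clinear_smult[OF Counit_hom(2) gen_closed] Counit_hom(3))
  also have "\<dots> = f (mat 1)"
    using matrix_linear_expand[of f "mat 1"] f by (simp add: mat_def kdelta_def)
  finally show "counit K (gen_map f) = counit matrix_coalgebra f" by (simp add: matrix_coalgebra_simps)
qed

end

section \<open>Encoding of expressions\<close>

text \<open>A term becomes one sequence of complex numbers. Position 0 holds a tag for the outermost
  constructor; a binary constructor then interleaves its arguments, the first at positions 2 m + 1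
  and the second at 2 m + 2, which makes decoding possible without knowing the sizes of the
  subterms.\<close>

fun expr_seq :: "expr \<Rightarrow> nat \<Rightarrow> complex"
  where
    "expr_seq (EGen k i j) n = (if n = 0 then 0 else if n = 1 then of_nat k
      else if n = 2 then if i = 0 then 0 else 1 else if j = 0 then 0 else 1)"
  | "expr_seq EOne n = 1"
  | "expr_seq (EAdd s t) n = (if n = 0 then 2 else if odd n then expr_seq s (n div 2) else expr_seq t (n div 2 - 1))"
  | "expr_seq (EMul s t) n = (if n = 0 then 3 else if odd n then expr_seq s (n div 2) else expr_seq t (n div 2 - 1))"
  | "expr_seq (EScal c t) n = (if n = 0 then 4 else if n = 1 then c else expr_seq t (n - 2))"

lemma expr_seq_0: "expr_seq (EGen k i j) 0 = 0" "expr_seq EOne 0 = 1" "expr_seq (EAdd s t) 0 = 2"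
  "expr_seq (EMul s t) 0 = 3" "expr_seq (EScal c t) 0 = 4"
  by simp_all

lemma expr_seq_inj: "expr_seq s = expr_seq t \<Longrightarrow> s = t"
proof (induction s arbitrary: t)
  case (EGen k i j)
  then have z: "expr_seq t 0 = 0" by (metis expr_seq_0(1))
  then obtain k' i' j' where t: "t = EGen k' i' j'" by (cases t) simp_all
  have "k = k'" using fun_cong[OF EGen, of 1] by (simp add: t)
  moreover have "i = 0 \<longleftrightarrow> i' = 0" using fun_cong[OF EGen, of 2] by (simp add: t split: if_splits)
  moreover have "j = 0 \<longleftrightarrow> j' = 0" using fun_cong[OF EGen, of 3] by (simp add: t split: if_splits)
  ultimately show ?case using exhaust_01[of i] exhaust_01[of i'] exhaust_01[of j] exhaust_01[of j'] by (auto simp: t)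
next
  case EOne
  then have "expr_seq t 0 = 1" by (metis expr_seq_0(2))
  then show ?case by (cases t) simp_all
next
  case (EAdd s u)
  then have "expr_seq t 0 = 2" by (metis expr_seq_0(3))
  then obtain s' u' where t: "t = EAdd s' u'" by (cases t) simp_all
  have "expr_seq s n = expr_seq s' n" "expr_seq u n = expr_seq u' n" for n
    using fun_cong[OF EAdd.prems, of "2 * n + 1"] fun_cong[OF EAdd.prems, of "2 * n + 2"] by (simp_all add: t)
  then show ?case using EAdd.IH by (simp add: t fun_eq_iff)
next
  case (EMul s u)
  then have "expr_seq t 0 = 3" by (metis expr_seq_0(4))
  then obtain s' u' where t: "t = EMul s' u'" by (cases t) simp_all
  have "expr_seq s n = expr_seq s' n" "expr_seq u n = expr_seq u' n" for n
    using fun_cong[OF EMul.prems, of "2 * n + 1"] fun_cong[OF EMul.prems, of "2 * n + 2"] by (simp_all add: t)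
  then show ?case using EMul.IH by (simp add: t fun_eq_iff)
next
  case (EScal c s)
  then have "expr_seq t 0 = 4" by (metis expr_seq_0(5))
  then obtain c' s' where t: "t = EScal c' s'" by (cases t) simp_all
  have "c = c'" using fun_cong[OF EScal.prems, of 1] by (simp add: t)
  moreover have "expr_seq s n = expr_seq s' n" for n
    using fun_cong[OF EScal.prems, of "n + 2"] by (simp add: t)
  ultimately show ?case using EScal.IH by (simp add: t fun_eq_iff)
qed

text \<open>Real numbers are traded for sets of natural numbers by \<phi>, and countably many such
  sets are packed into one by pairing: in \<open>G z\<close> the pair (n, 2 m) records membership of
  m for the real part of z n, and (n, 2 m + 1) for the imaginary part.\<close>

lemma complex_seq_embedding: "\<exists>f :: (nat \<Rightarrow> complex) \<Rightarrow> complex. inj f"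
proof -
  obtain \<psi> :: "nat set \<Rightarrow> real" where \<psi>: "bij \<psi>"
    using nat_sets_eqpoll_reals by (auto simp: eqpoll_def)
  define \<phi> where "\<phi> = inv_into UNIV \<psi>"
  have \<phi>: "\<phi> x = \<phi> y \<longleftrightarrow> x = y" for x y
    using \<psi> bij_imp_bij_inv[of \<psi>] by (auto simp: \<phi>_def bij_def inj_eq)
  define G where "G z = (\<Union>n. (\<lambda>m. prod_encode (n, 2 * m)) ` \<phi> (Re (z n)) \<union> (\<lambda>m. prod_encode (n, 2 * m + 1)) ` \<phi> (Im (z n)))"
    for z :: "nat \<Rightarrow> complex"
  have ev: "prod_encode (n, 2 * m) \<in> G z \<longleftrightarrow> m \<in> \<phi> (Re (z n))" for n m z
    unfolding G_def by (auto simp: prod_encode_eq) presburger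
  have od: "prod_encode (n, 2 * m + 1) \<in> G z \<longleftrightarrow> m \<in> \<phi> (Im (z n))" for n m z
    unfolding G_def by (auto simp: prod_encode_eq) presburger
  have "inj (\<lambda>z. complex_of_real (\<psi> (G z)))"
  proof (rule injI)
    fix z w assume "complex_of_real (\<psi> (G z)) = complex_of_real (\<psi> (G w))"
    then have G: "G z = G w" using \<psi> by (simp add: bij_def inj_eq)
    have "\<phi> (Re (z n)) = \<phi> (Re (w n))" "\<phi> (Im (z n)) = \<phi> (Im (w n))" for n
      using ev[of n _ z] ev[of n _ w] od[of n _ z] od[of n _ w] G by blast+
    then show "z = w" unfolding \<phi> by (simp add: fun_eq_iff complex_eq_iff)
  qed
  then show ?thesis by blast
qed

lemma expr_embedding:
  assumes "\<exists>e :: complex \<Rightarrow> 'h. inj e"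
  shows "\<exists>code :: expr \<Rightarrow> 'h. inj code"
proof -
  obtain e :: "complex \<Rightarrow> 'h" where e: "inj e" using assms by blast
  obtain f :: "(nat \<Rightarrow> complex) \<Rightarrow> complex" where f: "inj f" using complex_seq_embedding by blast
  have "inj (\<lambda>t. e (f (expr_seq t)))"
    using expr_seq_inj by (auto intro!: injI dest!: injD[OF e] injD[OF f])
  then show ?thesis by blast
qed

text \<open>The counit inverts c \<mapsto> c 1. Thus the type of \<open>H\<close> has room for codes
  of all terms, and the universal property, stated only for Hopf algebras on that type, reaches
  \<open>K\<close>.\<close>

lemma (in bialgebra_data) complex_embedding: "\<exists>e :: complex \<Rightarrow> 'h. inj e"
proof (intro exI injI)
  fix c d assume "c \<odot>\<^bsub>H\<^esub> \<one>\<^bsub>H\<^esub> = d \<odot>\<^bsub>H\<^esub> \<one>\<^bsub>H\<^esub>"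
  then have "counit H (c \<odot>\<^bsub>H\<^esub> \<one>\<^bsub>H\<^esub>) = counit H (d \<odot>\<^bsub>H\<^esub> \<one>\<^bsub>H\<^esub>)" by simp
  then show "c = d" by (simp add: counit_smult counit_one)
qed

section \<open>Non-invertibility\<close>

text \<open>Composing H \<rightarrow> K with the representation of K turns the row (y0, y1) into
  operators Y with Y x_0^t = (1, 0). Applied to the kernel vector of x_0^t this gives v0 = 0, a
  contradiction.\<close>

lemma free_hopf_no_left_inverse:
  fixes H :: "'h coalg"
  assumes free: "is_free_hopf_algebra matrix_coalgebra H \<iota>"
    and y: "y0 \<in> carrier H" "y1 \<in> carrier H"
    and eqs: "y0 \<otimes>\<^bsub>H\<^esub> \<iota> (matrix_coord 0 0) \<oplus>\<^bsub>H\<^esub> y1 \<otimes>\<^bsub>H\<^esub> \<iota> (matrix_coord 0 1) = \<one>\<^bsub>H\<^esub>"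
      "y0 \<otimes>\<^bsub>H\<^esub> \<iota> (matrix_coord 1 0) \<oplus>\<^bsub>H\<^esub> y1 \<otimes>\<^bsub>H\<^esub> \<iota> (matrix_coord 1 1) = \<zero>\<^bsub>H\<^esub>"
  shows False
proof -
  have H: "bialgebra H" and \<iota>: "\<iota> \<in> coalgebra_hom matrix_coalgebra H"
    using free by (auto simp: is_free_hopf_algebra_def hopf_algebra_def)
  interpret H: bialgebra_data H by (rule bialgebra_data.intro[OF H])
  obtain code :: "expr \<Rightarrow> 'h" where "inj code" using expr_embedding[OF H.complex_embedding] by blast
  then interpret encoded_exprs code by (rule encoded_exprs.intro)
  obtain g where g: "g \<in> hopf_hom H K" "\<And>c. c \<in> carrier matrix_coalgebra \<Longrightarrow> g (\<iota> c) = gen_map c"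
    using free K_hopf gen_map_coalgebra_hom unfolding is_free_hopf_algebra_def by blast
  define r where "r = (\<lambda>x. hom_of seq_endo rep_gen (g x))"
  have r: "r \<in> ring_hom H seq_endo"
    using ring_hom_trans[of g H K "hom_of seq_endo rep_gen" seq_endo] g(1)
      hom_of_K(1)[OF unital_seq_endo rep_gen_contragredient]
    by (simp add: hopf_hom_def r_def comp_def)
  have ra: "r (\<iota> (matrix_coord i j)) = rep_gen 0 i j" for i j
    using g(2)[of "matrix_coord i j"] matrix_coord_closed[of i j]
    by (simp add: r_def gen_map_coord hom_of_gen[OF unital_seq_endo rep_gen_contragredient] matrix_coalgebra_simps)
  note ac = coalgebra_hom_matrix_coord(1)[OF \<iota> H.HA.V]
  have rexp: "r (y0 \<otimes>\<^bsub>H\<^esub> \<iota> (matrix_coord i 0) \<oplus>\<^bsub>H\<^esub> y1 \<otimes>\<^bsub>H\<^esub> \<iota> (matrix_coord i 1)) =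
      (\<lambda>u n. r y0 (rep_gen 0 i 0 u) n + r y1 (rep_gen 0 i 1 u) n)" for i
    using y ac by (simp add: ring_hom_add[OF r] ring_hom_mult[OF r] ra)
  have "r \<zero>\<^bsub>H\<^esub> = \<zero>\<^bsub>seq_endo\<^esub>"
    by (rule additive_map_zero[OF H.HA.td.B.abelian_group_axioms
          ring.is_abelian_group[OF unital_algebraD(2)[OF unital_seq_endo]]])
       (use ring_hom_closed[OF r] ring_hom_add[OF r] in \<open>simp add: additive_map_def\<close>)
  then have r0: "r y0 (rep_gen 0 1 0 u) n + r y1 (rep_gen 0 1 1 u) n = 0" for u n
    using rexp[of 1] eqs(2) by (simp add: fun_eq_iff)
  have r1: "r y0 (rep_gen 0 0 0 u) n + r y1 (rep_gen 0 0 1 u) n = u n" for u n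
    using rexp[of 0] eqs(1) ring_hom_one[OF r] by (simp add: fun_eq_iff)
  define v0 :: seq where "v0 = (\<lambda>n. if n = 1 then - 1 else 0)"
  define v1 :: seq where "v1 = (\<lambda>n. if n = 0 then 1 else 0)"
  have ker: "(\<lambda>n. rep_gen 0 0 0 v0 n + rep_gen 0 1 0 v1 n) = (\<lambda>n. 0)" "(\<lambda>n. rep_gen 0 0 1 v0 n + rep_gen 0 1 1 v1 n) = (\<lambda>n. 0)"
    unfolding v0_def v1_def by (intro ext rep_gen_kernel)+
  have lin: "seq_linear (r y)" if "y \<in> carrier H" for y
    using ring_hom_closed[OF r that] by simp
  have add: "r y (\<lambda>n. u n + v n) n = r y u n + r y v n" if "y \<in> carrier H" for y u v n
    using lin[OF that] by (simp add: seq_linear_def)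
  have zero: "r y (\<lambda>n. 0) n = 0" if "y \<in> carrier H" for y n
    using spec[OF spec[OF conjunct2[OF lin[OF that, unfolded seq_linear_def]], of 0], of "\<lambda>n. 0"] by simp
  \<comment> \<open>The first equation is evaluated at \<open>v0\<close> and the second at
    \<open>v1\<close>. Collecting the terms with \<open>r y0\<close> and those with
    \<open>r y1\<close> then produces exactly the two components of x_0^t (v0, v1), which vanish.
    Index 1 is where \<open>v0\<close> is nonzero.\<close>
  have "v0 1 = (r y0 (rep_gen 0 0 0 v0) 1 + r y1 (rep_gen 0 0 1 v0) 1) + (r y0 (rep_gen 0 1 0 v1) 1 + r y1 (rep_gen 0 1 1 v1) 1)"
    by (simp only: r0 r1 add_0_right)
  also have "\<dots> = r y0 (\<lambda>n. rep_gen 0 0 0 v0 n + rep_gen 0 1 0 v1 n) 1 + r y1 (\<lambda>n. rep_gen 0 0 1 v0 n + rep_gen 0 1 1 v1 n) 1"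
    by (simp add: add y)
  also have "\<dots> = 0" unfolding ker by (simp add: zero y)
  finally show False by (simp add: v0_def)
qed

theorem mainTheorem1:
  fixes H :: "'h coalg"
    and \<iota> :: "(complex^2^2 \<Rightarrow> complex) \<Rightarrow> 'h"
    and a :: "2 \<Rightarrow> 2 \<Rightarrow> 'h"
    and M :: "('h, 'h \<times> 'h) module"
    and \<theta> :: "'h \<times> 'h \<Rightarrow> (('h \<times> 'h \<Rightarrow>\<^sub>0 int) set \<times> ('h \<times> 'h) \<Rightarrow>\<^sub>0 int) set"
    and is_\<Theta> :: "(('h \<times> ('h \<times> 'h) \<Rightarrow>\<^sub>0 int) set \<Rightarrow>
                   (('h \<times> 'h \<Rightarrow>\<^sub>0 int) set \<times> ('h \<times> 'h) \<Rightarrow>\<^sub>0 int) set) \<Rightarrow> bool"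
  assumes H: "is_free_hopf_algebra matrix_coalgebra H \<iota>"
    and a: "\<And>i j. a i j = \<iota> (matrix_coord i j)"
    and M: "M = dsum_module (regular_module H) (regular_module H)"
    and \<theta>: "\<And>k0 k1. \<theta> (k0, k1) =
      ext_tens (ctensor H H) (comult H) H M
        (ctens H H (a 0 0) k0 \<oplus>\<^bsub>ctensor H H\<^esub> ctens H H (a 0 1) k1) (\<one>\<^bsub>H\<^esub>, \<zero>\<^bsub>H\<^esub>)
      \<oplus>\<^bsub>ext_scalars (ctensor H H) (comult H) H M\<^esub>
      ext_tens (ctensor H H) (comult H) H M
        (ctens H H (a 1 0) k0 \<oplus>\<^bsub>ctensor H H\<^esub> ctens H H (a 1 1) k1) (\<zero>\<^bsub>H\<^esub>, \<one>\<^bsub>H\<^esub>)"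
    and is_\<Theta>: "\<And>\<Theta>. is_\<Theta> \<Theta> \<longleftrightarrow>
      \<Theta> \<in> lmod_hom (ctensor H H) (outer_tensor H H M)
             (ext_scalars (ctensor H H) (comult H) H M) \<and>
      \<Theta> \<in> extensional (carrier (outer_tensor H H M)) \<and>
      (\<forall>m\<in>carrier M. \<Theta> (outer_tens H H M \<one>\<^bsub>H\<^esub> m) = \<theta> m)"
  shows "(\<exists>!\<Theta>. is_\<Theta> \<Theta>) \<and>
    (\<forall>\<Theta>. is_\<Theta> \<Theta> \<longrightarrow>
      comult_condition H H (comult H) M \<Theta> \<and>
      counit_condition H H (comult H) M \<Theta> \<and>
      \<Theta> \<notin> lmod_iso (ctensor H H) (outer_tensor H H M)
             (ext_scalars (ctensor H H) (comult H) H M))"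
proof -
  have bialg: "bialgebra H" and \<iota>: "\<iota> \<in> coalgebra_hom matrix_coalgebra H"
    using H by (auto simp: is_free_hopf_algebra_def hopf_algebra_def)
  interpret bialgebra_data H by (rule bialgebra_data.intro[OF bialg])
  interpret comodule2 H a
    by unfold_locales (simp_all add: a coalgebra_hom_matrix_coord[OF \<iota> HA.V])
  \<comment> \<open>The two formulas differ only by b \<otimes> m = b (1 \<otimes> m), which
    rewrites the tensors of the statement as coordinates in the basis of the extended
    module.\<close>
  have th: "\<theta> (k0, k1) = theta k0 k1" if "k0 \<in> carrier H" "k1 \<in> carrier H" for k0 k1
    unfolding \<theta> M theta_def comb2_def
    using that by (simp add: N.et_eq_smult_unit_map HA.tens_closed a_closed M_simps basis_def)
  have iff: "is_\<Theta> \<Theta> \<longleftrightarrow> is_Theta \<Theta>" for \<Theta>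
    unfolding is_\<Theta> is_Theta_def M by (auto simp: M_simps th)
  have "\<Theta> \<notin> lmod_iso (ctensor H H) (outer_tensor H H M) (ext_scalars (ctensor H H) (comult H) H M)"
    if T: "is_\<Theta> \<Theta>" for \<Theta>
  proof
    assume "\<Theta> \<in> lmod_iso (ctensor H H) (outer_tensor H H M) (ext_scalars (ctensor H H) (comult H) H M)"
    then have "\<Theta> ` carrier (outer_tensor H H M) = carrier (ext_scalars (ctensor H H) (comult H) H M)"
      by (simp add: lmod_iso_def bij_betw_def)
    then obtain y0 y1 where "y0 \<in> carrier H" "y1 \<in> carrier H"
      "y0 \<otimes>\<^bsub>H\<^esub> a 0 0 \<oplus>\<^bsub>H\<^esub> y1 \<otimes>\<^bsub>H\<^esub> a 0 1 = \<one>\<^bsub>H\<^esub>" "y0 \<otimes>\<^bsub>H\<^esub> a 1 0 \<oplus>\<^bsub>H\<^esub> y1 \<otimes>\<^bsub>H\<^esub> a 1 1 = \<zero>\<^bsub>H\<^esub>"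
      using surj_imp_left_inverse[OF T[unfolded iff]] unfolding M by blast
    then show False using free_hopf_no_left_inverse[OF H] unfolding a by blast
  qed
  then show ?thesis
    using ex1_Theta comult_condition counit_condition unfolding iff M by blast
qed

end
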